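(* Let $\Omega\subset\mathbb{R}^d$ be convex and compact with non-empty interior, and let $\mathcal{H}$ be equal to the (fractional) Sobolev space $H^m=H^m(\Omega)$ with equivalent norms, where $m>d/2$. Suppose $\sigma^2\in(0,\infty)$ is independent of $n$, $g\in\mathcal H$, $g\ne0$, and the design points $X$ are either deterministic, or random but independent of the random error $E$. Suppose the design satisfies the norm-comparison property, and that: (i) there exist $C_g>0$ and $\delta\in(0,1]$ with $|\langle g,v\rangle_{\mathcal{H}}|\le C_g\|v\|_{L_2}^{\delta}\|v\|_{\mathcal{H}}^{1-\delta}$ for every $v\in\mathcal{H}$; (ii) for some $\tau\in(0,1]$ there exist $C_0>0$, $R_0>0$ such that for each $R\ge R_0$, $$\sup_{v\in\mathcal H:\ \|v\|_{\mathcal H}\le R\|v\|_{L_2}}\frac{\langle g,v\rangle_{\mathcal H}}{\|v\|_{L_2}}>C_0R^{1-\tau}.$$ If $\lambda=o(1)$ and $$\lambda^{-1}=o\Big(n^{\frac{2m}{d+2m(1-\delta/\tau)}}\Big),$$ then $$\frac{1}{\sqrt{\mathrm{VAR}}}\,g^T(X)(K(X,X)+\lambda nI)^{-1}E\ \xrightarrow{\mathscr L}\ N(0,1)\quad\text{as }n\to\infty.$$ In particular, if $\delta=\tau$, the condition on $\lambda^{-1}$ becomes $\lambda^{-1}=o(n^{2m/d})$.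
   Context: Setting: $K$ is a reproducing kernel on $\Omega\subset\mathbb{R}^d$ with reproducing kernel Hilbert space $\mathcal{H}$ (norm $\|\cdot\|_{\mathcal H}$, inner product $\langle\cdot,\cdot\rangle_{\mathcal H}$). For each $n$ there are design points $x_1,\dots,x_n\in\Omega$ (which may depend on $n$), and $e_1,e_2,\dots$ are i.i.d. random errors with mean zero and variance $\sigma^2$. Write $X=(x_1,\dots,x_n)^T$, $E=(e_1,\dots,e_n)^T$, $K(A,B)=(K(a_i,b_j))_{ij}$, $g(X)=(g(x_1),\dots,g(x_n))^T$. The parameter $\lambda=\lambda_n>0$ is deterministic and may depend on $n$; $g$ does not. Define $$\mathrm{VAR}:=\sigma^2g^T(X)(K(X,X)+\lambda nI)^{-2}g(X),$$ the variance with respect to $E$ (with $X$ held fixed) of $g^T(X)(K(X,X)+\lambda nI)^{-1}E$. (The latter quantity equals $\langle\hat f-\mathbb{E}_E\hat f,g\rangle_{\mathcal H}$, where $\hat f=\operatorname{argmin}_{v\in\mathcal{H}}\frac1n\sum_{i=1}^n(y_i-v(x_i))^2+\lambda\|v\|_{\mathcal{H}}^2$ is the kernel ridge regression estimator from $y_i=f(x_i)+e_i$.) Also $\|v\|_n^2=\frac1n\sum_{i=1}^n v(x_i)^2$, $\|\cdot\|_{L_2}$ is the $L_2(\Omega)$ norm, and $\xrightarrow{\mathscr L}$ denotes convergence in distribution. Convention: $0/0=0$. Norm-comparison property of the design: $X$, if random, is independent of $E$; and there is $C_1>0$, and for each $\epsilon>0$ a $C_\epsilon>0$, all independent of $n$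 and $X$, such that $\mathbb{P}(\Xi_\epsilon)\ge1-\epsilon$, where $\Xi_\epsilon$ is the event that, for all $v\in\mathcal H$, $\|v\|_{L_2}\le\max\{C_1\|v\|_n,C_\epsilon n^{-m/d}\|v\|_{\mathcal H}\}$ and $\|v\|_n\le\max\{C_1\|v\|_{L_2},C_\epsilon n^{-m/d}\|v\|_{\mathcal H}\}$ (for deterministic $X$ these inequalities hold unconditionally). *)

theory Defs
  imports
    "HOL-Probability.Probability"
    "HOL-Library.Landau_Symbols"
    "Jordan_Normal_Form.Gauss_Jordan_Elimination"
begin

section \<open>Reproducing kernel Hilbert spaces\<close>

text \<open>
  A function on \<open>\<Omega>\<close> is represented by a total function that is \<open>0\<close> outside \<open>\<Omega>\<close>, so that equality
  of functions on \<open>\<Omega>\<close> is equality in the logic. \<open>H\<close> is the set of functions and \<open>ip\<close> the inner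
  product, which is meaningful on \<open>H\<close> only.
\<close>

definition hnorm :: "(('a \<Rightarrow> real) \<Rightarrow> ('a \<Rightarrow> real) \<Rightarrow> real) \<Rightarrow> ('a \<Rightarrow> real) \<Rightarrow> real" where
  "hnorm ip v = sqrt (ip v v)"

definition function_hilbert_space ::
  "'a set \<Rightarrow> ('a \<Rightarrow> real) set \<Rightarrow> (('a \<Rightarrow> real) \<Rightarrow> ('a \<Rightarrow> real) \<Rightarrow> real) \<Rightarrow> bool" where
  "function_hilbert_space \<Omega> H ip \<longleftrightarrow>
     (\<forall>v\<in>H. \<forall>x. x \<notin> \<Omega> \<longrightarrow> v x = 0) \<and>
     (\<lambda>x. 0) \<in> H \<and>
     (\<forall>v\<in>H. \<forall>w\<in>H. (\<lambda>x. v x + w x) \<in> H) \<and>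
     (\<forall>c. \<forall>v\<in>H. (\<lambda>x. c * v x) \<in> H) \<and>
     (\<forall>v\<in>H. \<forall>w\<in>H. ip v w = ip w v) \<and>
     (\<forall>u\<in>H. \<forall>v\<in>H. \<forall>w\<in>H. ip (\<lambda>x. u x + v x) w = ip u w + ip v w) \<and>
     (\<forall>c. \<forall>v\<in>H. \<forall>w\<in>H. ip (\<lambda>x. c * v x) w = c * ip v w) \<and>
     (\<forall>v\<in>H. v \<noteq> (\<lambda>x. 0) \<longrightarrow> ip v v > 0) \<and>
     (\<forall>s :: nat \<Rightarrow> 'a \<Rightarrow> real. (\<forall>n. s n \<in> H) \<longrightarrow>
        (\<forall>\<epsilon>>0. \<exists>N. \<forall>j\<ge>N. \<forall>k\<ge>N. hnorm ip (\<lambda>x. s j x - s k x) < \<epsilon>) \<longrightarrow>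
        (\<exists>l\<in>H. (\<lambda>n. hnorm ip (\<lambda>x. s n x - l x)) \<longlonglongrightarrow> 0))"

definition rkhs ::
  "'a set \<Rightarrow> ('a \<Rightarrow> 'a \<Rightarrow> real) \<Rightarrow> ('a \<Rightarrow> real) set \<Rightarrow> (('a \<Rightarrow> real) \<Rightarrow> ('a \<Rightarrow> real) \<Rightarrow> real) \<Rightarrow> bool"
  where
  "rkhs \<Omega> K H ip \<longleftrightarrow> function_hilbert_space \<Omega> H ip \<and>
     (\<forall>x\<in>\<Omega>. (\<lambda>y. if y \<in> \<Omega> then K y x else 0) \<in> H \<and>
        (\<forall>v\<in>H. ip v (\<lambda>y. if y \<in> \<Omega> then K y x else 0) = v x))"

section \<open>Fractional Sobolev spaces\<close>

definition truncated_fourier :: "('a::euclidean_space \<Rightarrow> real) \<Rightarrow> real \<Rightarrow> 'a \<Rightarrow> complex" where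
  "truncated_fourier f R \<xi> =
     of_real ((2 * pi) powr (- real DIM('a) / 2)) *
     set_lebesgue_integral lborel (cball 0 R) (\<lambda>x. of_real (f x) * cis (- inner \<xi> x))"

text \<open>
  \<open>F\<close> is the Fourier--Plancherel transform of the square integrable function \<open>f\<close>: the limit in the
  mean of the truncated Fourier integrals. It is determined up to a null set.
\<close>

definition is_L2_fourier :: "('a::euclidean_space \<Rightarrow> real) \<Rightarrow> ('a \<Rightarrow> complex) \<Rightarrow> bool" where
  "is_L2_fourier f F \<longleftrightarrow>
     F \<in> borel_measurable lborel \<and> integrable lborel (\<lambda>\<xi>. (cmod (F \<xi>))\<^sup>2) \<and>
     ((\<lambda>R. \<integral>\<^sup>+ \<xi>. ennreal ((cmod (F \<xi> - truncated_fourier f R \<xi>))\<^sup>2) \<partial>lborel) \<longlongrightarrow> 0) at_top"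

definition L2_fourier :: "('a::euclidean_space \<Rightarrow> real) \<Rightarrow> 'a \<Rightarrow> complex" where
  "L2_fourier f = (SOME F. is_L2_fourier f F)"

text \<open>
  The space \<open>H\<^sup>m\<close> on the whole space. For \<open>m > d / 2\<close>, the only case used, the Sobolev embedding theorem
  says that every class of square integrable functions in \<open>H\<^sup>m\<close> has exactly one continuous representative,
  and this representative stands for the class.
\<close>

definition sobolev_space :: "real \<Rightarrow> ('a::euclidean_space \<Rightarrow> real) set" where
  "sobolev_space m = {f. continuous_on UNIV f \<and> integrable lborel (\<lambda>x. (f x)\<^sup>2) \<and>
     (\<exists>F. is_L2_fourier f F \<and>
        integrable lborel (\<lambda>\<xi>. (1 + (norm \<xi>)\<^sup>2) powr m * (cmod (F \<xi>))\<^sup>2))}"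

definition sobolev_norm :: "real \<Rightarrow> ('a::euclidean_space \<Rightarrow> real) \<Rightarrow> real" where
  "sobolev_norm m f =
     sqrt (\<integral>\<xi>. (1 + (norm \<xi>)\<^sup>2) powr m * (cmod (L2_fourier f \<xi>))\<^sup>2 \<partial>lborel)"

text \<open>The space \<open>H\<^sup>m(\<Omega>)\<close> consists of restrictions to \<open>\<Omega>\<close> and carries the quotient norm.\<close>

definition sobolev_extensions :: "real \<Rightarrow> 'a set \<Rightarrow> ('a::euclidean_space \<Rightarrow> real) \<Rightarrow> ('a \<Rightarrow> real) set"
  where "sobolev_extensions m \<Omega> v = {f \<in> sobolev_space m. \<forall>x\<in>\<Omega>. f x = v x}"

definition sobolev_space_on :: "real \<Rightarrow> 'a set \<Rightarrow> ('a::euclidean_space \<Rightarrow> real) set" where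
  "sobolev_space_on m \<Omega> = {v. (\<forall>x. x \<notin> \<Omega> \<longrightarrow> v x = 0) \<and> sobolev_extensions m \<Omega> v \<noteq> {}}"

definition sobolev_norm_on :: "real \<Rightarrow> 'a set \<Rightarrow> ('a::euclidean_space \<Rightarrow> real) \<Rightarrow> real" where
  "sobolev_norm_on m \<Omega> v = (INF f\<in>sobolev_extensions m \<Omega> v. sobolev_norm m f)"

definition equals_sobolev ::
  "real \<Rightarrow> 'a::euclidean_space set \<Rightarrow> ('a \<Rightarrow> real) set \<Rightarrow> (('a \<Rightarrow> real) \<Rightarrow> ('a \<Rightarrow> real) \<Rightarrow> real) \<Rightarrow> bool"
  where
  "equals_sobolev m \<Omega> H ip \<longleftrightarrow> H = sobolev_space_on m \<Omega> \<and>
     (\<exists>c>0. \<exists>C>0. \<forall>v\<in>H. c * sobolev_norm_on m \<Omega> v \<le> hnorm ip v \<and>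
                        hnorm ip v \<le> C * sobolev_norm_on m \<Omega> v)"

section \<open>Design and errors\<close>

definition L2_norm_on :: "'a::euclidean_space set \<Rightarrow> ('a \<Rightarrow> real) \<Rightarrow> real" where
  "L2_norm_on \<Omega> v = sqrt (set_lebesgue_integral lborel \<Omega> (\<lambda>x. (v x)\<^sup>2))"

definition empirical_norm :: "nat \<Rightarrow> (nat \<Rightarrow> 'a) \<Rightarrow> ('a \<Rightarrow> real) \<Rightarrow> real" where
  "empirical_norm n x v = sqrt ((\<Sum>i<n. (v (x i))\<^sup>2) / real n)"

text \<open>
  The design points of sample size \<open>n\<close> are \<open>x n 0, \<dots>, x n (n - 1)\<close>, and the errors are \<open>e 0, e 1, \<dots>\<close>.
  A deterministic design is one for which \<open>x n i\<close> is constant: it is independent of the errors, and the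
  event below, being empty or the whole space, has probability at least \<open>1 - \<epsilon>\<close> for an \<open>\<epsilon> < 1\<close> only if
  the inequalities hold unconditionally.
\<close>

definition norm_comparison ::
  "'w measure \<Rightarrow> 'a::euclidean_space set \<Rightarrow> ('a \<Rightarrow> real) set \<Rightarrow> (('a \<Rightarrow> real) \<Rightarrow> ('a \<Rightarrow> real) \<Rightarrow> real)
    \<Rightarrow> real \<Rightarrow> (nat \<Rightarrow> nat \<Rightarrow> 'w \<Rightarrow> 'a) \<Rightarrow> bool" where
  "norm_comparison M \<Omega> H ip m x \<longleftrightarrow>
     (\<exists>C1>0. \<forall>\<epsilon>>0. \<exists>C\<epsilon>>0. \<forall>n\<ge>1.
        measure M {\<omega> \<in> space M. \<forall>v\<in>H.
          L2_norm_on \<Omega> v \<le> max (C1 * empirical_norm n (\<lambda>i. x n i \<omega>) v)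
                               (C\<epsilon> * real n powr (- m / real DIM('a)) * hnorm ip v) \<and>
          empirical_norm n (\<lambda>i. x n i \<omega>) v \<le> max (C1 * L2_norm_on \<Omega> v)
                               (C\<epsilon> * real n powr (- m / real DIM('a)) * hnorm ip v)}
        \<ge> 1 - \<epsilon>)"

definition random_design ::
  "'w measure \<Rightarrow> 'a::euclidean_space set \<Rightarrow> (nat \<Rightarrow> nat \<Rightarrow> 'w \<Rightarrow> 'a) \<Rightarrow> bool" where
  "random_design M \<Omega> x \<longleftrightarrow>
     (\<forall>n. \<forall>i<n. x n i \<in> borel_measurable M \<and> (\<forall>\<omega>\<in>space M. x n i \<omega> \<in> \<Omega>))"

text \<open>
  Independence of the vectors \<open>X\<close> and \<open>E\<close>, that is of the sigma-algebras they generate; the library's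
  \<open>indep_var\<close> requires random variables with values in the same type.
\<close>

definition design_indep_errors ::
  "'w measure \<Rightarrow> (nat \<Rightarrow> nat \<Rightarrow> 'w \<Rightarrow> 'a::euclidean_space) \<Rightarrow> (nat \<Rightarrow> 'w \<Rightarrow> real) \<Rightarrow> bool" where
  "design_indep_errors M x e \<longleftrightarrow>
     (\<forall>n. prob_space.indep_set M
        (sets (vimage_algebra (space M) (\<lambda>\<omega>. \<lambda>i\<in>{..<n}. x n i \<omega>) (\<Pi>\<^sub>M i\<in>{..<n}. borel)))
        (sets (vimage_algebra (space M) (\<lambda>\<omega>. \<lambda>i\<in>{..<n}. e i \<omega>) (\<Pi>\<^sub>M i\<in>{..<n}. borel))))"

definition iid_errors :: "'w measure \<Rightarrow> (nat \<Rightarrow> 'w \<Rightarrow> real) \<Rightarrow> real \<Rightarrow> bool" where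
  "iid_errors M e \<sigma> \<longleftrightarrow>
     prob_space.indep_vars M (\<lambda>_. borel) e UNIV \<and>
     (\<forall>i. distr M borel (e i) = distr M borel (e 0)) \<and>
     (\<forall>i. integrable M (e i) \<and> integral\<^sup>L M (e i) = 0) \<and>
     (\<forall>i. integrable M (\<lambda>\<omega>. (e i \<omega>)\<^sup>2) \<and> prob_space.variance M (e i) = \<sigma>\<^sup>2)"

section \<open>The regression functional and its variance\<close>

definition kernel_mat :: "('a \<Rightarrow> 'a \<Rightarrow> real) \<Rightarrow> nat \<Rightarrow> (nat \<Rightarrow> 'a) \<Rightarrow> real mat" where
  "kernel_mat K n x = mat n n (\<lambda>(i, j). K (x i) (x j))"

definition ridge_inverse :: "('a \<Rightarrow> 'a \<Rightarrow> real) \<Rightarrow> real \<Rightarrow> nat \<Rightarrow> (nat \<Rightarrow> 'a) \<Rightarrow> real mat" where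
  "ridge_inverse K l n x = the (mat_inverse (kernel_mat K n x + (l * real n) \<cdot>\<^sub>m 1\<^sub>m n))"

text \<open>The variance of \<open>noise_functional\<close> below with respect to the errors, with \<open>x\<close> held fixed.\<close>

definition VAR :: "('a \<Rightarrow> 'a \<Rightarrow> real) \<Rightarrow> ('a \<Rightarrow> real) \<Rightarrow> real \<Rightarrow> real \<Rightarrow> nat \<Rightarrow> (nat \<Rightarrow> 'a) \<Rightarrow> real" where
  "VAR K g \<sigma> l n x = \<sigma>\<^sup>2 *
     scalar_prod (vec n (\<lambda>i. g (x i)))
       ((ridge_inverse K l n x ^\<^sub>m 2) *\<^sub>v vec n (\<lambda>i. g (x i)))"

definition noise_functional ::
  "('a \<Rightarrow> 'a \<Rightarrow> real) \<Rightarrow> ('a \<Rightarrow> real) \<Rightarrow> real \<Rightarrow> nat \<Rightarrow> (nat \<Rightarrow> 'a) \<Rightarrow> (nat \<Rightarrow> real) \<Rightarrow> real" where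
  "noise_functional K g l n x \<epsilon> =
     scalar_prod (vec n (\<lambda>i. g (x i))) (ridge_inverse K l n x *\<^sub>v vec n \<epsilon>)"

end

theory Submission
  imports
    Defs
    "HOL-Real_Asymp.Real_Asymp"
    "Jordan_Normal_Form.Determinant"
begin

text \<open>
With \<open>w = (K(X,X) + \<lambda> n I)\<^sup>-\<^sup>1 g(X)\<close> the functional is \<open>\<Sum>i<n. w i * e i\<close> and its variance is \<open>\<sigma>\<^sup>2 |w|\<^sup>2\<close>.
So the claim is a central limit theorem for sums of independent errors with weights that depend on the
design only, and it holds as soon as no single weight dominates: \<open>max |w i| / |w| \<rightarrow> 0\<close> in probability
(\<open>random_weights_clt\<close>, by characteristic functions, conditionally on the design).

The weights are small because they are values of a smooth function. Let \<open>r\<close> be the residual of \<open>g\<close>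
after noiseless kernel ridge regression on \<open>g(X)\<close>. Then \<open>r (x i) = \<lambda> n w i\<close>, so that
\<open>max |w i| / |w| = max |r (x i)| / (sqrt n * |r|_n)\<close>, where \<open>|r|_n\<close> is the empirical norm, and \<open>r\<close> solves the
variational equation \<open>\<langle>r,v\<rangle>_n + \<lambda> \<langle>r,v\<rangle> = \<lambda> \<langle>g,v\<rangle>\<close> for all \<open>v \<in> H\<close> (\<open>ridge_residual\<close>). Three facts control \<open>r\<close>.

\<^item> The equation at \<open>v = r\<close> and condition (i) give \<open>|r|_H = O(\<lambda>\<^bsup>\<delta>/2\<^esup>)\<close> (\<open>residual_hnorm_bound\<close>).

\<^item> The equation at an almost maximal \<open>v\<close> of condition (ii) bounds \<open>|r|_n\<close> from below
  (\<open>residual_empirical_lower_bound\<close>). The larger \<open>R\<close>, the better the bound; \<open>R\<close> may grow up to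
  \<open>min (n\<^bsup>m/d\<^esup>) (c \<lambda>\<^bsup>-\<delta>/(2\<tau>)\<^esup>)\<close>: beyond the first term the empirical and the \<open>L\<^sub>2\<close> norm cease to be
  comparable, beyond the second the term \<open>\<lambda> \<langle>r,v\<rangle>\<close> is no longer negligible. Together,
  \<open>|r|_H / |r|_n = O(1 / (\<lambda> R))\<close>, and the growth condition on \<open>1/\<lambda>\<close> makes this \<open>o(n\<^bsup>m/d\<^esup>)\<close> (\<open>ridge_rates\<close>).

\<^item> A function in \<open>H\<close> satisfies \<open>|v(x)| \<le> S (h\<^bsup>-d/2\<^esup> |v|_L2 + h\<^bsup>m-d/2\<^esup> |v|_H)\<close> for all \<open>h \<le> 1\<close>
  (\<open>sobolev_pointwise_bound\<close>). With \<open>v = r\<close> and \<open>h = T n\<^bsup>-1/d\<^esup>\<close>, the right-hand side is at most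
  \<open>sqrt n * |r|_n * (O(T\<^bsup>-d/2\<^esup>) + T\<^bsup>m-d/2\<^esup> o(1))\<close> (\<open>residual_spread\<close>), and \<open>T\<close> is arbitrary.

The pointwise bound is obtained without extension operators or interpolation of spaces. The value
\<open>v(x)\<close> is compared with values of \<open>v\<close> at \<open>x + (j h/k) y\<close>, \<open>1 \<le> j \<le> k\<close>, through a \<open>k\<close>-th finite difference, where \<open>x + y\<close>
runs over a fixed ball in \<open>\<Omega>\<close>; convexity keeps all these points in \<open>\<Omega>\<close>. The averages over the ball
are bounded by the \<open>L\<^sub>2\<close> norm on \<open>\<Omega>\<close>. The finite difference itself is bounded through the Fourier transform of an
arbitrary extension of \<open>v\<close>, since its symbol is \<open>(1 - exp (i h \<langle>y,\<xi>\<rangle> / k))\<^sup>k\<close>. This needs Fourier inversion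
for continuous \<open>L\<^sub>2\<close> functions whose transform, a limit in the mean, is integrable (\<open>fourier_inversion\<close>).
\<close>

section \<open>Gaussian integrals on Euclidean space\<close>

lemma borel_measurable_cis [measurable]: "cis \<in> borel_measurable borel"
  by (intro borel_measurable_continuous_onI continuous_intros)

lemma coordinate_product_lborel:
  fixes f :: "'a::euclidean_space \<Rightarrow> real \<Rightarrow> 'b::{real_normed_field,banach,second_countable_topology}"
  assumes f: "\<And>b. b \<in> Basis \<Longrightarrow> integrable lborel (f b)"
  shows integrable_lborel_prod: "integrable lborel (\<lambda>x::'a. \<Prod>b\<in>Basis. f b (inner x b))"
    and integral_lborel_prod:
      "(\<integral>x. (\<Prod>b\<in>Basis. f b (inner x b)) \<partial>(lborel::'a measure)) = (\<Prod>b\<in>Basis. (\<integral>t. f b t \<partial>lborel))"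
proof -
  interpret product_sigma_finite "\<lambda>b::'a. lborel :: real measure" ..
  have [measurable]: "f b \<in> borel_measurable borel" if "b \<in> Basis" for b
    using f[OF that] by (auto dest: borel_measurable_integrable)
  let ?T = "\<lambda>y :: 'a \<Rightarrow> real. \<Sum>b\<in>Basis. y b *\<^sub>R b"
  let ?g = "\<lambda>x::'a. \<Prod>b\<in>Basis. f b (inner x b)"
  have T: "?T \<in> (\<Pi>\<^sub>M b\<in>Basis. lborel) \<rightarrow>\<^sub>M borel" by simp
  have g: "?g \<in> borel_measurable borel" by measurable
  have gT: "?g (?T y) = (\<Prod>b\<in>Basis. f b (y b))" for y
    by (intro prod.cong refl) simp
  have "integrable (\<Pi>\<^sub>M b\<in>Basis. lborel) (\<lambda>y. \<Prod>b\<in>Basis. f b (y b))"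
    using f by (intro product_integrable_prod) auto
  then show "integrable lborel ?g"
    by (subst lborel_eq, subst integrable_distr_eq[OF T g]) (simp add: gT)
  show "(\<integral>x. ?g x \<partial>lborel) = (\<Prod>b\<in>Basis. (\<integral>t. f b t \<partial>lborel))"
    by (subst lborel_eq, subst integral_distr[OF T g], subst gT)
       (rule product_integral_prod[OF finite_Basis f])
qed

lemma integrable_one_plus_square_powr:
  fixes s :: real
  assumes s: "s > 1/2"
  shows "integrable lborel (\<lambda>t::real. (1 + t\<^sup>2) powr (-s))"
proof -
  let ?p = "\<lambda>t::real. ennreal (t powr (-2 * s)) * indicator {1..} t"
  have tail: "(\<integral>\<^sup>+t. ?p t \<partial>lborel) = ennreal (0 - 1 powr (1-2 * s) / (1-2 * s))"
  proof (rule nn_integral_FTC_atLeast[where F = "\<lambda>t. t powr (1-2 * s) / (1-2 * s)"])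
    fix t :: real assume "1 \<le> t"
    then show "((\<lambda>t. t powr (1-2 * s) / (1-2 * s)) has_real_derivative t powr (-2 * s)) (at t)"
      using s DERIV_cdivide[OF has_real_derivative_powr[of t "1 - 2 * s"], of "1 - 2 * s"] by simp
  next
    have "((\<lambda>t::real. t powr (1-2 * s)) \<longlongrightarrow> 0) at_top"
      using s by (intro tendsto_neg_powr filterlim_ident) auto
    from tendsto_divide[OF this tendsto_const[of "1-2 * s"]]
    show "((\<lambda>t::real. t powr (1-2 * s) / (1-2 * s)) \<longlongrightarrow> 0) at_top" using s by simp
  qed auto
  have "(\<integral>\<^sup>+t. ?p (-t) \<partial>lborel) = (\<integral>\<^sup>+t. ?p t \<partial>lborel)"
    by (subst (2) nn_integral_real_affine[where c="-1" and t=0]) auto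
  moreover have "(\<integral>\<^sup>+t. ennreal ((1 + t\<^sup>2) powr (-s)) \<partial>lborel)
      \<le> (\<integral>\<^sup>+t. indicator {-1..1} t + ?p t + ?p (-t) \<partial>lborel)"
  proof (intro nn_integral_mono)
    fix t :: real
    have 1: "(1 + t\<^sup>2) powr (-s) \<le> 1"
      using powr_mono2'[of "- s" 1 "1 + t\<^sup>2"] s by simp
    have 2: "(1 + t\<^sup>2) powr (-s) \<le> \<bar>t\<bar> powr (-2 * s)" if "t \<noteq> 0"
    proof -
      have "(1 + t\<^sup>2) powr (-s) \<le> (t\<^sup>2) powr (-s)"
        using s that by (intro powr_mono2') auto
      also have "(t\<^sup>2) powr (-s) = (\<bar>t\<bar> powr 2) powr (-s)" using that by simp
      also have "\<dots> = \<bar>t\<bar> powr (-2 * s)" by (subst powr_powr) simp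
      finally show ?thesis .
    qed
    consider "\<bar>t\<bar> \<le> 1" | "t > 1" | "t < -1" by linarith
    then show "ennreal ((1 + t\<^sup>2) powr (-s)) \<le> indicator {-1..1} t + ?p t + ?p (-t)"
    proof cases
      case 1
      then have "t \<in> {-1..1}" unfolding atLeastAtMost_iff by linarith
      then have "(indicator {-1..1} t :: ennreal) = 1" by simp
      then have "(1::ennreal) \<le> indicator {-1..1} t + ?p t + ?p (-t)"
        by (simp only: add.assoc) (simp only: add_increasing2 zero_le order_refl)
      moreover have "ennreal ((1 + t\<^sup>2) powr (-s)) \<le> 1" using \<open>(1 + t\<^sup>2) powr (-s) \<le> 1\<close> by simp
      ultimately show ?thesis by (rule order_trans[rotated])
    qed (use 2 in \<open>auto intro!: ennreal_leI\<close>)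
  qed
  moreover have "\<dots> = (\<integral>\<^sup>+t. indicator {-1..1::real} t \<partial>lborel) + (\<integral>\<^sup>+t. ?p t \<partial>lborel) + (\<integral>\<^sup>+t. ?p (-t) \<partial>lborel)"
    by (simp add: nn_integral_add)
  ultimately have "(\<integral>\<^sup>+t. ennreal ((1 + t\<^sup>2) powr (-s)) \<partial>lborel) < \<infinity>"
    using tail by (auto simp: top_unique less_top[symmetric])
  then show ?thesis by (intro integrableI_nonneg) auto
qed

text \<open>
  The integrand is at most the product over the coordinates \<open>b\<close> of \<open>(1 + \<xi>\<^sub>b\<^sup>2)\<^bsup>-m/d\<^esup>\<close>, because
  \<open>1 + |\<xi>|\<^sup>2 \<ge> 1 + \<xi>\<^sub>b\<^sup>2\<close> for each of the \<open>d\<close> coordinates. In one dimension the exponent \<open>m/d > 1/2\<close> suffices.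
\<close>

lemma integrable_one_plus_norm_square_powr:
  fixes m :: real
  assumes m: "m > real DIM('a) / 2"
  shows "integrable lborel (\<lambda>\<xi>::'a::euclidean_space. (1 + (norm \<xi>)\<^sup>2) powr (-m))"
proof (rule Bochner_Integration.integrable_bound)
  let ?s = "m / real DIM('a)"
  show "integrable lborel (\<lambda>\<xi>::'a. \<Prod>b\<in>Basis. (1 + (inner \<xi> b)\<^sup>2) powr (-?s))"
    using m by (intro integrable_lborel_prod integrable_one_plus_square_powr) (simp add: field_simps)
  show "AE \<xi> in (lborel :: 'a measure). norm ((1 + (norm \<xi>)\<^sup>2) powr (-m))
      \<le> norm (\<Prod>b\<in>Basis. (1 + (inner \<xi> b)\<^sup>2) powr (-?s))"
  proof (intro AE_I2)
    fix \<xi> :: 'a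
    have "(1 + (norm \<xi>)\<^sup>2) powr (-m) = ((1 + (norm \<xi>)\<^sup>2) powr (-?s)) ^ DIM('a)"
      by (subst powr_power) (auto simp: add_nonneg_eq_0_iff)
    also have "\<dots> = (\<Prod>b\<in>(Basis::'a set). (1 + (norm \<xi>)\<^sup>2) powr (-?s))" by simp
    also have "\<dots> \<le> (\<Prod>b\<in>Basis. (1 + (inner \<xi> b)\<^sup>2) powr (-?s))"
    proof (intro prod_mono conjI powr_mono2')
      fix b :: 'a assume "b \<in> Basis"
      then have "\<bar>inner \<xi> b\<bar> \<le> norm \<xi>" by (rule Basis_le_norm)
      then have "(inner \<xi> b)\<^sup>2 \<le> (norm \<xi>)\<^sup>2" by (metis abs_le_square_iff abs_norm_cancel)
      then show "1 + (inner \<xi> b)\<^sup>2 \<le> 1 + (norm \<xi>)\<^sup>2" by simp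
    qed (use m in \<open>auto simp: add_pos_nonneg divide_nonpos_pos\<close>)
    finally show "norm ((1 + (norm \<xi>)\<^sup>2) powr (-m))
      \<le> norm (\<Prod>b\<in>Basis. (1 + (inner \<xi> b)\<^sup>2) powr (-?s))" by (simp add: abs_prod)
  qed
qed measurable

text \<open>
  A rescaling of the characteristic function of the standard normal distribution.
\<close>

lemma gaussian_fourier_real:
  fixes \<epsilon> z :: real
  assumes \<epsilon>: "\<epsilon> > 0"
  shows "integrable lborel (\<lambda>t. of_real (exp (- \<epsilon> * t\<^sup>2 / 2)) * cis (z * t))"
    and "(\<integral>t. of_real (exp (- \<epsilon> * t\<^sup>2 / 2)) * cis (z * t) \<partial>lborel)
      = complex_of_real (sqrt (2 * pi / \<epsilon>) * exp (- z\<^sup>2 / (2 * \<epsilon>)))"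
proof -
  let ?s = "sqrt \<epsilon>"
  have s: "?s > 0" using \<epsilon> by simp
  have i: "integrable lborel (\<lambda>u. complex_of_real (std_normal_density u) * cis (w * u))" for w
  proof (rule Bochner_Integration.integrable_bound)
    show "integrable lborel std_normal_density" by simp
  qed (auto simp: norm_mult)
  have c: "(\<integral>u. complex_of_real (std_normal_density u) * cis (w * u) \<partial>lborel) = exp (- w\<^sup>2 / 2)" for w
  proof -
    have "char std_normal_distribution w = (\<integral>u. std_normal_density u *\<^sub>R cis (w * u) \<partial>lborel)"
      unfolding char_def cis_conv_exp
      by (subst integral_density) (auto simp: normal_density_nonneg)
    then show ?thesis unfolding char_std_normal_distribution
      by (simp add: scaleR_conv_of_real exp_of_real)
  qed
  have eq: "complex_of_real (exp (- \<epsilon> * t\<^sup>2 / 2)) * cis (z * t)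
     = of_real (sqrt (2 * pi)) * (complex_of_real (std_normal_density (0 + ?s * t)) * cis (z / ?s * (0 + ?s * t)))" for t
    using \<epsilon> by (simp add: std_normal_density_def power_mult_distrib)
  show "integrable lborel (\<lambda>t. of_real (exp (- \<epsilon> * t\<^sup>2 / 2)) * cis (z * t))"
    unfolding eq using s
    by (intro integrable_mult_right lborel_integrable_real_affine[OF i]) auto
  have "(\<integral>t. of_real (exp (- \<epsilon> * t\<^sup>2 / 2)) * cis (z * t) \<partial>lborel)
     = of_real (sqrt (2 * pi)) * (\<integral>t. complex_of_real (std_normal_density (0 + ?s * t)) * cis (z / ?s * (0 + ?s * t)) \<partial>lborel)"
    unfolding eq by simp
  also have "(\<integral>t. complex_of_real (std_normal_density (0 + ?s * t)) * cis (z / ?s * (0 + ?s * t)) \<partial>lborel)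
     = (1 / ?s) *\<^sub>R exp (- (z / ?s)\<^sup>2 / 2)"
    using lborel_integral_real_affine[of ?s "\<lambda>u. complex_of_real (std_normal_density u) * cis (z / ?s * u)" 0] s
    unfolding c by (simp add: field_simps scaleR_conv_of_real)
  finally show "(\<integral>t. of_real (exp (- \<epsilon> * t\<^sup>2 / 2)) * cis (z * t) \<partial>lborel)
      = complex_of_real (sqrt (2 * pi / \<epsilon>) * exp (- z\<^sup>2 / (2 * \<epsilon>)))"
    using \<epsilon> by (simp add: scaleR_conv_of_real real_sqrt_divide power_divide field_simps exp_of_real)
qed

lemma norm_square_eq_sum: "(norm (x::'a::euclidean_space))\<^sup>2 = (\<Sum>b\<in>Basis. (inner x b)\<^sup>2)"
  unfolding power2_norm_eq_inner by (subst euclidean_inner) (simp add: power2_eq_square)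

lemma prod_cis: "finite A \<Longrightarrow> (\<Prod>b\<in>A. cis (f b)) = cis (\<Sum>b\<in>A. f b)"
  by (induction A rule: finite_induct) (auto simp: cis_mult)

lemma gaussian_fourier:
  fixes z :: "'a::euclidean_space" and \<epsilon> :: real
  assumes \<epsilon>: "\<epsilon> > 0"
  shows "integrable lborel (\<lambda>\<xi>::'a. of_real (exp (- \<epsilon> * (norm \<xi>)\<^sup>2 / 2)) * cis (inner z \<xi>))" (is ?A)
    and "(\<integral>\<xi>. of_real (exp (- \<epsilon> * (norm \<xi>)\<^sup>2 / 2)) * cis (inner z \<xi>) \<partial>(lborel::'a measure))
      = complex_of_real (sqrt (2 * pi / \<epsilon>) ^ DIM('a) * exp (- (norm z)\<^sup>2 / (2 * \<epsilon>)))" (is ?B)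
proof -
  have eq: "complex_of_real (exp (- \<epsilon> * (norm \<xi>)\<^sup>2 / 2)) * cis (inner z \<xi>)
     = (\<Prod>b\<in>Basis. of_real (exp (- \<epsilon> * (inner \<xi> b)\<^sup>2 / 2)) * cis (inner z b * inner \<xi> b))" for \<xi>
    by (subst euclidean_inner)
       (simp add: prod.distrib prod_cis norm_square_eq_sum exp_sum[symmetric] sum_distrib_left
          sum_divide_distrib sum_negf flip: of_real_prod)
  show ?A unfolding eq by (intro integrable_lborel_prod gaussian_fourier_real \<epsilon>)
  show ?B unfolding eq
    by (subst integral_lborel_prod[OF gaussian_fourier_real(1)[OF \<epsilon>]], unfold gaussian_fourier_real(2)[OF \<epsilon>])
       (simp_all add: prod.distrib norm_square_eq_sum exp_sum[symmetric] sum_divide_distrib sum_negf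
         flip: of_real_prod)
qed

section \<open>Fourier inversion\<close>

text \<open>
  The Cauchy--Schwarz inequality for Bochner integrals, transferred from nonnegative integrals.
\<close>

lemma lebesgue_cauchy_schwarz:
  fixes f g :: "'b \<Rightarrow> real"
  assumes [measurable]: "f \<in> borel_measurable M" "g \<in> borel_measurable M"
    and f: "integrable M (\<lambda>x. (f x)\<^sup>2)" and g: "integrable M (\<lambda>x. (g x)\<^sup>2)"
  shows "integrable M (\<lambda>x. f x * g x)"
    and "(\<integral>x. \<bar>f x * g x\<bar> \<partial>M) \<le> sqrt (\<integral>x. (f x)\<^sup>2 \<partial>M) * sqrt (\<integral>x. (g x)\<^sup>2 \<partial>M)"
proof -
  show *: "integrable M (\<lambda>x. f x * g x)"
  proof (rule Bochner_Integration.integrable_bound)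
    show "integrable M (\<lambda>x. (f x)\<^sup>2 + (g x)\<^sup>2)"
      by (intro Bochner_Integration.integrable_add f g)
    have "\<bar>a * b\<bar> \<le> a\<^sup>2 + b\<^sup>2" for a b :: real
      using sum_squares_bound[of "\<bar>a\<bar>" "\<bar>b\<bar>"] abs_ge_zero[of "a * b"]
      unfolding power2_abs mult.assoc abs_mult by linarith
    then show "AE x in M. norm (f x * g x) \<le> norm ((f x)\<^sup>2 + (g x)\<^sup>2)"
      by (auto intro!: AE_I2 intro: order_trans)
  qed simp
  have "ennreal (\<integral>x. \<bar>f x * g x\<bar> \<partial>M) = (\<integral>\<^sup>+x. ennreal \<bar>f x * g x\<bar> \<partial>M)"
    using * by (intro nn_integral_eq_integral[symmetric]) auto
  then have "ennreal ((\<integral>x. \<bar>f x * g x\<bar> \<partial>M)\<^sup>2) = (\<integral>\<^sup>+x. ennreal \<bar>f x\<bar> * ennreal \<bar>g x\<bar> \<partial>M)\<^sup>2"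
    by (subst ennreal_power[symmetric]) (simp_all add: abs_mult ennreal_mult)
  also have "\<dots> \<le> (\<integral>\<^sup>+x. (ennreal \<bar>f x\<bar>)\<^sup>2 \<partial>M) * (\<integral>\<^sup>+x. (ennreal \<bar>g x\<bar>)\<^sup>2 \<partial>M)"
    by (rule Cauchy_Schwarz_nn_integral) auto
  also have "\<dots> = ennreal ((\<integral>x. (f x)\<^sup>2 \<partial>M) * (\<integral>x. (g x)\<^sup>2 \<partial>M))"
    using f g by (simp add: ennreal_power nn_integral_eq_integral ennreal_mult)
  finally have "(\<integral>x. \<bar>f x * g x\<bar> \<partial>M)\<^sup>2 \<le> (\<integral>x. (f x)\<^sup>2 \<partial>M) * (\<integral>x. (g x)\<^sup>2 \<partial>M)"
    by (subst (asm) ennreal_le_iff) auto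
  then show "(\<integral>x. \<bar>f x * g x\<bar> \<partial>M) \<le> sqrt (\<integral>x. (f x)\<^sup>2 \<partial>M) * sqrt (\<integral>x. (g x)\<^sup>2 \<partial>M)"
    by (metis real_le_rsqrt real_sqrt_mult)
qed

lemma measurable_truncated_fourier [measurable]:
  fixes f :: "'a::euclidean_space \<Rightarrow> real"
  assumes [measurable]: "f \<in> borel_measurable borel"
  shows "truncated_fourier f R \<in> borel_measurable borel"
proof -
  have [measurable]: "cball (0::'a) R \<in> sets borel" by simp
  show ?thesis
    unfolding truncated_fourier_def set_lebesgue_integral_def
    by (intro borel_measurable_times borel_measurable_const
        lborel.borel_measurable_lebesgue_integral[where N = borel]) measurable
qed

text \<open>
  The normalisation constant of the unitary Fourier transform.
\<close>

definition fourier_const :: "'a::euclidean_space itself \<Rightarrow> real" where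
  "fourier_const _ = (2 * pi) powr (- real DIM('a) / 2)"

text \<open>
  Multiplying the transform by a modulated Gaussian and integrating mollifies the function: by Fubini,
  the Gaussian may be transformed instead. The truncation makes both sides absolutely integrable.
\<close>

lemma truncated_fourier_gaussian:
  fixes f :: "'a::euclidean_space \<Rightarrow> real" and \<epsilon> R :: real and x :: 'a
  assumes f: "continuous_on UNIV f" and \<epsilon>: "\<epsilon> > 0"
  defines "G \<equiv> \<lambda>\<xi>. of_real (exp (- \<epsilon> * (norm \<xi>)\<^sup>2 / 2)) * cis (inner x \<xi>)"
  defines "P \<equiv> \<lambda>y. sqrt (2 * pi / \<epsilon>) ^ DIM('a) * exp (- (norm (x - y))\<^sup>2 / (2 * \<epsilon>))"
  shows "integrable lborel (\<lambda>\<xi>. truncated_fourier f R \<xi> * G \<xi>)"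
    and "(\<integral>\<xi>. truncated_fourier f R \<xi> * G \<xi> \<partial>lborel) =
      of_real (fourier_const TYPE('a) * (\<integral>y. indicator (cball 0 R) y * f y *
         P y \<partial>lborel))"
proof -
  have fm [measurable]: "f \<in> borel_measurable borel"
    using f by (rule borel_measurable_continuous_onI)
  have fi: "integrable lborel (\<lambda>y. indicator (cball 0 R) y * f y)"
    using borel_integrable_compact[OF compact_cball, of 0 R f] f by (auto intro: continuous_on_subset)
  have [measurable]: "cball (0::'a) R \<in> sets borel" by simp
  define h where "h \<xi> y = complex_of_real (indicator (cball 0 R) y * f y) * cis (- inner \<xi> y) * G \<xi>" for \<xi> y
  have G_norm: "cmod (G \<xi>) = exp (- \<epsilon> * (norm \<xi>)\<^sup>2 / 2)" for \<xi> by (simp add: G_def norm_mult)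
  have Gi: "integrable lborel G" unfolding G_def by (rule gaussian_fourier[OF \<epsilon>])
  have [measurable]: "G \<in> borel_measurable borel" using Gi by (auto dest: borel_measurable_integrable)
  have hm: "case_prod h \<in> borel_measurable (lborel \<Otimes>\<^sub>M lborel)"
    unfolding h_def by measurable
  have hn: "cmod (h \<xi> y) = cmod (G \<xi>) * \<bar>indicator (cball 0 R) y * f y\<bar>" for \<xi> y
    by (simp add: h_def norm_mult abs_mult)
  have hi: "integrable (lborel \<Otimes>\<^sub>M lborel) (case_prod h)"
  proof (rule lborel_pair.Fubini_integrable[OF hm])
    show "integrable lborel (\<lambda>\<xi>. \<integral>y. norm (case_prod h (\<xi>, y)) \<partial>lborel)"
      using Gi by (simp add: hn)
    show "AE \<xi> in lborel. integrable lborel (\<lambda>y. case_prod h (\<xi>, y))"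
    proof (intro AE_I2)
      fix \<xi> :: 'a
      have "(\<lambda>y. h \<xi> y) \<in> borel_measurable lborel" unfolding h_def by measurable
      then have "integrable lborel (\<lambda>y. h \<xi> y)"
        by (subst integrable_norm_iff[symmetric]) (use fi in \<open>auto simp: hn\<close>)
      then show "integrable lborel (\<lambda>y. case_prod h (\<xi>, y))" by simp
    qed
  qed
  have tf: "truncated_fourier f R \<xi> * G \<xi> = of_real (fourier_const TYPE('a)) * (\<integral>y. h \<xi> y \<partial>lborel)" for \<xi>
  proof -
    have "(\<integral>y. h \<xi> y \<partial>lborel) = (\<integral>y. complex_of_real (indicator (cball 0 R) y * f y) * cis (- inner \<xi> y) \<partial>lborel) * G \<xi>"
      unfolding h_def by simp
    moreover have "set_lebesgue_integral lborel (cball 0 R) (\<lambda>x. complex_of_real (f x) * cis (- inner \<xi> x))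
       = (\<integral>y. complex_of_real (indicator (cball 0 R) y * f y) * cis (- inner \<xi> y) \<partial>lborel)"
      unfolding set_lebesgue_integral_def by (intro Bochner_Integration.integral_cong) (auto simp: scaleR_conv_of_real)
    ultimately show ?thesis
      unfolding truncated_fourier_def fourier_const_def by simp
  qed
  show "integrable lborel (\<lambda>\<xi>. truncated_fourier f R \<xi> * G \<xi>)"
    unfolding tf using lborel_pair.integrable_fst[OF hi] by (intro integrable_mult_right) auto
  have "(\<integral>\<xi>. (\<integral>y. h \<xi> y \<partial>lborel) \<partial>lborel) = (\<integral>y. (\<integral>\<xi>. h \<xi> y \<partial>lborel) \<partial>lborel)"
    by (rule lborel_pair.Fubini_integral[OF hi, symmetric])
  also have "\<dots> = (\<integral>y. of_real (indicator (cball 0 R) y * f y *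
         P y) \<partial>lborel)"
  proof (intro Bochner_Integration.integral_cong refl)
    fix y :: 'a
    have "h \<xi> y = complex_of_real (indicator (cball 0 R) y * f y) *
        (of_real (exp (- \<epsilon> * (norm \<xi>)\<^sup>2 / 2)) * cis (inner (x - y) \<xi>))" for \<xi>
      by (simp add: h_def G_def cis_mult inner_diff_left inner_commute[of \<xi> y] ac_simps)
    then have "(\<integral>\<xi>. h \<xi> y \<partial>lborel) = complex_of_real (indicator (cball 0 R) y * f y) *
        (\<integral>\<xi>. of_real (exp (- \<epsilon> * (norm \<xi>)\<^sup>2 / 2)) * cis (inner (x - y) \<xi>) \<partial>lborel)" by simp
    then show "(\<integral>\<xi>. h \<xi> y \<partial>lborel) = of_real (indicator (cball 0 R) y * f y *
         P y)"
      unfolding gaussian_fourier(2)[OF \<epsilon>] P_def by simp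
  qed
  also have "\<dots> = of_real (\<integral>y. indicator (cball 0 R) y * f y *
         P y \<partial>lborel)"
    by (rule integral_complex_of_real)
  finally show "(\<integral>\<xi>. truncated_fourier f R \<xi> * G \<xi> \<partial>lborel) =
      of_real (fourier_const TYPE('a) * (\<integral>y. indicator (cball 0 R) y * f y *
         P y \<partial>lborel))"
    unfolding tf by simp
qed

lemma integrable_gaussian_sq:
  fixes x :: "'a::euclidean_space" and \<epsilon> :: real
  assumes "\<epsilon> > 0"
  shows "integrable lborel (\<lambda>y. exp (- \<epsilon> * (norm (x - y))\<^sup>2))"
proof -
  have "integrable lborel (\<lambda>y::'a. exp (- \<epsilon> * (norm y)\<^sup>2))"
    using integrable_norm[OF gaussian_fourier(1)[of "2 * \<epsilon>" "0::'a"]] assms by (simp add: norm_mult)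
  moreover have "lborel = distr lborel borel (\<lambda>y. x + (-1) *\<^sub>R y)"
    using lborel_affine[of "-1" x] by (simp add: density_1)
  ultimately have "integrable (distr lborel borel (\<lambda>y. x + (-1) *\<^sub>R y)) (\<lambda>y::'a. exp (- \<epsilon> * (norm y)\<^sup>2))"
    by simp
  then show ?thesis
    by (subst (asm) integrable_distr_eq) auto
qed

text \<open>
  The truncation is removed. On the frequency side the transforms converge in the mean and are
  paired with a square integrable Gaussian; on the space side dominated convergence applies.
\<close>

lemma fourier_gaussian:
  fixes f :: "'a::euclidean_space \<Rightarrow> real" and \<epsilon> :: real and x :: 'a
  assumes f: "continuous_on UNIV f" and f2: "integrable lborel (\<lambda>x. (f x)\<^sup>2)"
    and F: "is_L2_fourier f F" and Fi: "integrable lborel F" and \<epsilon>: "\<epsilon> > 0"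
  defines "G \<equiv> \<lambda>\<xi>. of_real (exp (- \<epsilon> * (norm \<xi>)\<^sup>2 / 2)) * cis (inner x \<xi>)"
  defines "P \<equiv> \<lambda>y. sqrt (2 * pi / \<epsilon>) ^ DIM('a) * exp (- (norm (x - y))\<^sup>2 / (2 * \<epsilon>))"
  shows "integrable lborel (\<lambda>y. f y * P y)"
    and "(\<integral>\<xi>. F \<xi> * G \<xi> \<partial>lborel) = of_real (fourier_const TYPE('a) * (\<integral>y. f y * P y \<partial>lborel))"
proof -
  have fm [measurable]: "f \<in> borel_measurable borel"
    using f by (rule borel_measurable_continuous_onI)
  have [measurable]: "F \<in> borel_measurable borel" using F by (simp add: is_L2_fourier_def)
  have [measurable]: "P \<in> borel_measurable borel" unfolding P_def by measurable
  have P2: "integrable lborel (\<lambda>y. (P y)\<^sup>2)"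
  proof -
    have "(P y)\<^sup>2 = (sqrt (2 * pi / \<epsilon>) ^ DIM('a))\<^sup>2 * exp (- (1 / \<epsilon>) * (norm (x - y))\<^sup>2)" for y
      unfolding P_def power_mult_distrib exp_double[symmetric] by simp
    then show ?thesis using integrable_gaussian_sq[of "1 / \<epsilon>" x] \<epsilon> by simp
  qed
  show fP: "integrable lborel (\<lambda>y. f y * P y)"
    by (rule lebesgue_cauchy_schwarz) (use f2 P2 in auto)
  have G_norm: "cmod (G \<xi>) = exp (- \<epsilon> * (norm \<xi>)\<^sup>2 / 2)" for \<xi> by (simp add: G_def norm_mult)
  have Gi: "integrable lborel G" unfolding G_def by (rule gaussian_fourier[OF \<epsilon>])
  have [measurable]: "G \<in> borel_measurable borel" using Gi by (auto dest: borel_measurable_integrable)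
  have FG: "integrable lborel (\<lambda>\<xi>. F \<xi> * G \<xi>)"
    using Fi by (rule Bochner_Integration.integrable_bound)
       (use \<epsilon> in \<open>auto simp: norm_mult G_norm intro!: mult_left_le\<close>)
  have "integrable lborel (\<lambda>\<xi>. (cmod (G \<xi>))\<^sup>2)"
  proof -
    have "(cmod (G \<xi>))\<^sup>2 = exp (- \<epsilon> * (norm (0 - \<xi>))\<^sup>2)" for \<xi>
      unfolding G_norm exp_double[symmetric] by simp
    then show ?thesis using integrable_gaussian_sq[OF \<epsilon>, of 0] by simp
  qed
  then have g2: "(\<integral>\<^sup>+\<xi>. (ennreal (cmod (G \<xi>)))\<^sup>2 \<partial>lborel) < \<infinity>"
    by (simp add: ennreal_power nn_integral_eq_integral)
  let ?tf = "\<lambda>n::nat. truncated_fourier f (real n)"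
  have tG: "integrable lborel (\<lambda>\<xi>. ?tf n \<xi> * G \<xi>)" for n
    unfolding G_def by (rule truncated_fourier_gaussian[OF f \<epsilon>])
  define A where "A n = (\<integral>\<^sup>+ \<xi>. ennreal ((cmod (F \<xi> - ?tf n \<xi>))\<^sup>2) \<partial>lborel)" for n
  have A0: "A \<longlonglongrightarrow> 0"
    unfolding A_def using F filterlim_compose[OF _ filterlim_real_sequentially]
    unfolding is_L2_fourier_def by blast
  define D where "D n = cmod ((\<integral>\<xi>. F \<xi> * G \<xi> \<partial>lborel) - (\<integral>\<xi>. ?tf n \<xi> * G \<xi> \<partial>lborel))" for n
  have DA: "ennreal ((D n)\<^sup>2) \<le> A n * (\<integral>\<^sup>+\<xi>. (ennreal (cmod (G \<xi>)))\<^sup>2 \<partial>lborel)" for n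
  proof -
    have "D n = cmod (\<integral>\<xi>. (F \<xi> - ?tf n \<xi>) * G \<xi> \<partial>lborel)"
      unfolding D_def by (subst Bochner_Integration.integral_diff[symmetric]) (use FG tG in \<open>auto simp: left_diff_distrib\<close>)
    also have "ennreal \<dots> \<le> (\<integral>\<^sup>+\<xi>. ennreal (cmod (F \<xi> - ?tf n \<xi>)) * ennreal (cmod (G \<xi>)) \<partial>lborel)"
      using integral_norm_bound_ennreal[of lborel "\<lambda>\<xi>. (F \<xi> - ?tf n \<xi>) * G \<xi>"] FG tG[of n]
      by (simp add: left_diff_distrib[symmetric] norm_mult ennreal_mult)
         (simp add: left_diff_distrib)
    finally have "(ennreal (D n))\<^sup>2 \<le> (\<integral>\<^sup>+\<xi>. ennreal (cmod (F \<xi> - ?tf n \<xi>)) * ennreal (cmod (G \<xi>)) \<partial>lborel)\<^sup>2"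
      by (intro power_mono) auto
    also have "\<dots> \<le> (\<integral>\<^sup>+\<xi>. (ennreal (cmod (F \<xi> - ?tf n \<xi>)))\<^sup>2 \<partial>lborel) * (\<integral>\<^sup>+\<xi>. (ennreal (cmod (G \<xi>)))\<^sup>2 \<partial>lborel)"
      by (intro Cauchy_Schwarz_nn_integral) auto
    finally show ?thesis by (simp add: A_def ennreal_power D_def)
  qed
  have "(\<lambda>n. ennreal ((D n)\<^sup>2)) \<longlonglongrightarrow> 0"
  proof (rule tendsto_sandwich[OF _ _ tendsto_const])
    show "(\<lambda>n. A n * (\<integral>\<^sup>+\<xi>. (ennreal (cmod (G \<xi>)))\<^sup>2 \<partial>lborel)) \<longlonglongrightarrow> 0"
      using ennreal_tendsto_cmult[OF _ A0, of "\<integral>\<^sup>+\<xi>. (ennreal (cmod (G \<xi>)))\<^sup>2 \<partial>lborel"] g2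
      by (simp add: mult.commute)
  qed (auto simp: DA)
  then have "(\<lambda>n. (D n)\<^sup>2) \<longlonglongrightarrow> 0"
    by (simp add: ennreal_tendsto_0_iff)
  then have "(\<lambda>n. sqrt ((D n)\<^sup>2)) \<longlonglongrightarrow> sqrt 0" by (intro tendsto_real_sqrt)
  moreover have "D n \<ge> 0" for n by (simp add: D_def)
  ultimately have "D \<longlonglongrightarrow> 0" by simp
  then have lim1: "(\<lambda>n. \<integral>\<xi>. ?tf n \<xi> * G \<xi> \<partial>lborel) \<longlonglongrightarrow> (\<integral>\<xi>. F \<xi> * G \<xi> \<partial>lborel)"
    unfolding D_def by (subst (asm) norm_minus_commute) (simp add: tendsto_norm_zero_iff LIM_zero_iff)
  have "(\<lambda>n. \<integral>y. indicator (cball 0 (real n)) y * f y * P y \<partial>lborel) \<longlonglongrightarrow> (\<integral>y. f y * P y \<partial>lborel)"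
  proof (rule integral_dominated_convergence[where w = "\<lambda>y. norm (f y * P y)"])
    have [measurable]: "cball (0::'a) r \<in> sets borel" for r by simp
    show "(\<lambda>y. indicator (cball 0 (real n)) y * f y * P y) \<in> borel_measurable lborel" for n by measurable
    show "integrable lborel (\<lambda>y. norm (f y * P y))" by (rule integrable_norm[OF fP])
    show "AE y in lborel. norm (indicator (cball 0 (real n)) y * f y * P y) \<le> norm (f y * P y)" for n
      by (auto simp: indicator_def)
    show "AE y in lborel. (\<lambda>n. indicator (cball 0 (real n)) y * f y * P y) \<longlonglongrightarrow> f y * P y"
    proof (intro AE_I2 tendsto_eventually)
      fix y :: 'a
      obtain N :: nat where "norm y \<le> real N" using real_arch_simple by blast
      then have "\<forall>n\<ge>N. indicator (cball 0 (real n)) y = (1::real)" by (auto intro: order_trans)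
      then show "\<forall>\<^sub>F n in sequentially. indicator (cball 0 (real n)) y * f y * P y = f y * P y"
        by (auto simp: eventually_sequentially intro!: exI[of _ N])
    qed
  qed measurable
  then have "(\<lambda>n. complex_of_real (fourier_const TYPE('a) * (\<integral>y. indicator (cball 0 (real n)) y * f y * P y \<partial>lborel)))
     \<longlonglongrightarrow> of_real (fourier_const TYPE('a) * (\<integral>y. f y * P y \<partial>lborel))"
    by (intro tendsto_intros)
  then have "(\<lambda>n. \<integral>\<xi>. ?tf n \<xi> * G \<xi> \<partial>lborel) \<longlonglongrightarrow> of_real (fourier_const TYPE('a) * (\<integral>y. f y * P y \<partial>lborel))"
    unfolding G_def P_def truncated_fourier_gaussian(2)[OF f \<epsilon>] .
  with lim1 show "(\<integral>\<xi>. F \<xi> * G \<xi> \<partial>lborel) = of_real (fourier_const TYPE('a) * (\<integral>y. f y * P y \<partial>lborel))"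
    by (rule LIMSEQ_unique)
qed

lemma lborel_affine_change:
  fixes h :: "'a::euclidean_space \<Rightarrow> 'b::{banach, second_countable_topology}"
  assumes [measurable]: "h \<in> borel_measurable borel" and c: "c \<noteq> 0"
  shows integrable_lborel_affine: "integrable lborel (\<lambda>u. h (t + c *\<^sub>R u)) \<longleftrightarrow> integrable lborel h"
    and integral_lborel_affine:
      "(\<integral>y. h y \<partial>lborel) = (\<bar>c\<bar> ^ DIM('a)) *\<^sub>R (\<integral>u. h (t + c *\<^sub>R u) \<partial>lborel)"
proof -
  have L: "(lborel::'a measure) = density (distr lborel borel (\<lambda>x. t + c *\<^sub>R x)) (\<lambda>_. ennreal (\<bar>c\<bar> ^ DIM('a)))"
    using lborel_affine[OF c, of t] by (simp add: ennreal_power)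
  show "integrable lborel (\<lambda>u. h (t + c *\<^sub>R u)) \<longleftrightarrow> integrable lborel h"
  proof -
    have "integrable lborel h \<longleftrightarrow> integrable lborel (\<lambda>u. (\<bar>c\<bar> ^ DIM('a)) *\<^sub>R h (t + c *\<^sub>R u))"
      by (subst L, subst integrable_density) (use c in \<open>auto simp: integrable_distr_eq\<close>)
    also have "\<dots> \<longleftrightarrow> integrable lborel (\<lambda>u. h (t + c *\<^sub>R u))"
      using c integrable_scaleR_right[of "inverse (\<bar>c\<bar> ^ DIM('a))" lborel "\<lambda>u. (\<bar>c\<bar> ^ DIM('a)) *\<^sub>R h (t + c *\<^sub>R u)"]
      by (intro iffI) simp_all
    finally show ?thesis ..
  qed
  show "(\<integral>y. h y \<partial>lborel) = (\<bar>c\<bar> ^ DIM('a)) *\<^sub>R (\<integral>u. h (t + c *\<^sub>R u) \<partial>lborel)"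
    by (subst L, subst integral_density) (use c in \<open>auto simp: integral_distr\<close>)
qed

lemma integral_gaussian: "(\<integral>u. exp (- (norm u)\<^sup>2 / 2) \<partial>(lborel::'a::euclidean_space measure)) = sqrt (2 * pi) ^ DIM('a)"
proof -
  have "complex_of_real (\<integral>u. exp (- (1::real) * (norm u)\<^sup>2 / 2) \<partial>(lborel::'a measure))
      = (\<integral>u. of_real (exp (- (1::real) * (norm u)\<^sup>2 / 2)) * cis (inner 0 u) \<partial>(lborel::'a measure))"
    by simp
  also have "\<dots> = of_real (sqrt (2 * pi / 1) ^ DIM('a) * exp (- (norm (0::'a))\<^sup>2 / (2 * 1)))"
    by (rule gaussian_fourier(2)) simp
  finally show ?thesis by (simp only: of_real_eq_iff) simp
qed

text \<open>
  Nothing is known about the growth of \<open>f\<close> except square integrability, so the integral is split at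
  distance \<open>1\<close> from \<open>x\<close>. Near \<open>x\<close> the function is bounded, and dominated convergence applies
  after rescaling. Far from \<open>x\<close> the mollifier is at most a fixed Gaussian times a factor that tends to \<open>0\<close>.
\<close>

lemma gaussian_mollification:
  fixes f :: "'a::euclidean_space \<Rightarrow> real" and x :: 'a
  assumes f: "continuous_on UNIV f" and f2: "integrable lborel (\<lambda>x. (f x)\<^sup>2)"
    and fP: "\<And>n. integrable lborel (\<lambda>y. f y * (sqrt (2 * pi * Suc n) ^ DIM('a) * exp (- (Suc n * (norm (x - y))\<^sup>2) / 2)))"
  shows "(\<lambda>n. \<integral>y. f y * (sqrt (2 * pi * Suc n) ^ DIM('a) * exp (- (Suc n * (norm (x - y))\<^sup>2) / 2)) \<partial>lborel)
     \<longlonglongrightarrow> (2 * pi) ^ DIM('a) * f x"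
proof -
  let ?d = "DIM('a)"
  define P where "P n y = sqrt (2 * pi * Suc n) ^ ?d * exp (- (Suc n * (norm (x - y))\<^sup>2) / 2)" for n y
  have fm [measurable]: "f \<in> borel_measurable borel"
    using f by (rule borel_measurable_continuous_onI)
  have Pm [measurable]: "P n \<in> borel_measurable borel" for n unfolding P_def by measurable
  have fP': "integrable lborel (\<lambda>y. f y * P n y)" for n using fP unfolding P_def .
  have bm [measurable]: "ball x 1 \<in> sets borel" "cball x 1 \<in> sets borel" by simp_all
  obtain b where b: "\<And>y. y \<in> cball x 1 \<Longrightarrow> \<bar>f y\<bar> \<le> b"
  proof -
    have "compact (f ` cball x 1)" using f by (intro compact_continuous_image continuous_on_subset[OF f]) auto
    then obtain b where "\<forall>y\<in>f ` cball x 1. norm y \<le> b" using compact_imp_bounded bounded_iff by blast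
    then show ?thesis by (intro that[of b]) auto
  qed
  \<comment> \<open>the part of the integral near \<open>x\<close>\<close>
  define cut where "cut y = (indicator (ball x 1) y :: real)" for y
  have cutm [measurable]: "cut \<in> borel_measurable borel" unfolding cut_def by measurable
  have loc: "(\<lambda>n. \<integral>y. cut y * f y * P n y \<partial>lborel) \<longlonglongrightarrow> (2 * pi) ^ ?d * f x"
  proof -
    define s where "s n = 1 / sqrt (Suc n)" for n :: nat
    have s: "s n > 0" for n by (simp add: s_def)
    let ?cf = "\<lambda>n u. cut (x + s n *\<^sub>R u) * f (x + s n *\<^sub>R u)" and ?G = "\<lambda>u::'a. exp (- (norm u)\<^sup>2 / 2)"
    have s0: "s \<longlonglongrightarrow> 0"
      unfolding s_def
      by (intro tendsto_divide_0[OF tendsto_const] filterlim_at_top_imp_at_infinity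
          filterlim_compose[OF sqrt_at_top] filterlim_compose[OF filterlim_real_sequentially filterlim_Suc])
    have tr: "(\<integral>y. cut y * f y * P n y \<partial>lborel) =
       sqrt (2 * pi) ^ ?d * (\<integral>u. ?cf n u * ?G u \<partial>lborel)" for n
    proof -
      have P: "(s n ^ ?d) * P n (x + s n *\<^sub>R u) = sqrt (2 * pi) ^ ?d * ?G u" for u
      proof -
        have "s n * sqrt (2 * pi * Suc n) = sqrt (2 * pi)" by (simp add: s_def real_sqrt_mult)
        then have 1: "s n ^ ?d * sqrt (2 * pi * Suc n) ^ ?d = sqrt (2 * pi) ^ ?d"
          by (simp only: power_mult_distrib[symmetric])
        have "Suc n * (norm (x - (x + s n *\<^sub>R u)))\<^sup>2 = (norm u)\<^sup>2"
          by (simp add: s_def power_divide)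
        then show ?thesis unfolding P_def by (simp only: mult.assoc[symmetric] 1)
      qed
      have "(\<integral>y. cut y * f y * P n y \<partial>lborel) = \<bar>s n\<bar> ^ ?d *\<^sub>R (\<integral>u. ?cf n u * P n (x + s n *\<^sub>R u) \<partial>lborel)"
        by (rule integral_lborel_affine) (use s[of n] in \<open>simp_all\<close>)
      also have "\<dots> = (\<integral>u. s n ^ ?d * (?cf n u * P n (x + s n *\<^sub>R u)) \<partial>lborel)"
        using s[of n] by simp
      also have "\<dots> = (\<integral>u. sqrt (2 * pi) ^ ?d * (?cf n u * ?G u) \<partial>lborel)"
      proof (intro Bochner_Integration.integral_cong refl)
        fix u
        have "p * (a * q) = r * (a * e)" if "p * q = r * e" for a e p q r :: real
          using that by (metis mult.left_commute)
        from this[OF P] show "s n ^ ?d * (?cf n u * P n (x + s n *\<^sub>R u))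
          = sqrt (2 * pi) ^ ?d * (?cf n u * ?G u)" .
      qed
      finally show ?thesis by simp
    qed
    have "(\<lambda>n. \<integral>u. ?cf n u * ?G u \<partial>lborel)
       \<longlonglongrightarrow> (\<integral>u. f x * ?G u \<partial>(lborel::'a measure))"
    proof (rule integral_dominated_convergence[where w = "\<lambda>u. b * ?G u"])
      show "integrable lborel (\<lambda>u::'a. b * ?G u)"
        using integrable_gaussian_sq[of "1/2" "0::'a"] by simp
      show "AE u in lborel. norm (?cf n u * ?G u) \<le> b * ?G u" for n
      proof (intro AE_I2)
        fix u :: 'a
        have "b \<ge> 0" using b[of x] by auto
        then have "\<bar>?cf n u\<bar> \<le> b"
          using b[of "x + s n *\<^sub>R u"] by (auto simp: cut_def indicator_def)
        then show "norm (?cf n u * ?G u) \<le> b * ?G u"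
          unfolding norm_mult[of _ "exp _"] by (intro mult_mono) auto
      qed
      show "AE u in lborel. (\<lambda>n. ?cf n u * ?G u) \<longlonglongrightarrow> f x * ?G u"
      proof (intro AE_I2)
        fix u :: 'a
        have l: "(\<lambda>n. x + s n *\<^sub>R u) \<longlonglongrightarrow> x" using tendsto_add[OF tendsto_const tendsto_scaleR[OF s0 tendsto_const], of x u] by simp
        have "\<forall>\<^sub>F n in sequentially. x + s n *\<^sub>R u \<in> ball x 1"
          using topological_tendstoD[OF l open_ball, of x 1] by simp
        then have "\<forall>\<^sub>F n in sequentially. cut (x + s n *\<^sub>R u) = 1" by eventually_elim (simp add: cut_def)
        then have "(\<lambda>n. cut (x + s n *\<^sub>R u)) \<longlonglongrightarrow> 1" by (rule tendsto_eventually)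
        moreover have "(\<lambda>n. f (x + s n *\<^sub>R u)) \<longlonglongrightarrow> f x"
          using f l by (metis UNIV_I continuous_on_tendsto_compose eventually_sequentiallyI)
        ultimately show "(\<lambda>n. ?cf n u * ?G u) \<longlonglongrightarrow> f x * ?G u"
          by (auto intro!: tendsto_eq_intros)
      qed
    qed measurable
    then have "(\<lambda>n. sqrt (2 * pi) ^ ?d * (\<integral>u. ?cf n u * ?G u \<partial>lborel))
       \<longlonglongrightarrow> sqrt (2 * pi) ^ ?d * (f x * sqrt (2 * pi) ^ ?d)"
      unfolding integral_mult_right_zero integral_gaussian by (intro tendsto_intros)
    moreover have "sqrt (2 * pi) ^ ?d * (f x * sqrt (2 * pi) ^ ?d) = (2 * pi) ^ ?d * f x"
    proof -
      have "sqrt (2 * pi) ^ ?d * sqrt (2 * pi) ^ ?d = (2 * pi) ^ ?d"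
        unfolding power_mult_distrib[symmetric] real_sqrt_mult_self by simp
      then show ?thesis by (metis mult.commute mult.left_commute)
    qed
    ultimately show ?thesis unfolding tr by simp
  qed
  have far: "(\<lambda>n. \<integral>y. (1 - cut y) * f y * P n y \<partial>lborel) \<longlonglongrightarrow> 0"
  proof -
    let ?e = "\<lambda>y. exp (- (norm (x - y))\<^sup>2 / 4)"
    have ei: "integrable lborel (\<lambda>y. f y * ?e y)"
    proof (rule lebesgue_cauchy_schwarz)
      have "(?e y)\<^sup>2 = exp (- (1/2) * (norm (x - y))\<^sup>2)" for y by (simp flip: exp_double)
      then show "integrable lborel (\<lambda>y. (?e y)\<^sup>2)" using integrable_gaussian_sq[of "1/2" x] by simp
    qed (use f2 in auto)
    \<comment> \<open>For \<open>|x - y| \<ge> 1\<close> half of the exponent gives the small factor in \<open>\<kappa> n\<close>, the other half at most \<open>?e y\<close>.\<close>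
    define \<kappa> where "\<kappa> n = (2 * pi * Suc n) ^ ?d * exp (- real (Suc n) / 4)" for n
    have bound: "\<bar>\<integral>y. (1 - cut y) * f y * P n y \<partial>lborel\<bar> \<le> \<kappa> n * (\<integral>y. \<bar>f y * ?e y\<bar> \<partial>lborel)" for n
    proof -
      have pw: "\<bar>(1 - cut y) * f y * P n y\<bar> \<le> \<kappa> n * \<bar>f y * ?e y\<bar>" for y
      proof (cases "y \<in> ball x 1")
        case True then show ?thesis by (simp add: cut_def \<kappa>_def)
      next
        case False
        then have r: "1 \<le> (norm (x - y))\<^sup>2" by (simp add: dist_norm)
        have "0 \<le> real n * ((norm (x - y))\<^sup>2 - 1)" "0 \<le> real n * (norm (x - y))\<^sup>2" using r by simp_all
        then have "- (Suc n * (norm (x - y))\<^sup>2) / 2 \<le> - real (Suc n) / 4 + - (norm (x - y))\<^sup>2 / 4"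
          using r by (simp add: field_simps)
        then have 1: "exp (- (Suc n * (norm (x - y))\<^sup>2) / 2) \<le> exp (- real (Suc n) / 4) * ?e y"
          unfolding exp_add[symmetric] exp_le_cancel_iff .
        have sq: "sqrt c \<le> c" if "1 \<le> c" for c :: real
          using that mult_left_mono[of 1 c c] by (intro real_le_lsqrt) (auto simp: power2_eq_square)
        have "1 * 1 \<le> 2 * pi * Suc n" using pi_ge_two by (intro mult_mono) auto
        then have "sqrt (2 * pi * Suc n) \<le> 2 * pi * Suc n" by (intro sq) simp
        then have 2: "sqrt (2 * pi * Suc n) ^ ?d \<le> (2 * pi * Suc n) ^ ?d" by (intro power_mono) auto
        have "P n y \<le> (2 * pi * Suc n) ^ ?d * (exp (- real (Suc n) / 4) * ?e y)"
          unfolding P_def by (intro mult_mono 1 2) auto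
        moreover have "P n y \<ge> 0" unfolding P_def by (intro mult_nonneg_nonneg) auto
        ultimately have "\<bar>f y\<bar> * P n y \<le> \<bar>f y\<bar> * ((2 * pi * Suc n) ^ ?d * (exp (- real (Suc n) / 4) * ?e y))"
          by (intro mult_left_mono) auto
        then show ?thesis using False \<open>P n y \<ge> 0\<close> by (simp add: cut_def \<kappa>_def abs_mult ac_simps)
      qed
      have "\<bar>\<integral>y. (1 - cut y) * f y * P n y \<partial>lborel\<bar> \<le> (\<integral>y. \<bar>(1 - cut y) * f y * P n y\<bar> \<partial>lborel)"
        by (rule integral_abs_bound)
      also have "\<dots> \<le> (\<integral>y. \<kappa> n * \<bar>f y * ?e y\<bar> \<partial>lborel)"
      proof (rule integral_mono_AE')
        show "integrable lborel (\<lambda>y. \<kappa> n * \<bar>f y * ?e y\<bar>)"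
          using integrable_abs[OF ei] by (rule integrable_mult_right)
        show "AE y in lborel. \<bar>(1 - cut y) * f y * P n y\<bar> \<le> \<kappa> n * \<bar>f y * ?e y\<bar>"
          by (intro AE_I2 pw)
        show "AE y in lborel. 0 \<le> \<kappa> n * \<bar>f y * ?e y\<bar>" by (intro AE_I2) (simp add: \<kappa>_def)
      qed
      finally show ?thesis by simp
    qed
    have "\<kappa> \<longlonglongrightarrow> 0"
    proof -
      have k: "\<kappa> n = (8 * pi) ^ ?d * ((real (Suc n) / 4) ^ ?d / exp (real (Suc n) / 4))" for n
      proof -
        have "2 * pi * real (Suc n) = (8 * pi) * (real (Suc n) / 4)" by simp
        then have "(2 * pi * real (Suc n)) ^ ?d = (8 * pi) ^ ?d * (real (Suc n) / 4) ^ ?d"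
          by (metis power_mult_distrib)
        moreover have "exp (- real (Suc n) / 4) = 1 / exp (real (Suc n) / 4)"
          by (simp only: minus_divide_left[symmetric] exp_minus inverse_eq_divide)
        ultimately show ?thesis
          unfolding \<kappa>_def by (simp only: times_divide_eq_right mult_1_right mult.assoc)
      qed
      have "(\<lambda>n. (real (Suc n) / 4) ^ ?d / exp (real (Suc n) / 4)) \<longlonglongrightarrow> 0"
      proof (rule filterlim_compose[OF tendsto_power_div_exp_0])
        show "filterlim (\<lambda>n. real (Suc n) / 4) at_top sequentially" by real_asymp
      qed
      from tendsto_mult_right_zero[OF this, of "(8 * pi) ^ ?d"]
      show ?thesis unfolding k[abs_def] .
    qed
    from tendsto_mult_left_zero[OF this]
    have "(\<lambda>n. \<kappa> n * (\<integral>y. \<bar>f y * ?e y\<bar> \<partial>lborel)) \<longlonglongrightarrow> 0" .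
    then show ?thesis
      by (rule Lim_null_comparison[rotated]) (unfold real_norm_def, intro always_eventually allI bound)
  qed
  have "(\<integral>y. f y * P n y \<partial>lborel) = (\<integral>y. cut y * f y * P n y \<partial>lborel) + (\<integral>y. (1 - cut y) * f y * P n y \<partial>lborel)" for n
  proof -
    have i1: "integrable lborel (\<lambda>y. cut y * f y * P n y)"
    proof (rule Bochner_Integration.integrable_bound[OF fP'[of n]])
      show "AE y in lborel. norm (cut y * f y * P n y) \<le> norm (f y * P n y)"
        by (intro AE_I2) (simp add: cut_def indicator_def)
    qed measurable
    have "(\<integral>y. (1 - cut y) * f y * P n y \<partial>lborel) = (\<integral>y. f y * P n y - cut y * f y * P n y \<partial>lborel)"
      by (intro Bochner_Integration.integral_cong refl) (simp add: left_diff_distrib)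
    also have "\<dots> = (\<integral>y. f y * P n y \<partial>lborel) - (\<integral>y. cut y * f y * P n y \<partial>lborel)"
      by (rule Bochner_Integration.integral_diff[OF fP' i1])
    finally show ?thesis by linarith
  qed
  then have "(\<lambda>n. \<integral>y. f y * P n y \<partial>lborel) \<longlonglongrightarrow> (2 * pi) ^ ?d * f x"
    using tendsto_add[OF loc far] by simp
  then show ?thesis unfolding P_def .
qed

text \<open>
  The Gaussian in \<open>fourier_gaussian\<close> is widened to the constant \<open>1\<close>. Integrability of \<open>F\<close> gives the limit on
  the frequency side, and \<open>gaussian_mollification\<close> the limit on the space side.
\<close>

lemma fourier_inversion:
  fixes f :: "'a::euclidean_space \<Rightarrow> real" and x :: 'a
  assumes f: "continuous_on UNIV f" and f2: "integrable lborel (\<lambda>x. (f x)\<^sup>2)"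
    and F: "is_L2_fourier f F" and Fi: "integrable lborel F"
  shows "of_real (f x) = of_real (fourier_const TYPE('a)) * (\<integral>\<xi>. F \<xi> * cis (inner x \<xi>) \<partial>lborel)"
proof -
  let ?k = "fourier_const TYPE('a)"
  define G where "G n \<xi> = of_real (exp (- (1 / Suc n) * (norm \<xi>)\<^sup>2 / 2)) * cis (inner x \<xi>)" for n and \<xi> :: 'a
  let ?P = "\<lambda>n y. sqrt (2 * pi * Suc n) ^ DIM('a) * exp (- (Suc n * (norm (x - y))\<^sup>2) / 2)"
  have [measurable]: "F \<in> borel_measurable borel" using F by (simp add: is_L2_fourier_def)
  have eq: "sqrt (2 * pi / (1 / Suc n)) ^ DIM('a) * exp (- (norm (x - y))\<^sup>2 / (2 * (1 / Suc n))) = ?P n y" for n y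
    by (simp add: field_simps)
  have A: "integrable lborel (\<lambda>y. f y * ?P n y)"
    "(\<integral>\<xi>. F \<xi> * G n \<xi> \<partial>lborel) = of_real (?k * (\<integral>y. f y * ?P n y \<partial>lborel))" for n
    using fourier_gaussian[OF f f2 F Fi, of "1 / Suc n" x] unfolding eq G_def by simp_all
  have l1: "(\<lambda>n. complex_of_real (?k * (\<integral>y. f y * ?P n y \<partial>lborel))) \<longlonglongrightarrow> of_real (?k * ((2 * pi) ^ DIM('a) * f x))"
    by (rule tendsto_of_real[OF tendsto_mult[OF tendsto_const gaussian_mollification[OF f f2 A(1)]]])
  have l2: "(\<lambda>n. \<integral>\<xi>. F \<xi> * G n \<xi> \<partial>lborel) \<longlonglongrightarrow> (\<integral>\<xi>. F \<xi> * cis (inner x \<xi>) \<partial>lborel)"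
  proof (rule integral_dominated_convergence[where w = "\<lambda>\<xi>. cmod (F \<xi>)"])
    show "AE \<xi> in lborel. (\<lambda>n. F \<xi> * G n \<xi>) \<longlonglongrightarrow> F \<xi> * cis (inner x \<xi>)"
    proof (intro AE_I2)
      fix \<xi> :: 'a
      have "(\<lambda>n. exp (- (1 / Suc n) * (norm \<xi>)\<^sup>2 / 2)) \<longlonglongrightarrow> exp (- 0 * (norm \<xi>)\<^sup>2 / 2)"
        by (intro tendsto_intros LIMSEQ_Suc[OF lim_1_over_n]) simp
      from tendsto_mult[OF tendsto_const[of "F \<xi>"] tendsto_mult[OF tendsto_of_real[OF this] tendsto_const[of "cis (inner x \<xi>)"]]]
      show "(\<lambda>n. F \<xi> * G n \<xi>) \<longlonglongrightarrow> F \<xi> * cis (inner x \<xi>)"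
        unfolding G_def by simp
    qed
    show "AE \<xi> in lborel. norm (F \<xi> * G n \<xi>) \<le> cmod (F \<xi>)" for n
      by (auto simp: G_def norm_mult intro!: mult_left_le)
    show "(\<lambda>\<xi>. F \<xi> * G n \<xi>) \<in> borel_measurable lborel" for n unfolding G_def by measurable
    show "(\<lambda>\<xi>. F \<xi> * cis (inner x \<xi>)) \<in> borel_measurable lborel" by measurable
    show "integrable lborel (\<lambda>\<xi>. cmod (F \<xi>))" by (rule integrable_norm[OF Fi])
  qed
  have I: "(\<integral>\<xi>. F \<xi> * cis (inner x \<xi>) \<partial>lborel) = of_real (?k * ((2 * pi) ^ DIM('a) * f x))"
    by (rule LIMSEQ_unique[OF l2]) (unfold A(2), rule l1)
  have p: "(2 * pi) ^ DIM('a) = (2 * pi) powr real DIM('a)"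
    by (rule powr_realpow[symmetric]) simp
  have k: "?k * (?k * ((2 * pi) ^ DIM('a))) = 1"
    unfolding fourier_const_def p powr_add[symmetric] by simp
  have "?k * (?k * ((2 * pi) ^ DIM('a) * f x)) = f x"
    by (metis k mult.assoc mult_1)
  then show ?thesis unfolding I by (metis of_real_mult)
qed

section \<open>A pointwise bound for Sobolev functions\<close>

text \<open>
  Limits in the mean of the same truncated transforms agree almost everywhere.
\<close>

lemma is_L2_fourier_unique:
  fixes f :: "'a::euclidean_space \<Rightarrow> real"
  assumes [measurable]: "f \<in> borel_measurable borel"
    and F: "is_L2_fourier f F" and F': "is_L2_fourier f F'"
  shows "AE \<xi> in lborel. F \<xi> = F' \<xi>"
proof -
  have [measurable]: "F \<in> borel_measurable borel" "F' \<in> borel_measurable borel"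
    using F F' by (simp_all add: is_L2_fourier_def)
  define A where "A G n = (\<integral>\<^sup>+ \<xi>. ennreal ((cmod (G \<xi> - truncated_fourier f (real n) \<xi>))\<^sup>2) \<partial>lborel)" for G and n :: nat
  have A0: "A F \<longlonglongrightarrow> 0" "A F' \<longlonglongrightarrow> 0"
    unfolding A_def using F F' filterlim_compose[OF _ filterlim_real_sequentially]
    unfolding is_L2_fourier_def by blast+
  have le: "(\<integral>\<^sup>+ \<xi>. ennreal ((cmod (F \<xi> - F' \<xi>))\<^sup>2) \<partial>lborel) \<le> 2 * A F n + 2 * A F' n" for n
  proof -
    have "(cmod (a - b))\<^sup>2 \<le> 2 * (cmod (a - c))\<^sup>2 + 2 * (cmod (b - c))\<^sup>2" for a b c
    proof -
      have "cmod (a - b) \<le> cmod (a - c) + cmod (b - c)"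
        using norm_triangle_ineq4[of "a - c" "b - c"] by simp
      then have "(cmod (a - b))\<^sup>2 \<le> (cmod (a - c) + cmod (b - c))\<^sup>2" by (rule power_mono) simp
      also have "\<dots> \<le> 2 * (cmod (a - c))\<^sup>2 + 2 * (cmod (b - c))\<^sup>2"
        using sum_squares_bound[of "cmod (a - c)" "cmod (b - c)"] by (simp add: power2_sum)
      finally show ?thesis .
    qed
    then have "(\<integral>\<^sup>+ \<xi>. ennreal ((cmod (F \<xi> - F' \<xi>))\<^sup>2) \<partial>lborel)
       \<le> (\<integral>\<^sup>+ \<xi>. ennreal (2 * (cmod (F \<xi> - truncated_fourier f (real n) \<xi>))\<^sup>2 +
          2 * (cmod (F' \<xi> - truncated_fourier f (real n) \<xi>))\<^sup>2) \<partial>lborel)"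
      by (intro nn_integral_mono ennreal_leI)
    also have "\<dots> = 2 * A F n + 2 * A F' n"
      unfolding A_def by (simp add: ennreal_mult nn_integral_add nn_integral_cmult)
    finally show ?thesis .
  qed
  have "(\<lambda>n. 2 * A F n + 2 * A F' n) \<longlonglongrightarrow> 2 * 0 + 2 * 0"
    using A0 by (intro tendsto_add ennreal_tendsto_cmult) auto
  then have "(\<lambda>n. 2 * A F n + 2 * A F' n) \<longlonglongrightarrow> 0" by simp
  then have "(\<integral>\<^sup>+ \<xi>. ennreal ((cmod (F \<xi> - F' \<xi>))\<^sup>2) \<partial>lborel) \<le> 0"
    by (rule LIMSEQ_le_const) (use le in auto)
  then have "(\<integral>\<^sup>+ \<xi>. ennreal ((cmod (F \<xi> - F' \<xi>))\<^sup>2) \<partial>lborel) = 0" by simp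
  then have "AE \<xi> in lborel. ennreal ((cmod (F \<xi> - F' \<xi>))\<^sup>2) = 0"
    by (subst (asm) nn_integral_0_iff_AE) auto
  then show ?thesis by eventually_elim simp
qed

text \<open>
  Membership in the Sobolev space is witnessed by some transform, while the norm uses a chosen one.
  Both agree almost everywhere.
\<close>

lemma sobolev_space_L2_fourier:
  fixes f :: "'a::euclidean_space \<Rightarrow> real"
  assumes "f \<in> sobolev_space m"
  shows "continuous_on UNIV f" "integrable lborel (\<lambda>x. (f x)\<^sup>2)" "is_L2_fourier f (L2_fourier f)"
    "integrable lborel (\<lambda>\<xi>. (1 + (norm \<xi>)\<^sup>2) powr m * (cmod (L2_fourier f \<xi>))\<^sup>2)"
proof -
  obtain F where F: "is_L2_fourier f F"
    and i: "integrable lborel (\<lambda>\<xi>. (1 + (norm \<xi>)\<^sup>2) powr m * (cmod (F \<xi>))\<^sup>2)"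
    and f: "continuous_on UNIV f" "integrable lborel (\<lambda>x. (f x)\<^sup>2)"
    using assms unfolding sobolev_space_def by auto
  show "continuous_on UNIV f" "integrable lborel (\<lambda>x. (f x)\<^sup>2)" by fact+
  show L: "is_L2_fourier f (L2_fourier f)" unfolding L2_fourier_def by (rule someI[of "is_L2_fourier f", OF F])
  have [measurable]: "F \<in> borel_measurable borel" "L2_fourier f \<in> borel_measurable borel"
    using F L by (simp_all add: is_L2_fourier_def)
  have "AE \<xi> in lborel. F \<xi> = L2_fourier f \<xi>"
    by (rule is_L2_fourier_unique[OF borel_measurable_continuous_onI[OF f(1)] F L])
  then have "AE \<xi> in lborel. (1 + (norm \<xi>)\<^sup>2) powr m * (cmod (F \<xi>))\<^sup>2 = (1 + (norm \<xi>)\<^sup>2) powr m * (cmod (L2_fourier f \<xi>))\<^sup>2"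
    by eventually_elim simp
  then show "integrable lborel (\<lambda>\<xi>. (1 + (norm \<xi>)\<^sup>2) powr m * (cmod (L2_fourier f \<xi>))\<^sup>2)"
    using i by (subst (asm) integrable_cong_AE) auto
qed

lemma powr_half_square: "(x powr (a / 2))\<^sup>2 = (x::real) powr a"
  by (simp add: power2_eq_square powr_add[symmetric])

text \<open>
  The Cauchy--Schwarz inequality after distributing the weight \<open>(1 + |\<xi>|\<^sup>2)\<^bsup>m\<^esup>\<close>. With \<open>k = 1\<close> and \<open>m > d/2\<close>
  it shows that the transform is integrable, with \<open>k\<close> the symbol of a difference it bounds
  that difference by the Sobolev norm.
\<close>

lemma sobolev_weighted_fourier:
  fixes f :: "'a::euclidean_space \<Rightarrow> real"
  assumes f: "f \<in> sobolev_space m"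
    and k [measurable]: "k \<in> borel_measurable borel" and k0: "\<And>\<xi>. k \<xi> \<ge> 0"
    and ki: "integrable lborel (\<lambda>\<xi>. (k \<xi>)\<^sup>2 * (1 + (norm \<xi>)\<^sup>2) powr (-m))"
  shows "integrable lborel (\<lambda>\<xi>. cmod (L2_fourier f \<xi>) * k \<xi>)"
    and "(\<integral>\<xi>. cmod (L2_fourier f \<xi>) * k \<xi> \<partial>lborel)
      \<le> sobolev_norm m f * sqrt (\<integral>\<xi>. (k \<xi>)\<^sup>2 * (1 + (norm \<xi>)\<^sup>2) powr (-m) \<partial>lborel)"
proof -
  let ?F = "L2_fourier f"
  note s = sobolev_space_L2_fourier[OF f]
  have Fm [measurable]: "?F \<in> borel_measurable borel" using s(3) by (simp add: is_L2_fourier_def)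
  let ?u = "\<lambda>\<xi>. (1 + (norm \<xi>)\<^sup>2) powr (m/2) * cmod (?F \<xi>)"
  let ?w = "\<lambda>\<xi>::'a. k \<xi> * (1 + (norm \<xi>)\<^sup>2) powr (-m/2)"
  have u2: "(?u \<xi>)\<^sup>2 = (1 + (norm \<xi>)\<^sup>2) powr m * (cmod (?F \<xi>))\<^sup>2" for \<xi>
    unfolding power_mult_distrib powr_half_square ..
  have w2: "(?w \<xi>)\<^sup>2 = (k \<xi>)\<^sup>2 * (1 + (norm \<xi>)\<^sup>2) powr (-m)" for \<xi>
    unfolding power_mult_distrib powr_half_square ..
  have uw: "?u \<xi> * ?w \<xi> = cmod (?F \<xi>) * k \<xi>" for \<xi>
  proof -
    have "(1 + (norm \<xi>)\<^sup>2) powr (m/2) * (1 + (norm \<xi>)\<^sup>2) powr (-m/2) = 1"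
      by (simp add: powr_add[symmetric] add_nonneg_eq_0_iff)
    moreover have "p * c * (k \<xi> * q) = p * q * (c * k \<xi>)" for p q c by (simp only: mult_ac)
    ultimately show ?thesis by simp
  qed
  have um: "?u \<in> borel_measurable lborel" "?w \<in> borel_measurable lborel" by measurable
  have u2i: "integrable lborel (\<lambda>\<xi>. (?u \<xi>)\<^sup>2)" unfolding u2 by (rule s(4))
  have w2i: "integrable lborel (\<lambda>\<xi>. (?w \<xi>)\<^sup>2)" unfolding w2 by (rule ki)
  show "integrable lborel (\<lambda>\<xi>. cmod (?F \<xi>) * k \<xi>)"
    using lebesgue_cauchy_schwarz(1)[OF um u2i w2i] unfolding uw .
  have "(\<integral>\<xi>. \<bar>cmod (?F \<xi>) * k \<xi>\<bar> \<partial>lborel) \<le> sobolev_norm m f * sqrt (\<integral>\<xi>. (k \<xi>)\<^sup>2 * (1 + (norm \<xi>)\<^sup>2) powr (-m) \<partial>lborel)"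
    using lebesgue_cauchy_schwarz(2)[OF um u2i w2i] unfolding uw u2 w2 sobolev_norm_def .
  moreover have "\<bar>cmod (?F \<xi>) * k \<xi>\<bar> = cmod (?F \<xi>) * k \<xi>" for \<xi> using k0[of \<xi>] by simp
  ultimately show "(\<integral>\<xi>. cmod (L2_fourier f \<xi>) * k \<xi> \<partial>lborel)
      \<le> sobolev_norm m f * sqrt (\<integral>\<xi>. (k \<xi>)\<^sup>2 * (1 + (norm \<xi>)\<^sup>2) powr (-m) \<partial>lborel)" by (simp only:)
qed

lemma cmod_one_minus_cis: "cmod (1 - cis t) \<le> min 2 \<bar>t\<bar>"
proof -
  have "cmod (cis t - 1) \<le> \<bar>t\<bar>" using iexp_approx1[of t 0] by (simp add: cis_conv_exp)
  then have "cmod (1 - cis t) \<le> \<bar>t\<bar>" by (simp only: norm_minus_commute)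
  moreover have "cmod (1 - cis t) \<le> 2" using norm_triangle_ineq4[of 1 "cis t"] by simp
  ultimately show ?thesis by simp
qed

text \<open>
  Shifting by \<open>z\<close> multiplies the transform by \<open>cis (inner z \<xi>)\<close>, so by the binomial theorem the
  \<open>k\<close>-th difference multiplies it by \<open>(1 - cis (inner z \<xi>)) ^ k\<close>.
\<close>

lemma finite_difference_bound:
  fixes f :: "'a::euclidean_space \<Rightarrow> real" and x z :: 'a
  assumes m: "m > real DIM('a) / 2" and f: "f \<in> sobolev_space m" and s: "norm z \<le> s"
  shows "\<bar>\<Sum>j\<le>k. (-1) ^ j * real (k choose j) * f (x + real j *\<^sub>R z)\<bar>
    \<le> fourier_const TYPE('a) * (\<integral>\<xi>. cmod (L2_fourier f \<xi>) * min 2 (s * norm \<xi>) ^ k \<partial>lborel)"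
proof -
  let ?F = "L2_fourier f"
  note S = sobolev_space_L2_fourier[OF f]
  have Fm [measurable]: "?F \<in> borel_measurable borel" using S(3) by (simp add: is_L2_fourier_def)
  have "integrable lborel (\<lambda>\<xi>. cmod (?F \<xi>))"
    using sobolev_weighted_fourier(1)[OF f, of "\<lambda>_. 1"] integrable_one_plus_norm_square_powr[OF m] by simp
  then have Fi: "integrable lborel ?F" by (subst (asm) integrable_norm_iff) auto
  have s0: "s \<ge> 0" using s norm_ge_zero[of z] by linarith
  let ?c = "complex_of_real (fourier_const TYPE('a))"
  let ?S = "\<Sum>j\<le>k. (-1) ^ j * real (k choose j) * f (x + real j *\<^sub>R z)"
    and ?T = "\<lambda>j \<xi>. ((-1) ^ j * of_nat (k choose j)) * (?F \<xi> * cis (inner (x + real j *\<^sub>R z) \<xi>))"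
    and ?D = "\<lambda>\<xi>. ?F \<xi> * cis (inner x \<xi>) * (1 - cis (inner z \<xi>)) ^ k"
    and ?B = "\<lambda>\<xi>. cmod (?F \<xi>) * min 2 (s * norm \<xi>) ^ k"
  have Fci: "integrable lborel (\<lambda>\<xi>. ?F \<xi> * cis (inner y \<xi>))" for y
    by (rule Bochner_Integration.integrable_bound[OF Fi]) (auto simp: norm_mult)
  have inv: "complex_of_real (f y) = ?c * (\<integral>\<xi>. ?F \<xi> * cis (inner y \<xi>) \<partial>lborel)" for y
    by (rule fourier_inversion[OF S(1-3) Fi])
  have "complex_of_real ?S
     = (\<Sum>j\<le>k. (-1) ^ j * of_nat (k choose j) * (?c * (\<integral>\<xi>. ?F \<xi> * cis (inner (x + real j *\<^sub>R z) \<xi>) \<partial>lborel)))"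
    by (simp add: inv)
  also have "\<dots> = ?c * (\<Sum>j\<le>k. (\<integral>\<xi>. ?T j \<xi> \<partial>lborel))"
    unfolding integral_mult_right_zero sum_distrib_left by (intro sum.cong refl) (simp only: mult_ac)
  also have "(\<Sum>j\<le>k. (\<integral>\<xi>. ?T j \<xi> \<partial>lborel))
     = (\<integral>\<xi>. (\<Sum>j\<le>k. ?T j \<xi>) \<partial>lborel)"
    by (intro Bochner_Integration.integral_sum[symmetric] integrable_mult_right Fci)
  also have "\<dots> = (\<integral>\<xi>. ?D \<xi> \<partial>lborel)"
  proof (intro Bochner_Integration.integral_cong refl)
    fix \<xi> :: 'a
    have t: "?T j \<xi>
      = ?F \<xi> * cis (inner x \<xi>) * (of_nat (k choose j) * (- cis (inner z \<xi>)) ^ j * 1 ^ (k - j))" for j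
    proof -
      have "cis (inner (x + real j *\<^sub>R z) \<xi>) = cis (inner x \<xi>) * cis (inner z \<xi>) ^ j"
        by (simp only: inner_add_left inner_scaleR_left cis_mult[symmetric] Complex.DeMoivre[symmetric])
      moreover have "(- cis (inner z \<xi>)) ^ j = (-1) ^ j * cis (inner z \<xi>) ^ j"
        by (rule power_minus)
      ultimately show ?thesis by simp
    qed
    have "(1 - cis (inner z \<xi>)) ^ k = (- cis (inner z \<xi>) + 1) ^ k" by simp
    also have "\<dots> = (\<Sum>j\<le>k. of_nat (k choose j) * (- cis (inner z \<xi>)) ^ j * 1 ^ (k - j))"
      by (rule binomial_ring)
    finally show "(\<Sum>j\<le>k. ?T j \<xi>)
       = ?D \<xi>"
      unfolding t sum_distrib_left[symmetric] by (simp only:)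
  qed
  finally have eq: "complex_of_real ?S
     = ?c * (\<integral>\<xi>. ?D \<xi> \<partial>lborel)" .
  have c0: "fourier_const TYPE('a) \<ge> 0" by (simp add: fourier_const_def)
  have bi: "integrable lborel (\<lambda>\<xi>. ?B \<xi>)"
  proof (rule Bochner_Integration.integrable_bound)
    show "integrable lborel (\<lambda>\<xi>. 2 ^ k * cmod (?F \<xi>))" using integrable_norm[OF Fi] by (rule integrable_mult_right)
    have "\<bar>min 2 (s * norm \<xi>) ^ k\<bar> \<le> 2 ^ k" for \<xi> :: 'a
      unfolding power_abs using s0 by (intro power_mono) auto
    then have "cmod (?F \<xi>) * \<bar>min 2 (s * norm \<xi>) ^ k\<bar> \<le> cmod (?F \<xi>) * 2 ^ k" for \<xi>
      by (intro mult_left_mono) auto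
    then show "AE \<xi> in lborel. norm (?B \<xi>) \<le> norm (2 ^ k * cmod (?F \<xi>))"
      by (intro AE_I2) (simp add: abs_mult mult.commute[of _ "2 ^ k"])
  qed measurable
  have "cmod (\<integral>\<xi>. ?D \<xi> \<partial>lborel)
    \<le> (\<integral>\<xi>. cmod (?D \<xi>) \<partial>lborel)"
    by (rule integral_norm_bound)
  also have "\<dots> \<le> (\<integral>\<xi>. ?B \<xi> \<partial>lborel)"
  proof (rule integral_mono_AE'[OF bi])
    show "AE \<xi> in lborel. cmod (?D \<xi>) \<le> ?B \<xi>"
    proof (intro AE_I2)
      fix \<xi> :: 'a
      have "\<bar>inner z \<xi>\<bar> \<le> norm z * norm \<xi>" by (rule Cauchy_Schwarz_ineq2)
      also have "\<dots> \<le> s * norm \<xi>" using s by (intro mult_right_mono) auto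
      finally have "cmod (1 - cis (inner z \<xi>)) \<le> min 2 (s * norm \<xi>)"
        using cmod_one_minus_cis[of "inner z \<xi>"] by linarith
      then have "cmod (1 - cis (inner z \<xi>)) ^ k \<le> min 2 (s * norm \<xi>) ^ k" by (intro power_mono) auto
      then show "cmod (?D \<xi>) \<le> ?B \<xi>"
        unfolding norm_mult norm_power norm_cis mult_1_right by (intro mult_left_mono) auto
    qed
    show "AE \<xi> in lborel. 0 \<le> ?B \<xi>"
      using s0 by (intro AE_I2 mult_nonneg_nonneg zero_le_power) auto
  qed
  finally have "fourier_const TYPE('a) * cmod (\<integral>\<xi>. ?D \<xi> \<partial>lborel)
     \<le> fourier_const TYPE('a) * (\<integral>\<xi>. ?B \<xi> \<partial>lborel)"
    using c0 by (rule mult_left_mono)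
  moreover have "\<bar>?S\<bar>
     = cmod (complex_of_real ?S)"
    by (rule norm_of_real[symmetric])
  ultimately show ?thesis
    unfolding eq norm_mult norm_of_real using c0 by (simp only: abs_of_nonneg)
qed

text \<open>
  Substituting \<open>\<xi> = \<eta> / s\<close> brings out the power of \<open>s\<close>. The remaining integrand stays below a multiple of
  \<open>(1 + |\<eta>|\<^sup>2)\<^bsup>-m\<^esup>\<close>, uniformly in \<open>s\<close>: for large \<open>|\<eta>|\<close> the symbol is bounded, and near \<open>0\<close> the order \<open>k \<ge> m\<close> of
  the difference compensates the singularity \<open>|\<eta>|\<^bsup>-2m\<^esup>\<close>.
\<close>

lemma difference_symbol_integral:
  fixes m s :: real and k :: nat
  assumes m: "m > real DIM('a::euclidean_space) / 2" and k: "real k \<ge> m" and s: "s > 0"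
  shows "integrable lborel (\<lambda>\<xi>::'a. (min 2 (s * norm \<xi>) ^ k)\<^sup>2 * (1 + (norm \<xi>)\<^sup>2) powr (-m))"
    and "(\<integral>\<xi>. (min 2 (s * norm \<xi>) ^ k)\<^sup>2 * (1 + (norm \<xi>)\<^sup>2) powr (-m) \<partial>(lborel::'a measure))
      \<le> s powr (2 * m - DIM('a)) * (4 ^ k * 2 powr m * (\<integral>\<xi>. (1 + (norm \<xi>)\<^sup>2) powr (-m) \<partial>(lborel::'a measure)))"
proof -
  let ?d = "DIM('a)"
  let ?h = "\<lambda>\<xi>::'a. (min 2 (s * norm \<xi>) ^ k)\<^sup>2 * (1 + (norm \<xi>)\<^sup>2) powr (-m)"
  let ?B = "4 ^ k * 2 powr m"
  have m0: "m > 0" using m by (rule order.strict_trans1[rotated]) simp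
  have k0: "k > 0" using k m0 by (cases k) auto
  have hm: "?h \<in> borel_measurable borel" by measurable
  have pw: "?h (0 + (1/s) *\<^sub>R \<eta>) \<le> s powr (2 * m) * (?B * (1 + (norm \<eta>)\<^sup>2) powr (-m))" for \<eta>
  proof (cases "\<eta> = 0")
    case True
    then show ?thesis using k0 by (simp add: power_0_left)
  next
    case False
    define r where "r = norm \<eta>"
    have r: "r > 0" using False by (simp add: r_def)
    have "?h (0 + (1/s) *\<^sub>R \<eta>) = (min 2 r ^ k)\<^sup>2 * (1 + (r / s)\<^sup>2) powr (-m)"
      using s by (simp add: r_def)
    also have "\<dots> \<le> (min 2 r ^ k)\<^sup>2 * ((r / s)\<^sup>2) powr (-m)"
      using r s m0 by (intro mult_left_mono powr_mono2') auto
    also have "((r / s)\<^sup>2) powr (-m) = s powr (2 * m) * r powr (- 2 * m)"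
    proof -
      have "(r / s)\<^sup>2 = (r / s) powr 2" using r s by simp
      then have "((r / s)\<^sup>2) powr (-m) = (r / s) powr (- 2 * m)" by (simp only: powr_powr) simp
      also have "\<dots> = r powr (- 2 * m) / s powr (- 2 * m)" using r s by (simp add: powr_divide)
      also have "\<dots> = s powr (2 * m) * r powr (- 2 * m)" using s by (simp add: powr_minus divide_inverse)
      finally show ?thesis .
    qed
    also have "(min 2 r ^ k)\<^sup>2 * (s powr (2 * m) * r powr (- 2 * m)) = s powr (2 * m) * ((min 2 r ^ k)\<^sup>2 * r powr (- 2 * m))"
      by simp
    also have "\<dots> \<le> s powr (2 * m) * (?B * (1 + r\<^sup>2) powr (-m))"
    proof (intro mult_left_mono)
      show "(min 2 r ^ k)\<^sup>2 * r powr (- 2 * m) \<le> ?B * (1 + r\<^sup>2) powr (-m)"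
      proof (cases "r \<le> 1")
        case True
        have "min 2 r ^ k = r powr (2 * real k / 2)" using True r by (simp add: powr_realpow)
        then have "(min 2 r ^ k)\<^sup>2 * r powr (- 2 * m) = r powr (2 * real k) * r powr (- 2 * m)"
          by (simp only: powr_half_square)
        also have "\<dots> = r powr (2 * real k - 2 * m)" by (simp add: powr_add[symmetric])
        also have "\<dots> \<le> 1" using True r k by (intro powr_le1) auto
        also have "1 = 2 powr m * 2 powr (-m)" by (simp add: powr_add[symmetric])
        also have "\<dots> \<le> 2 powr m * (1 + r\<^sup>2) powr (-m)"
          using True r m0 by (intro mult_left_mono powr_mono2') (auto simp: power_le_one add_pos_nonneg)
        also have "\<dots> \<le> ?B * (1 + r\<^sup>2) powr (-m)" by (intro mult_right_mono) auto
        finally show ?thesis .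
      next
        case False
        have "(min 2 r ^ k)\<^sup>2 \<le> (2 ^ k)\<^sup>2" using r by (intro power_mono) auto
        also have "(2 ^ k)\<^sup>2 = (4::real) ^ k" by (simp only: power2_eq_square power_mult_distrib[symmetric]) simp
        finally have 1: "(min 2 r ^ k)\<^sup>2 \<le> 4 ^ k" .
        have "r powr (- 2 * m) = (r powr 2) powr (-m)" by (simp only: powr_powr) simp
        also have "r powr 2 = r\<^sup>2" using r by simp
        also have "(r\<^sup>2) powr (-m) = 2 powr m * (2 * r\<^sup>2) powr (-m)"
          using r by (simp add: powr_mult powr_minus)
        also have "\<dots> \<le> 2 powr m * (1 + r\<^sup>2) powr (-m)"
          using False m0 by (intro mult_left_mono powr_mono2') (auto simp: add_pos_nonneg)
        finally have 2: "r powr (- 2 * m) \<le> 2 powr m * (1 + r\<^sup>2) powr (-m)" .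
        show ?thesis unfolding mult.assoc by (intro mult_mono 1 2) auto
      qed
    qed simp
    finally show ?thesis unfolding r_def .
  qed
  have h0: "?h \<xi> \<ge> 0" for \<xi> by simp
  have Gi: "integrable lborel (\<lambda>\<eta>::'a. s powr (2 * m) * (?B * (1 + (norm \<eta>)\<^sup>2) powr (-m)))"
    by (intro integrable_mult_right integrable_one_plus_norm_square_powr m)
  have hs: "integrable lborel (\<lambda>\<eta>. ?h (0 + (1/s) *\<^sub>R \<eta>))"
  proof (rule Bochner_Integration.integrable_bound[OF Gi])
    show "AE \<eta> in lborel. norm (?h (0 + (1/s) *\<^sub>R \<eta>)) \<le> norm (s powr (2 * m) * (?B * (1 + (norm \<eta>)\<^sup>2) powr (-m)))"
    proof (intro AE_I2)
      fix \<eta> :: 'a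
      show "norm (?h (0 + (1/s) *\<^sub>R \<eta>)) \<le> norm (s powr (2 * m) * (?B * (1 + (norm \<eta>)\<^sup>2) powr (-m)))"
        unfolding real_norm_def using pw[of \<eta>] h0[of "0 + (1/s) *\<^sub>R \<eta>"] by linarith
    qed
  qed measurable
  show "integrable lborel ?h"
    using hs by (subst (asm) integrable_lborel_affine[OF hm]) (use s in auto)
  have "integral\<^sup>L lborel ?h = (\<bar>1/s\<bar> ^ ?d) *\<^sub>R (\<integral>\<eta>. ?h (0 + (1/s) *\<^sub>R \<eta>) \<partial>lborel)"
    by (rule integral_lborel_affine[OF hm]) (use s in auto)
  also have "\<dots> \<le> (\<bar>1/s\<bar> ^ ?d) *\<^sub>R (\<integral>\<eta>. s powr (2 * m) * (?B * (1 + (norm \<eta>)\<^sup>2) powr (-m)) \<partial>(lborel::'a measure))"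
    using pw by (intro scaleR_left_mono integral_mono hs Gi) auto
  also have "\<dots> = (\<bar>1/s\<bar> ^ ?d * s powr (2 * m)) * (?B * (\<integral>\<eta>. (1 + (norm \<eta>)\<^sup>2) powr (-m) \<partial>(lborel::'a measure)))"
    by simp
  also have "\<bar>1/s\<bar> ^ ?d * s powr (2 * m) = s powr (2 * m - ?d)"
    using s by (simp add: powr_diff powr_realpow power_one_over)
  finally show "integral\<^sup>L lborel ?h \<le> s powr (2 * m - ?d) * (?B * (\<integral>\<eta>. (1 + (norm \<eta>)\<^sup>2) powr (-m) \<partial>(lborel::'a measure)))" .
qed

lemma sobolev_norm_nonneg: "sobolev_norm m f \<ge> 0"
  unfolding sobolev_norm_def by (intro real_sqrt_ge_zero integral_nonneg_AE) simp

text \<open>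
  Estimates that hold for every extension pass to the quotient norm.
\<close>

lemma sobolev_norm_on_greatest:
  assumes ne: "sobolev_extensions m \<Omega> v \<noteq> {}" and c: "c \<ge> 0"
    and le: "\<And>f. f \<in> sobolev_extensions m \<Omega> v \<Longrightarrow> a \<le> b + c * sobolev_norm m f"
  shows "a \<le> b + c * sobolev_norm_on m \<Omega> v"
proof (cases "c = 0")
  case True
  then show ?thesis using ne le by auto
next
  case False
  then have "(a - b) / c \<le> sobolev_norm m f" if "f \<in> sobolev_extensions m \<Omega> v" for f
    using c le[OF that] by (simp add: field_simps)
  then have "(a - b) / c \<le> sobolev_norm_on m \<Omega> v"
    unfolding sobolev_norm_on_def by (intro cINF_greatest[OF ne])
  then show ?thesis using False c by (simp add: field_simps)
qed

text \<open>
  The Cauchy--Schwarz inequality on the ball, followed by the change of variables \<open>y = q + s u\<close>, whose Jacobian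
  is the source of the factor \<open>s\<^bsup>-d/2\<^esup>\<close>.
\<close>

lemma translated_ball_average:
  fixes f v :: "'a::euclidean_space \<Rightarrow> real" and q :: 'a
  assumes f: "continuous_on UNIV f" and f2: "integrable lborel (\<lambda>x. (f x)\<^sup>2)"
    and \<Omega>: "compact \<Omega>" and v: "\<And>y. y \<in> \<Omega> \<Longrightarrow> f y = v y"
    and s: "s > 0" and sub: "\<And>u. u \<in> ball 0 \<rho> \<Longrightarrow> q + s *\<^sub>R u \<in> \<Omega>"
  shows "integrable lborel (\<lambda>u::'a. indicator (ball 0 \<rho>) u * \<bar>f (q + s *\<^sub>R u)\<bar>)"
    and "(\<integral>u. indicator (ball 0 \<rho>) u * \<bar>f (q + s *\<^sub>R u)\<bar> \<partial>lborel)
      \<le> sqrt (measure lborel (ball (0::'a) \<rho>)) * (s powr (- real DIM('a) / 2) * L2_norm_on \<Omega> v)"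
proof -
  have fm [measurable]: "f \<in> borel_measurable borel"
    using f by (rule borel_measurable_continuous_onI)
  have Om [measurable]: "\<Omega> \<in> sets borel" using \<Omega> by (simp add: borel_closed compact_imp_closed)
  have bm [measurable]: "ball (0::'a) \<rho> \<in> sets borel" by simp
  let ?\<iota> = "\<lambda>u::'a. indicator (ball 0 \<rho>) u :: real"
  let ?g = "\<lambda>u. ?\<iota> u * f (q + s *\<^sub>R u)"
  let ?h = "\<lambda>y. indicator \<Omega> y * (f y)\<^sup>2"
  have \<iota>2: "(?\<iota> u)\<^sup>2 = ?\<iota> u" for u by (simp add: indicator_def)
  have fin: "emeasure lborel (ball (0::'a) \<rho>) < \<infinity>" by (rule emeasure_lborel_ball_finite)
  have \<iota>i: "integrable lborel (\<lambda>u. (?\<iota> u)\<^sup>2)" unfolding \<iota>2 using fin by simp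
  have hm: "?h \<in> borel_measurable borel" by measurable
  have hi: "integrable lborel ?h"
    by (rule Bochner_Integration.integrable_bound[OF f2]) (auto simp: indicator_def)
  have hsi: "integrable lborel (\<lambda>u. ?h (q + s *\<^sub>R u))"
    using hi by (subst integrable_lborel_affine[OF hm]) (use s in auto)
  have g2: "(?g u)\<^sup>2 \<le> ?h (q + s *\<^sub>R u)" for u using sub[of u] by (auto simp: indicator_def)
  have gi: "integrable lborel (\<lambda>u. (?g u)\<^sup>2)"
  proof (rule Bochner_Integration.integrable_bound[OF hsi])
    show "AE u in lborel. norm ((?g u)\<^sup>2) \<le> norm (?h (q + s *\<^sub>R u))"
      using g2 by (intro AE_I2) (auto intro: order_trans)
  qed measurable
  have eq: "?\<iota> u * ?g u = ?\<iota> u * f (q + s *\<^sub>R u)" for u by (simp add: indicator_def)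
  have abs: "\<bar>?\<iota> u * f (q + s *\<^sub>R u)\<bar> = ?\<iota> u * \<bar>f (q + s *\<^sub>R u)\<bar>" for u by (simp add: abs_mult)
  have \<iota>m: "?\<iota> \<in> borel_measurable lborel" "?g \<in> borel_measurable lborel" by measurable
  note cs = lebesgue_cauchy_schwarz[OF \<iota>m \<iota>i gi, unfolded eq]
  show "integrable lborel (\<lambda>u. ?\<iota> u * \<bar>f (q + s *\<^sub>R u)\<bar>)"
    using integrable_abs[OF cs(1)] unfolding abs .
  have 1: "(\<integral>u. (?\<iota> u)\<^sup>2 \<partial>lborel) = measure lborel (ball (0::'a) \<rho>)" unfolding \<iota>2 by simp
  have L: "(\<integral>y. ?h y \<partial>lborel) = (L2_norm_on \<Omega> v)\<^sup>2"
  proof -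
    have "set_lebesgue_integral lborel \<Omega> (\<lambda>y. (v y)\<^sup>2) = (\<integral>y. ?h y \<partial>lborel)"
      unfolding set_lebesgue_integral_def by (intro Bochner_Integration.integral_cong) (auto simp: indicator_def v)
    moreover have "(\<integral>y. ?h y \<partial>lborel) \<ge> 0" by (intro integral_nonneg_AE) simp
    ultimately show ?thesis unfolding L2_norm_on_def by simp
  qed
  have "(\<integral>y. ?h y \<partial>lborel) = (\<bar>s\<bar> ^ DIM('a)) *\<^sub>R (\<integral>u. ?h (q + s *\<^sub>R u) \<partial>lborel)"
    by (rule integral_lborel_affine[OF hm]) (use s in auto)
  then have "(\<integral>u. ?h (q + s *\<^sub>R u) \<partial>lborel) = s powr (- real DIM('a)) * (L2_norm_on \<Omega> v)\<^sup>2"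
    unfolding L using s by (simp add: powr_minus powr_realpow field_simps)
  moreover have "(\<integral>u. (?g u)\<^sup>2 \<partial>lborel) \<le> (\<integral>u. ?h (q + s *\<^sub>R u) \<partial>lborel)"
    by (intro integral_mono gi hsi g2)
  ultimately have "sqrt (\<integral>u. (?g u)\<^sup>2 \<partial>lborel) \<le> sqrt (s powr (- real DIM('a)) * (L2_norm_on \<Omega> v)\<^sup>2)"
    by simp
  also have "\<dots> = s powr (- real DIM('a) / 2) * \<bar>L2_norm_on \<Omega> v\<bar>"
  proof -
    have "s powr (- real DIM('a)) = (s powr (- real DIM('a) / 2))\<^sup>2" by (rule powr_half_square[symmetric])
    then show ?thesis by (simp add: real_sqrt_mult)
  qed
  also have "\<bar>L2_norm_on \<Omega> v\<bar> = L2_norm_on \<Omega> v"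
  proof -
    have "set_lebesgue_integral lborel \<Omega> (\<lambda>x. (v x)\<^sup>2) \<ge> 0"
      unfolding set_lebesgue_integral_def by (intro integral_nonneg_AE) simp
    then show ?thesis unfolding L2_norm_on_def by simp
  qed
  finally have 2: "sqrt (\<integral>u. (?g u)\<^sup>2 \<partial>lborel) \<le> s powr (- real DIM('a) / 2) * L2_norm_on \<Omega> v" .
  have "(\<integral>u. ?\<iota> u * \<bar>f (q + s *\<^sub>R u)\<bar> \<partial>lborel) \<le> sqrt (measure lborel (ball (0::'a) \<rho>)) * sqrt (\<integral>u. (?g u)\<^sup>2 \<partial>lborel)"
    using cs(2) unfolding abs 1 .
  also have "\<dots> \<le> sqrt (measure lborel (ball (0::'a) \<rho>)) * (s powr (- real DIM('a) / 2) * L2_norm_on \<Omega> v)"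
    by (intro mult_left_mono 2) simp
  finally show "(\<integral>u. ?\<iota> u * \<bar>f (q + s *\<^sub>R u)\<bar> \<partial>lborel)
      \<le> sqrt (measure lborel (ball (0::'a) \<rho>)) * (s powr (- real DIM('a) / 2) * L2_norm_on \<Omega> v)" .
qed

text \<open>
  A ball \<open>ball p \<rho>\<close> inside \<open>\<Omega>\<close> is visible from every point \<open>x\<close>: by convexity \<open>(1 - t) x + t (p + u)\<close> lies in \<open>\<Omega>\<close> for
  \<open>|u| < \<rho>\<close> and \<open>0 \<le> t \<le> 1\<close>. The \<open>k\<close>-th difference with step \<open>(h/k) (p + u - x)\<close> expresses \<open>v x\<close> by values at such
  points with \<open>t = j h / k\<close>. Averaging over \<open>u\<close> turns these values into the \<open>L\<^sub>2\<close> term, and the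
  difference contributes the Sobolev term.
\<close>

lemma sobolev_pointwise_bound:
  fixes \<Omega> :: "'a::euclidean_space set" and m :: real
  assumes conv: "convex \<Omega>" and comp: "compact \<Omega>" and int: "interior \<Omega> \<noteq> {}"
    and m: "m > real DIM('a) / 2"
  shows "\<exists>S>0. \<forall>v\<in>sobolev_space_on m \<Omega>. \<forall>x\<in>\<Omega>. \<forall>h. 0 < h \<and> h \<le> 1 \<longrightarrow>
    \<bar>v x\<bar> \<le> S * (h powr (- real DIM('a) / 2) * L2_norm_on \<Omega> v + h powr (m - real DIM('a) / 2) * sobolev_norm_on m \<Omega> v)"
proof -
  let ?d = "real DIM('a)"
  obtain p \<rho> where \<rho>: "\<rho> > 0" and ball: "ball p \<rho> \<subseteq> \<Omega>"
    using int unfolding mem_interior by (metis ex_in_conv mem_interior)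
  obtain D0 where D0: "\<And>x y. x \<in> \<Omega> \<Longrightarrow> y \<in> \<Omega> \<Longrightarrow> norm (y - x) \<le> D0"
    using compact_imp_bounded[OF comp] unfolding bounded_two_points dist_norm by blast
  \<comment> \<open>a bound for the diameter of \<open>\<Omega>\<close>, made positive\<close>
  define D where "D = max D0 1"
  have D: "D > 0" "\<And>x y. x \<in> \<Omega> \<Longrightarrow> y \<in> \<Omega> \<Longrightarrow> norm (y - x) \<le> D"
    unfolding D_def using D0 by (auto intro: max.coboundedI1)
  obtain k :: nat where k: "real k \<ge> m" using real_arch_simple by blast
  have m0: "m > 0" using m by (rule order.strict_trans1[rotated]) simp
  have k0: "k > 0" using k m0 by (cases k) auto
  define B where "B = measure lborel (ball (0::'a) \<rho>)"
  have B: "B > 0" unfolding B_def using \<rho> by (simp add: content_ball_pos)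
  define J where "J = 4 ^ k * 2 powr m * (\<integral>\<xi>. (1 + (norm \<xi>)\<^sup>2) powr (-m) \<partial>(lborel::'a measure))"
  have J0: "J \<ge> 0" unfolding J_def by (intro mult_nonneg_nonneg integral_nonneg_AE) auto
  define c where "c = fourier_const TYPE('a)"
  have c0: "c \<ge> 0" by (simp add: c_def fourier_const_def)
  define A1 where "A1 = 2 ^ k * real k powr (?d / 2) / sqrt B"
  \<comment> \<open>\<open>A1\<close> collects the factors of the averages, \<open>A2\<close> those of the finite difference.\<close>
  define A2 where "A2 = c * (D powr (m - ?d / 2) * sqrt J)"
  have A10: "A1 \<ge> 0" and A20: "A2 \<ge> 0" unfolding A1_def A2_def using B J0 c0 by auto
  define S where "S = A1 + A2 + 1"
  have "\<bar>v x\<bar> \<le> S * (h powr (- ?d / 2) * L2_norm_on \<Omega> v + h powr (m - ?d / 2) * sobolev_norm_on m \<Omega> v)"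
    if v: "v \<in> sobolev_space_on m \<Omega>" and x: "x \<in> \<Omega>" and h: "0 < h" "h \<le> 1" for v x h
  proof -
    let ?L = "L2_norm_on \<Omega> v"
    have ne: "sobolev_extensions m \<Omega> v \<noteq> {}" using v by (simp add: sobolev_space_on_def)
    have L0: "?L \<ge> 0"
      unfolding L2_norm_on_def set_lebesgue_integral_def by (intro real_sqrt_ge_zero integral_nonneg_AE) simp
    have bound: "\<bar>v x\<bar> \<le> A1 * (h powr (- ?d / 2) * ?L) + (A2 * h powr (m - ?d / 2)) * sobolev_norm m f"
      if f: "f \<in> sobolev_extensions m \<Omega> v" for f
    proof -
      have fs: "f \<in> sobolev_space m" and fv: "\<And>y. y \<in> \<Omega> \<Longrightarrow> f y = v y"
        using f by (auto simp: sobolev_extensions_def)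
      note S = sobolev_space_L2_fourier[OF fs]
      define E where "E = A2 * h powr (m - ?d / 2) * sobolev_norm m f"
      define t where "t j = real j * h / real k" for j :: nat
      let ?y = "\<lambda>j u. x + t j *\<^sub>R (p - x) + t j *\<^sub>R u" and ?i = "\<lambda>u::'a. indicator (ball 0 \<rho>) u :: real"
        and ?k = "(real k powr (?d / 2) * h powr (- ?d / 2)) * ?L"
      have t: "0 < t j" "t j \<le> 1" if "1 \<le> j" "j \<le> k" for j
      proof -
        show "0 < t j" using that h k0 by (simp add: t_def)
        have "real j * h \<le> real k * 1" using that h by (intro mult_mono) auto
        then show "t j \<le> 1" using k0 by (simp add: t_def divide_le_eq)
      qed
      have inO: "?y j u \<in> \<Omega>" if "u \<in> ball 0 \<rho>" "1 \<le> j" "j \<le> k" for u j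
      proof -
        have "p + u \<in> \<Omega>" using that(1) ball by (auto simp: dist_norm)
        then have "(1 - t j) *\<^sub>R x + t j *\<^sub>R (p + u) \<in> \<Omega>"
          using t[OF that(2,3)] by (intro convexD[OF conv x]) auto
        then show ?thesis by (simp add: algebra_simps)
      qed
      have pt: "\<bar>v x\<bar> \<le> (\<Sum>j=1..k. real (k choose j) * \<bar>f (?y j u)\<bar>) + E"
        if u: "u \<in> ball 0 \<rho>" for u
      proof -
        \<comment> \<open>The step of the difference: \<open>j\<close> steps lead from \<open>x\<close> to \<open>?y j u\<close>.\<close>
        let ?z = "(h / real k) *\<^sub>R (p + u - x)"
        have "p + u \<in> \<Omega>" using u ball by (auto simp: dist_norm)
        then have "norm (p + u - x) \<le> D" using D(2) x by blast
        moreover have "h / real k \<le> h" using h k0 by (simp add: divide_le_eq)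
        ultimately have z: "norm ?z \<le> h * D"
          using h k0 by (simp only: norm_scaleR) (intro mult_mono, auto)
        have hD: "h * D > 0" using h D by simp
        note Ji = difference_symbol_integral[OF m k hD]
        have "\<bar>\<Sum>j\<le>k. (-1) ^ j * real (k choose j) * f (x + real j *\<^sub>R ?z)\<bar>
           \<le> c * (\<integral>\<xi>. cmod (L2_fourier f \<xi>) * min 2 (h * D * norm \<xi>) ^ k \<partial>lborel)"
          unfolding c_def by (rule finite_difference_bound[OF m fs z])
        also have "\<dots> \<le> c * (sobolev_norm m f * sqrt (\<integral>\<xi>. (min 2 (h * D * norm \<xi>) ^ k)\<^sup>2 * (1 + (norm \<xi>)\<^sup>2) powr (-m) \<partial>(lborel::'a measure)))"
          using hD by (intro mult_left_mono[OF _ c0] sobolev_weighted_fourier(2)[OF fs] Ji(1)) auto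
        also have "\<dots> \<le> c * (sobolev_norm m f * sqrt ((h * D) powr (2 * m - ?d) * J))"
          using Ji(2) unfolding J_def[symmetric]
          by (intro mult_left_mono c0 sobolev_norm_nonneg real_sqrt_le_mono)
        also have "sqrt ((h * D) powr (2 * m - ?d) * J) = (h * D) powr (m - ?d / 2) * sqrt J"
        proof -
          have "(h * D) powr (2 * m - ?d) = ((h * D) powr ((2 * m - ?d) / 2))\<^sup>2" by (rule powr_half_square[symmetric])
          then have "sqrt ((h * D) powr (2 * m - ?d)) = (h * D) powr ((2 * m - ?d) / 2)" by simp
          also have "(2 * m - ?d) / 2 = m - ?d / 2" by simp
          finally show ?thesis by (simp only: real_sqrt_mult)
        qed
        also have "c * (sobolev_norm m f * ((h * D) powr (m - ?d / 2) * sqrt J)) = E"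
        proof -
          have "(h * D) powr (m - ?d / 2) = h powr (m - ?d / 2) * D powr (m - ?d / 2)"
            using h D by (simp add: powr_mult)
          then show ?thesis unfolding E_def A2_def by (simp only: mult_ac)
        qed
        finally have diff: "\<bar>\<Sum>j\<le>k. (-1) ^ j * real (k choose j) * f (x + real j *\<^sub>R ?z)\<bar> \<le> E" .
        have zt: "x + real j *\<^sub>R ?z = ?y j u" for j
          by (simp add: t_def algebra_simps)
        let ?a = "\<lambda>j. (-1) ^ j * real (k choose j) * f (?y j u)"
        have "(\<Sum>j\<le>k. ?a j) = ?a 0 + (\<Sum>j=1..k. ?a j)"
          by (simp add: atMost_atLeast0 sum.atLeast_Suc_atMost)
        also have "?a 0 = v x" using fv[OF x] by (simp add: t_def)
        finally have "v x = (\<Sum>j\<le>k. ?a j) - (\<Sum>j=1..k. ?a j)" by simp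
        moreover have "\<bar>\<Sum>j\<le>k. ?a j\<bar> \<le> E" using diff unfolding zt .
        moreover have "\<bar>\<Sum>j=1..k. ?a j\<bar> \<le> (\<Sum>j=1..k. real (k choose j) * \<bar>f (?y j u)\<bar>)"
          by (rule order_trans[OF sum_abs]) (simp add: abs_mult)
        ultimately show ?thesis by linarith
      qed
      have av: "integrable lborel (\<lambda>u::'a. ?i u * \<bar>f (?y j u)\<bar>)"
        "(\<integral>u. ?i u * \<bar>f (?y j u)\<bar> \<partial>lborel) \<le> sqrt B * (t j powr (- ?d / 2) * ?L)"
        if "1 \<le> j" "j \<le> k" for j
        unfolding B_def
        by (rule translated_ball_average[OF S(1,2) comp fv t(1)[OF that] inO[OF _ that]]; assumption)+
      have bm [measurable]: "ball (0::'a) \<rho> \<in> sets borel" by simp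
      have \<iota>i: "integrable lborel (indicator (ball (0::'a) \<rho>) :: 'a \<Rightarrow> real)"
        by (intro integrable_real_indicator emeasure_lborel_ball_finite) simp
      let ?G = "\<lambda>u::'a. (\<Sum>j=1..k. real (k choose j) * (?i u * \<bar>f (?y j u)\<bar>))
        + ?i u * E"
      have Gs: "integrable lborel (\<lambda>u::'a. \<Sum>j=1..k. real (k choose j) * (?i u * \<bar>f (?y j u)\<bar>))"
        by (intro Bochner_Integration.integrable_sum integrable_mult_right av) auto
      have Gi: "integrable lborel ?G"
        by (intro Bochner_Integration.integrable_add Gs integrable_mult_left \<iota>i)
      have "B * \<bar>v x\<bar> = (\<integral>u. ?i u * \<bar>v x\<bar> \<partial>lborel)" unfolding B_def by simp
      also have "\<dots> \<le> (\<integral>u. ?G u \<partial>lborel)"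
      proof (intro integral_mono Gi integrable_mult_left \<iota>i)
        fix u :: 'a
        show "?i u * \<bar>v x\<bar> \<le> ?G u"
          using pt[of u] by (cases "u \<in> ball 0 \<rho>") auto
      qed
      also have "\<dots> = (\<Sum>j=1..k. real (k choose j) * (\<integral>u. ?i u * \<bar>f (?y j u)\<bar> \<partial>lborel)) + B * E"
      proof -
        have "(\<integral>u. ?G u \<partial>lborel) = (\<integral>u. (\<Sum>j=1..k. real (k choose j) * (?i u * \<bar>f (?y j u)\<bar>)) \<partial>lborel)
          + (\<integral>u. ?i u * E \<partial>lborel)"
          by (intro Bochner_Integration.integral_add Gs integrable_mult_left \<iota>i)
        also have "(\<integral>u. ?i u * E \<partial>lborel) = B * E" unfolding B_def by simp
        also have "(\<integral>u. (\<Sum>j=1..k. real (k choose j) * (?i u * \<bar>f (?y j u)\<bar>)) \<partial>lborel)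
          = (\<Sum>j=1..k. (\<integral>u. real (k choose j) * (?i u * \<bar>f (?y j u)\<bar>) \<partial>lborel))"
          by (intro Bochner_Integration.integral_sum integrable_mult_right av) auto
        finally show ?thesis by simp
      qed
      also have "\<dots> \<le> (\<Sum>j=1..k. real (k choose j) * (sqrt B * ?k)) + B * E"
      proof (intro add_right_mono sum_mono mult_left_mono)
        fix j assume "j \<in> {1..k}"
        then have j: "1 \<le> j" "j \<le> k" by auto
        have "h / real k \<le> t j" unfolding t_def using j h k0 by (intro divide_right_mono) auto
        then have "t j powr (- ?d / 2) \<le> (h / real k) powr (- ?d / 2)"
          using h k0 by (intro powr_mono2') auto
        also have "\<dots> = real k powr (?d / 2) * h powr (- ?d / 2)"
          using h k0 by (simp add: powr_divide powr_minus field_simps)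
        finally have "t j powr (- ?d / 2) * ?L \<le> ?k"
          using L0 by (rule mult_right_mono)
        then have "sqrt B * (t j powr (- ?d / 2) * ?L) \<le> sqrt B * ?k"
          using B by (intro mult_left_mono) auto
        then show "(\<integral>u. ?i u * \<bar>f (?y j u)\<bar> \<partial>lborel)
          \<le> sqrt B * ?k"
          using av(2)[OF j] by linarith
      qed auto
      also have "\<dots> = (\<Sum>j=1..k. real (k choose j)) * (sqrt B * ?k) + B * E"
        by (simp only: sum_distrib_right)
      also have "\<dots> \<le> 2 ^ k * (sqrt B * ?k) + B * E"
      proof (intro add_right_mono mult_right_mono)
        have "(\<Sum>j=1..k. (k choose j)) \<le> (\<Sum>j\<le>k. (k choose j))" by (intro sum_mono2) auto
        also have "\<dots> = 2 ^ k" by (rule choose_row_sum)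
        finally have "real (\<Sum>j=1..k. (k choose j)) \<le> real (2 ^ k)" by (simp only: of_nat_le_iff)
        then show "(\<Sum>j=1..k. real (k choose j)) \<le> 2 ^ k" by simp
        show "0 \<le> sqrt B * ?k"
          using B L0 by (intro mult_nonneg_nonneg) auto
      qed
      also have "\<dots> = B * (A1 * (h powr (- ?d / 2) * ?L) + E)"
      proof -
        have "B * (1 / sqrt B) = sqrt B" using B by (simp add: field_simps)
        then have "B * A1 = 2 ^ k * real k powr (?d / 2) * sqrt B"
          unfolding A1_def by (metis mult.assoc mult.commute times_divide_eq_right mult_1_right)
        then have "B * A1 * (h powr (- ?d / 2) * ?L) = 2 ^ k * (sqrt B * ?k)"
          by (simp only: mult_ac)
        then show ?thesis by (simp only: distrib_left mult.assoc)
      qed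
      finally have "\<bar>v x\<bar> \<le> A1 * (h powr (- ?d / 2) * ?L) + E"
        using B by (simp only: mult_le_cancel_left_pos)
      then show ?thesis unfolding E_def .
    qed
    have "\<bar>v x\<bar> \<le> A1 * (h powr (- ?d / 2) * ?L) + (A2 * h powr (m - ?d / 2)) * sobolev_norm_on m \<Omega> v"
      by (rule sobolev_norm_on_greatest[OF ne _ bound]) (use A20 in auto)
    also have "\<dots> \<le> S * (h powr (- ?d / 2) * ?L) + S * (h powr (m - ?d / 2) * sobolev_norm_on m \<Omega> v)"
    proof -
      have n0: "sobolev_norm_on m \<Omega> v \<ge> 0"
        unfolding sobolev_norm_on_def by (intro cINF_greatest[OF ne] sobolev_norm_nonneg)
      have "A1 * (h powr (- ?d / 2) * ?L) \<le> S * (h powr (- ?d / 2) * ?L)"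
        using A20 L0 by (intro mult_right_mono) (auto simp: S_def)
      moreover have "A2 * (h powr (m - ?d / 2) * sobolev_norm_on m \<Omega> v) \<le> S * (h powr (m - ?d / 2) * sobolev_norm_on m \<Omega> v)"
        using A10 n0 by (intro mult_right_mono) (auto simp: S_def)
      ultimately show ?thesis by (simp only: mult.assoc)
    qed
    finally show ?thesis by (simp only: distrib_left)
  qed
  moreover have "S > 0" unfolding S_def using A10 A20 by simp
  ultimately show ?thesis by (intro exI[of _ S]) auto
qed

section \<open>Kernel ridge weights\<close>

context
  fixes \<Omega> :: "'a set" and H :: "('a \<Rightarrow> real) set" and ip :: "('a \<Rightarrow> real) \<Rightarrow> ('a \<Rightarrow> real) \<Rightarrow> real"
  assumes fh: "function_hilbert_space \<Omega> H ip"
begin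

lemma H_zero: "(\<lambda>x. 0) \<in> H"
  and H_add: "v \<in> H \<Longrightarrow> w \<in> H \<Longrightarrow> (\<lambda>x. v x + w x) \<in> H"
  and H_scale: "v \<in> H \<Longrightarrow> (\<lambda>x. c * v x) \<in> H"
  and ip_sym: "v \<in> H \<Longrightarrow> w \<in> H \<Longrightarrow> ip v w = ip w v"
  and ip_add: "u \<in> H \<Longrightarrow> v \<in> H \<Longrightarrow> w \<in> H \<Longrightarrow> ip (\<lambda>x. u x + v x) w = ip u w + ip v w"
  and ip_scale: "v \<in> H \<Longrightarrow> w \<in> H \<Longrightarrow> ip (\<lambda>x. c * v x) w = c * ip v w"
  and ip_pos: "v \<in> H \<Longrightarrow> v \<noteq> (\<lambda>x. 0) \<Longrightarrow> ip v v > 0"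
  using fh unfolding function_hilbert_space_def by blast+

lemma ip_zero: "w \<in> H \<Longrightarrow> ip (\<lambda>x. 0) w = 0"
  using ip_scale[OF H_zero, of w 0] by simp

lemma ip_nonneg: "v \<in> H \<Longrightarrow> ip v v \<ge> 0"
  using ip_pos[of v] ip_zero[OF H_zero] by (cases "v = (\<lambda>x. 0)") auto

lemma hnorm_square: "v \<in> H \<Longrightarrow> (hnorm ip v)\<^sup>2 = ip v v"
  by (simp add: hnorm_def ip_nonneg)

lemma hnorm_ge_0: "v \<in> H \<Longrightarrow> hnorm ip v \<ge> 0"
  by (simp add: hnorm_def ip_nonneg)

lemma H_linear_combination: "\<lbrakk>finite I; \<And>i. i \<in> I \<Longrightarrow> \<phi> i \<in> H\<rbrakk> \<Longrightarrow> (\<lambda>y. \<Sum>i\<in>I. c i * \<phi> i y) \<in> H"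
proof (induction I rule: finite_induct)
  case (insert i I)
  then show ?case using H_add[OF H_scale[of "\<phi> i" "c i"], of "\<lambda>y. \<Sum>i\<in>I. c i * \<phi> i y"] by simp
qed (simp add: H_zero)

lemma ip_linear_combination:
  "\<lbrakk>finite I; \<And>i. i \<in> I \<Longrightarrow> \<phi> i \<in> H; w \<in> H\<rbrakk> \<Longrightarrow> ip (\<lambda>y. \<Sum>i\<in>I. c i * \<phi> i y) w = (\<Sum>i\<in>I. c i * ip (\<phi> i) w)"
proof (induction I rule: finite_induct)
  case (insert i I)
  have "ip (\<lambda>y. c i * \<phi> i y + (\<Sum>i\<in>I. c i * \<phi> i y)) w = ip (\<lambda>y. c i * \<phi> i y) w + ip (\<lambda>y. \<Sum>i\<in>I. c i * \<phi> i y) w"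
    using insert by (intro ip_add H_scale H_linear_combination) auto
  then show ?case using insert by (simp add: ip_scale)
qed (simp add: ip_zero)

lemma H_diff: "v \<in> H \<Longrightarrow> w \<in> H \<Longrightarrow> (\<lambda>x. v x - w x) \<in> H"
  using H_add[OF _ H_scale[of w "-1"], of v] by simp

lemma ip_diff: "u \<in> H \<Longrightarrow> v \<in> H \<Longrightarrow> w \<in> H \<Longrightarrow> ip (\<lambda>x. u x - v x) w = ip u w - ip v w"
  using ip_add[OF _ H_scale[of v "-1"], of u w] ip_scale[of v w "-1"] by simp

lemma ip_cauchy_schwarz:
  assumes v: "v \<in> H" and w: "w \<in> H"
  shows "\<bar>ip v w\<bar> \<le> hnorm ip v * hnorm ip w"
proof (cases "w = (\<lambda>x. 0)")
  case True
  then have "ip v w = 0" using ip_zero[OF v] ip_sym[OF v w] by simp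
  then show ?thesis using hnorm_ge_0[OF v] hnorm_ge_0[OF w] by simp
next
  case False
  then have W: "ip w w > 0" using ip_pos[OF w] by blast
  define c where "c = ip v w / ip w w"
  let ?u = "\<lambda>x. v x - c * w x"
  have u: "?u \<in> H" by (intro H_diff H_scale v w)
  have "ip ?u ?u = ip v ?u - c * ip w ?u"
    using ip_diff[OF v H_scale[OF w] u, of c] ip_scale[OF w u, of c] by simp
  also have "ip v ?u = ip v v - c * ip v w"
    unfolding ip_sym[OF v u] using ip_diff[OF v H_scale[OF w] v, of c] ip_scale[OF w v, of c] ip_sym[OF v w] by simp
  also have "ip w ?u = ip v w - c * ip w w"
    unfolding ip_sym[OF w u] using ip_diff[OF v H_scale[OF w] w, of c] ip_scale[OF w w, of c] by simp
  finally have "ip ?u ?u = ip v v - c * ip v w"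
    using W by (simp add: c_def)
  then have "c * ip v w \<le> ip v v" using ip_nonneg[OF u] by linarith
  then have "(ip v w)\<^sup>2 \<le> ip v v * ip w w"
    using W by (simp add: c_def power2_eq_square field_simps)
  then have "sqrt ((ip v w)\<^sup>2) \<le> sqrt (ip v v * ip w w)" by (rule real_sqrt_le_mono)
  then show ?thesis by (simp add: hnorm_def real_sqrt_mult)
qed

end

text \<open>
  The representer of evaluation at \<open>x\<close>, extended by zero as the elements of the Hilbert space are.
\<close>

definition kernel_section :: "'a set \<Rightarrow> ('a \<Rightarrow> 'a \<Rightarrow> real) \<Rightarrow> 'a \<Rightarrow> 'a \<Rightarrow> real" where
  "kernel_section \<Omega> K x = (\<lambda>y. if y \<in> \<Omega> then K y x else 0)"

lemma
  assumes "rkhs \<Omega> K H ip"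
  shows rkhs_hilbert: "function_hilbert_space \<Omega> H ip"
    and rkhs_section: "x \<in> \<Omega> \<Longrightarrow> kernel_section \<Omega> K x \<in> H"
    and rkhs_eval: "x \<in> \<Omega> \<Longrightarrow> v \<in> H \<Longrightarrow> ip v (kernel_section \<Omega> K x) = v x"
  using assms unfolding rkhs_def kernel_section_def by blast+

lemma rkhs_kernel_sym:
  assumes K: "rkhs \<Omega> K H ip" and "x \<in> \<Omega>" "y \<in> \<Omega>"
  shows "K x y = K y x"
proof -
  have "kernel_section \<Omega> K y x = kernel_section \<Omega> K x y"
    using rkhs_eval[OF K] rkhs_section[OF K] ip_sym[OF rkhs_hilbert[OF K]] assms(2,3) by metis
  then show ?thesis using assms(2,3) by (simp add: kernel_section_def)
qed

lemma rkhs_kernel_psd: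
  fixes n :: nat
  assumes K: "rkhs \<Omega> K H ip" and x: "\<And>i. i < n \<Longrightarrow> x i \<in> \<Omega>"
  shows "(\<Sum>i<n. c i * (\<Sum>j<n. K (x i) (x j) * c j)) \<ge> 0"
proof -
  note fh = rkhs_hilbert[OF K]
  let ?u = "\<lambda>y. \<Sum>j<n. c j * kernel_section \<Omega> K (x j) y"
  have u: "?u \<in> H" using x by (intro H_linear_combination[OF fh] rkhs_section[OF K]) auto
  have "ip ?u ?u = (\<Sum>i<n. c i * ip (kernel_section \<Omega> K (x i)) ?u)"
    using x by (intro ip_linear_combination[OF fh] u rkhs_section[OF K]) auto
  also have "\<dots> = (\<Sum>i<n. c i * (\<Sum>j<n. K (x i) (x j) * c j))"
  proof (intro sum.cong refl)
    fix i assume i: "i \<in> {..<n}"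
    then have xi: "x i \<in> \<Omega>" using x by simp
    have "ip (kernel_section \<Omega> K (x i)) ?u = ?u (x i)"
      using ip_sym[OF fh rkhs_section[OF K xi] u] rkhs_eval[OF K xi u] by simp
    also have "\<dots> = (\<Sum>j<n. K (x i) (x j) * c j)"
      using xi by (simp add: kernel_section_def mult.commute)
    finally show "c i * ip (kernel_section \<Omega> K (x i)) ?u = c i * (\<Sum>j<n. K (x i) (x j) * c j)" by simp
  qed
  finally show ?thesis using ip_nonneg[OF fh u] by simp
qed

definition ridge_mat :: "('a \<Rightarrow> 'a \<Rightarrow> real) \<Rightarrow> real \<Rightarrow> nat \<Rightarrow> (nat \<Rightarrow> 'a) \<Rightarrow> real mat" where
  "ridge_mat K l n x = kernel_mat K n x + (l * real n) \<cdot>\<^sub>m 1\<^sub>m n"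

lemma ridge_mat_carrier: "ridge_mat K l n x \<in> carrier_mat n n"
  by (simp add: ridge_mat_def kernel_mat_def)

lemma ridge_mat_index: "i < n \<Longrightarrow> j < n \<Longrightarrow> ridge_mat K l n x $$ (i, j) = K (x i) (x j) + (if i = j then l * real n else 0)"
  by (simp add: ridge_mat_def kernel_mat_def)

lemma ridge_mat_mult_vec:
  assumes v: "v \<in> carrier_vec n" and i: "i < n"
  shows "vec_index (ridge_mat K l n x *\<^sub>v v) i = (\<Sum>j<n. K (x i) (x j) * vec_index v j) + l * real n * vec_index v i"
proof -
  have "vec_index (ridge_mat K l n x *\<^sub>v v) i = (\<Sum>j<n. ridge_mat K l n x $$ (i, j) * vec_index v j)"
    using v i ridge_mat_carrier[of K l n x] by (simp add: scalar_prod_def atLeast0LessThan)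
  also have "\<dots> = (\<Sum>j<n. K (x i) (x j) * vec_index v j + (if i = j then l * real n * vec_index v j else 0))"
    using i by (intro sum.cong refl) (simp add: ridge_mat_index distrib_right)
  also have "\<dots> = (\<Sum>j<n. K (x i) (x j) * vec_index v j) + l * real n * vec_index v i"
    using i by (simp add: sum.distrib)
  finally show ?thesis .
qed

text \<open>
  The kernel matrix is positive semidefinite, so adding a positive multiple of the identity makes
  the quadratic form definite.
\<close>

lemma ridge_mat_det:
  assumes K: "rkhs \<Omega> K H ip" and x: "\<And>i. i < n \<Longrightarrow> x i \<in> \<Omega>" and l: "l > 0" and n: "n \<ge> 1"
  shows "det (ridge_mat K l n x) \<noteq> 0"
proof
  assume "det (ridge_mat K l n x) = 0"
  then obtain v where v: "v \<in> carrier_vec n" "v \<noteq> 0\<^sub>v n" and 0: "ridge_mat K l n x *\<^sub>v v = 0\<^sub>v n"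
    using det_0_iff_vec_prod_zero_field[OF ridge_mat_carrier] by blast
  have "(\<Sum>i<n. vec_index v i * (\<Sum>j<n. K (x i) (x j) * vec_index v j)) + l * real n * (\<Sum>i<n. (vec_index v i)\<^sup>2)
      = (\<Sum>i<n. vec_index v i * vec_index (ridge_mat K l n x *\<^sub>v v) i)"
    unfolding sum_distrib_left sum.distrib[symmetric]
    using v by (intro sum.cong refl) (simp add: ridge_mat_mult_vec distrib_left power2_eq_square sum_distrib_left)
  also have "\<dots> = 0" unfolding 0 by simp
  finally have "(\<Sum>i<n. vec_index v i * (\<Sum>j<n. K (x i) (x j) * vec_index v j))
      + l * real n * (\<Sum>i<n. (vec_index v i)\<^sup>2) = 0" .
  moreover have "0 \<le> (\<Sum>i<n. vec_index v i * (\<Sum>j<n. K (x i) (x j) * vec_index v j))"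
    by (rule rkhs_kernel_psd[OF K]) (rule x)
  ultimately have "l * real n * (\<Sum>i<n. (vec_index v i)\<^sup>2) \<le> 0" by linarith
  then have "(\<Sum>i<n. (vec_index v i)\<^sup>2) \<le> 0" using l n by (simp add: mult_le_0_iff)
  moreover have "(\<Sum>i<n. (vec_index v i)\<^sup>2) \<ge> 0" by (intro sum_nonneg) simp
  ultimately have "(\<Sum>i<n. (vec_index v i)\<^sup>2) = 0" by linarith
  then have "\<forall>i\<in>{..<n}. (vec_index v i)\<^sup>2 = 0" by (subst (asm) sum_nonneg_eq_0_iff) auto
  then have "v = 0\<^sub>v n" using v(1) by (intro eq_vecI) auto
  then show False using v(2) by contradiction
qed

text \<open>
  The inverse is defined by Gauss--Jordan elimination, an opaque function of the entries. Being the inverse, it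
  equals the adjugate divided by the determinant.
\<close>

lemma ridge_inverse_adj:
  assumes "det (ridge_mat K l n x) \<noteq> 0"
  shows "ridge_inverse K l n x = (1 / det (ridge_mat K l n x)) \<cdot>\<^sub>m adj_mat (ridge_mat K l n x)"
    and "ridge_mat K l n x * ridge_inverse K l n x = 1\<^sub>m n"
    and "ridge_inverse K l n x \<in> carrier_mat n n"
proof -
  let ?A = "ridge_mat K l n x"
  note A = ridge_mat_carrier[of K l n x]
  have "mat_inverse ?A \<noteq> None"
    using mat_inverse(1)[OF A, of undefined] det_non_zero_imp_unit[OF A assms, of undefined] by blast
  then obtain B where B: "mat_inverse ?A = Some B" by blast
  then have R: "ridge_inverse K l n x = B" unfolding ridge_inverse_def ridge_mat_def[symmetric] by simp
  from mat_inverse(2)[OF A B] have AB: "?A * B = 1\<^sub>m n" "B * ?A = 1\<^sub>m n" "B \<in> carrier_mat n n" by auto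
  note ad = adj_mat[OF A]
  have "?A * ((1 / det ?A) \<cdot>\<^sub>m adj_mat ?A) = 1\<^sub>m n"
    unfolding mult_smult_distrib[OF A ad(1)] ad(2) by (intro eq_matI) (use assms in auto)
  then have "B = B * (?A * ((1 / det ?A) \<cdot>\<^sub>m adj_mat ?A))"
    using AB(3) by simp
  also have "\<dots> = (B * ?A) * ((1 / det ?A) \<cdot>\<^sub>m adj_mat ?A)"
    using AB(3) A ad(1) by (intro assoc_mult_mat[symmetric]) auto
  also have "\<dots> = (1 / det ?A) \<cdot>\<^sub>m adj_mat ?A" unfolding AB(2) using ad(1) by simp
  finally show "ridge_inverse K l n x = (1 / det ?A) \<cdot>\<^sub>m adj_mat ?A" unfolding R .
  show "?A * ridge_inverse K l n x = 1\<^sub>m n" "ridge_inverse K l n x \<in> carrier_mat n n" using AB unfolding R by auto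
qed

text \<open>
  The entries of the vector \<open>(K(X,X) + \<lambda> n I)\<^sup>-\<^sup>1 g(X)\<close>, written by Cramer's rule: in this form they are visibly
  measurable functions of the design, and they are defined for every design.
\<close>

definition ridge_weight :: "('a \<Rightarrow> 'a \<Rightarrow> real) \<Rightarrow> ('a \<Rightarrow> real) \<Rightarrow> real \<Rightarrow> nat \<Rightarrow> (nat \<Rightarrow> 'a) \<Rightarrow> nat \<Rightarrow> real" where
  "ridge_weight K g l n x i =
     (\<Sum>j<n. cofactor (ridge_mat K l n x) j i * g (x j)) / det (ridge_mat K l n x)"

lemma ridge_weight_vec:
  assumes d: "det (ridge_mat K l n x) \<noteq> 0"
  shows "ridge_inverse K l n x *\<^sub>v vec n (\<lambda>i. g (x i)) = vec n (ridge_weight K g l n x)"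
proof (rule eq_vecI)
  let ?A = "ridge_mat K l n x"
  have dim: "dim_row ?A = n" "dim_col ?A = n" using ridge_mat_carrier[of K l n x] by auto
  note ri = ridge_inverse_adj[OF d]
  fix i assume "i < dim_vec (vec n (ridge_weight K g l n x))"
  then have i: "i < n" by simp
  have "vec_index (ridge_inverse K l n x *\<^sub>v vec n (\<lambda>i. g (x i))) i = (\<Sum>j<n. ridge_inverse K l n x $$ (i, j) * g (x j))"
    using i ri(3) by (simp add: scalar_prod_def atLeast0LessThan)
  also have "\<dots> = (\<Sum>j<n. cofactor ?A j i * g (x j) / det ?A)"
    using i dim unfolding ri(1) by (intro sum.cong refl) (simp add: adj_mat_def)
  also have "\<dots> = ridge_weight K g l n x i" by (simp add: ridge_weight_def sum_divide_distrib)
  finally show "vec_index (ridge_inverse K l n x *\<^sub>v vec n (\<lambda>i. g (x i))) i = vec_index (vec n (ridge_weight K g l n x)) i"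
    using i by simp
qed (use ridge_inverse_adj[OF d] in auto)

lemma ridge_weight_system:
  assumes d: "det (ridge_mat K l n x) \<noteq> 0" and i: "i < n"
  shows "(\<Sum>j<n. K (x i) (x j) * ridge_weight K g l n x j) + l * real n * ridge_weight K g l n x i = g (x i)"
proof -
  let ?A = "ridge_mat K l n x"
  note ri = ridge_inverse_adj[OF d]
  have "?A *\<^sub>v vec n (ridge_weight K g l n x) = (?A * ridge_inverse K l n x) *\<^sub>v vec n (\<lambda>i. g (x i))"
    unfolding ridge_weight_vec[OF d, symmetric]
    by (rule assoc_mult_mat_vec[OF ridge_mat_carrier ri(3), symmetric]) simp
  also have "\<dots> = vec n (\<lambda>i. g (x i))" unfolding ri(2) by simp
  finally have "vec_index (?A *\<^sub>v vec n (ridge_weight K g l n x)) i = g (x i)" using i by simp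
  then show ?thesis using i by (subst (asm) ridge_mat_mult_vec) auto
qed

lemma ridge_mat_sym:
  assumes K: "rkhs \<Omega> K H ip" and x: "\<And>i. i < n \<Longrightarrow> x i \<in> \<Omega>"
  shows "transpose_mat (ridge_mat K l n x) = ridge_mat K l n x"
  using ridge_mat_carrier[of K l n x]
  by (intro eq_matI) (auto simp: ridge_mat_index rkhs_kernel_sym[OF K x x])

text \<open>
  The inverse is symmetric because the matrix is. It is moved to the other side by writing \<open>g(X)\<close> as the
  matrix times the weight vector.
\<close>

lemma ridge_scalar_prod:
  assumes K: "rkhs \<Omega> K H ip" and x: "\<And>i. i < n \<Longrightarrow> x i \<in> \<Omega>" and l: "l > 0" and n: "n \<ge> 1"
    and z: "z \<in> carrier_vec n"
  shows "scalar_prod (vec n (\<lambda>i. g (x i))) (ridge_inverse K l n x *\<^sub>v z) = (\<Sum>i<n. ridge_weight K g l n x i * vec_index z i)"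
proof -
  let ?A = "ridge_mat K l n x" and ?B = "ridge_inverse K l n x" and ?w = "vec n (ridge_weight K g l n x)"
  have d: "det ?A \<noteq> 0" by (rule ridge_mat_det[OF K x l n])
  note ri = ridge_inverse_adj[OF d]
  note A = ridge_mat_carrier[of K l n x]
  have T: "transpose_mat ?A = ?A" by (rule ridge_mat_sym[OF K]) (rule x)
  have Bz: "?B *\<^sub>v z \<in> carrier_vec n" using ri(3) z by simp
  have "?A *\<^sub>v ?w = (?A * ?B) *\<^sub>v vec n (\<lambda>i. g (x i))"
    unfolding ridge_weight_vec[OF d, symmetric] by (rule assoc_mult_mat_vec[OF A ri(3), symmetric]) simp
  then have g: "vec n (\<lambda>i. g (x i)) = ?A *\<^sub>v ?w" unfolding ri(2) by simp
  have "scalar_prod (?A *\<^sub>v ?w) (?B *\<^sub>v z) = scalar_prod (transpose_mat ?A *\<^sub>v ?w) (?B *\<^sub>v z)"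
    by (simp only: T)
  also have "\<dots> = scalar_prod ?w (?A *\<^sub>v (?B *\<^sub>v z))"
    by (rule transpose_vec_mult_scalar[OF A Bz]) simp
  also have "?A *\<^sub>v (?B *\<^sub>v z) = z"
    using assoc_mult_mat_vec[OF A ri(3) z] z unfolding ri(2) by simp
  finally show ?thesis unfolding g[symmetric] using z by (simp add: scalar_prod_def atLeast0LessThan)
qed

lemma noise_functional_eq:
  assumes K: "rkhs \<Omega> K H ip" and x: "\<And>i. i < n \<Longrightarrow> x i \<in> \<Omega>" and l: "l > 0" and n: "n \<ge> 1"
  shows "noise_functional K g l n x \<epsilon> = (\<Sum>i<n. ridge_weight K g l n x i * \<epsilon> i)"
  unfolding noise_functional_def by (subst ridge_scalar_prod[OF K x l n]) auto

lemma VAR_eq: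
  assumes K: "rkhs \<Omega> K H ip" and x: "\<And>i. i < n \<Longrightarrow> x i \<in> \<Omega>" and l: "l > 0" and n: "n \<ge> 1"
  shows "VAR K g \<sigma> l n x = \<sigma>\<^sup>2 * (\<Sum>i<n. (ridge_weight K g l n x i)\<^sup>2)"
proof -
  let ?B = "ridge_inverse K l n x"
  have d: "det (ridge_mat K l n x) \<noteq> 0" by (rule ridge_mat_det[OF K x l n])
  note B = ridge_inverse_adj(3)[OF d]
  have "(?B ^\<^sub>m 2) *\<^sub>v vec n (\<lambda>i. g (x i)) = ?B *\<^sub>v vec n (ridge_weight K g l n x)"
    unfolding ridge_weight_vec[OF d, symmetric] using B by (simp add: numeral_2_eq_2 assoc_mult_mat_vec[OF B B])
  moreover have "scalar_prod (vec n (\<lambda>i. g (x i))) (?B *\<^sub>v vec n (ridge_weight K g l n x))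
      = (\<Sum>i<n. ridge_weight K g l n x i * vec_index (vec n (ridge_weight K g l n x)) i)"
    by (rule ridge_scalar_prod[OF K _ l n]) (auto intro: x)
  ultimately show ?thesis
    unfolding VAR_def by (simp add: power2_eq_square)
qed

text \<open>
  The residual is \<open>g\<close> minus the combination of representers with the weights as coefficients. The linear
  system for the weights says that its values at the design points are \<open>l * n\<close> times the weights, and pairing
  it with \<open>v\<close> through the reproducing property gives the variational equation of the ridge problem.
\<close>

lemma ridge_residual:
  assumes K: "rkhs \<Omega> K H ip" and x: "\<And>i. i < n \<Longrightarrow> x i \<in> \<Omega>" and l: "l > 0" and n: "n \<ge> 1" and g: "g \<in> H"
  shows "\<exists>r\<in>H. (\<forall>i<n. r (x i) = l * real n * ridge_weight K g l n x i) \<and>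
    (\<forall>v\<in>H. (\<Sum>i<n. r (x i) * v (x i)) / real n + l * ip r v = l * ip g v)"
proof -
  note fh = rkhs_hilbert[OF K]
  have d: "det (ridge_mat K l n x) \<noteq> 0" by (rule ridge_mat_det[OF K x l n])
  let ?w = "ridge_weight K g l n x"
  let ?s = "\<lambda>i. kernel_section \<Omega> K (x i)"
  let ?u = "\<lambda>y. \<Sum>i<n. ?w i * ?s i y"
  have s: "?s i \<in> H" if "i < n" for i using rkhs_section[OF K x[OF that]] .
  have u: "?u \<in> H" using s by (intro H_linear_combination[OF fh]) auto
  have r: "(\<lambda>y. g y - ?u y) \<in> H" by (rule H_diff[OF fh g u])
  have rx: "g (x i) - ?u (x i) = l * real n * ?w i" if i: "i < n" for i
  proof -
    have "?u (x i) = (\<Sum>j<n. K (x i) (x j) * ?w j)"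
      using x[OF i] by (simp add: kernel_section_def mult.commute)
    then show ?thesis using ridge_weight_system[OF d i, of g] by linarith
  qed
  have "(\<Sum>i<n. (g (x i) - ?u (x i)) * v (x i)) / real n + l * ip (\<lambda>y. g y - ?u y) v = l * ip g v" if v: "v \<in> H" for v
  proof -
    have "ip ?u v = (\<Sum>i<n. ?w i * ip (?s i) v)"
      using s v by (intro ip_linear_combination[OF fh]) auto
    also have "\<dots> = (\<Sum>i<n. ?w i * v (x i))"
      using s v x by (intro sum.cong refl) (simp add: ip_sym[OF fh] rkhs_eval[OF K])
    finally have uv: "ip ?u v = (\<Sum>i<n. ?w i * v (x i))" .
    have "(\<Sum>i<n. (g (x i) - ?u (x i)) * v (x i)) / real n = l * (\<Sum>i<n. ?w i * v (x i))"
      unfolding sum_divide_distrib sum_distrib_left using n by (intro sum.cong refl) (simp add: rx)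
    then show ?thesis unfolding ip_diff[OF fh g u v] uv by (simp add: right_diff_distrib)
  qed
  with r rx show ?thesis by (intro bexI[of _ "\<lambda>y. g y - ?u y"]) auto
qed

section \<open>Spread of the residual\<close>

lemma L2_norm_on_nonneg: "L2_norm_on \<Omega> v \<ge> 0"
  unfolding L2_norm_on_def set_lebesgue_integral_def by (intro real_sqrt_ge_zero integral_nonneg_AE) simp

lemma empirical_norm_nonneg: "empirical_norm n x v \<ge> 0"
  unfolding empirical_norm_def by (intro real_sqrt_ge_zero divide_nonneg_nonneg sum_nonneg) auto

lemma empirical_norm_square: "(empirical_norm n x v)\<^sup>2 = (\<Sum>i<n. (v (x i))\<^sup>2) / real n"
  unfolding empirical_norm_def by (intro real_sqrt_pow2 divide_nonneg_nonneg sum_nonneg) auto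

lemma empirical_cauchy_schwarz:
  "\<bar>(\<Sum>i<n. u (x i) * v (x i)) / real n\<bar> \<le> empirical_norm n x u * empirical_norm n x v"
proof -
  have "(\<Sum>i<n. u (x i) * v (x i))\<^sup>2 \<le> (\<Sum>i<n. (u (x i))\<^sup>2) * (\<Sum>i<n. (v (x i))\<^sup>2)"
    by (rule Cauchy_Schwarz_ineq_sum)
  then have "((\<Sum>i<n. u (x i) * v (x i)) / real n)\<^sup>2 \<le> ((\<Sum>i<n. (u (x i))\<^sup>2) / real n) * ((\<Sum>i<n. (v (x i))\<^sup>2) / real n)"
    by (simp add: power2_eq_square divide_simps)
  then have "sqrt (((\<Sum>i<n. u (x i) * v (x i)) / real n)\<^sup>2) \<le> sqrt (((\<Sum>i<n. (u (x i))\<^sup>2) / real n) * ((\<Sum>i<n. (v (x i))\<^sup>2) / real n))"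
    by (rule real_sqrt_le_mono)
  then show ?thesis unfolding real_sqrt_abs empirical_norm_def real_sqrt_mult .
qed

text \<open>
  Both norms are measured by the single number \<open>s\<close> with \<open>s\<^sup>2 = |r|_n\<^sup>2 + l |r|_H\<^sup>2\<close>, which by the variational equation is
  \<open>l * ip g r\<close>. The comparison of norms gives \<open>|r|_L2 \<le> C s\<close>, and always \<open>|r|_H \<le> s / sqrt l\<close>. Hence condition (i)
  bounds \<open>s\<^sup>2\<close> by a multiple of \<open>s\<close>, and the exponents add up as stated.
\<close>

lemma residual_hnorm_bound:
  assumes fh: "function_hilbert_space \<Omega> H ip" and r: "r \<in> H" and l: "l > 0"
    and eq: "(\<Sum>i<n. r (x i) * r (x i)) / real n + l * ip r r = l * ip g r"
    and cmp: "L2_norm_on \<Omega> r \<le> max (C1 * empirical_norm n x r) (Ce * N * hnorm ip r)"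
    and N: "0 \<le> N" "N \<le> sqrt l" and C: "C1 > 0" "Ce > 0" "C = max C1 Ce"
    and i: "\<bar>ip g r\<bar> \<le> Cg * L2_norm_on \<Omega> r powr \<delta> * hnorm ip r powr (1 - \<delta>)"
    and Cg: "Cg > 0" and \<delta>: "0 < \<delta>" "\<delta> \<le> 1"
  shows "hnorm ip r \<le> Cg * C powr \<delta> * l powr (\<delta> / 2)"
proof -
  define a where "a = empirical_norm n x r"
  define b where "b = hnorm ip r"
  define s where "s = sqrt (a\<^sup>2 + l * b\<^sup>2)"
  have a0: "a \<ge> 0" and b0: "b \<ge> 0" unfolding a_def b_def by (auto intro: empirical_norm_nonneg hnorm_ge_0[OF fh r])
  have C0: "C > 0" "C1 \<le> C" "Ce \<le> C" using C by auto
  have s0: "s \<ge> 0" by (simp add: s_def l less_imp_le)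
  have s2: "s\<^sup>2 = a\<^sup>2 + l * b\<^sup>2" using l by (simp add: s_def)
  have as: "a \<le> s" unfolding s_def using l by (intro real_le_rsqrt) simp
  have bs: "sqrt l * b \<le> s"
    unfolding s_def using l by (intro real_le_rsqrt) (simp add: power_mult_distrib)
  show ?thesis
  proof (cases "s = 0")
    case True
    then have "b \<le> 0" using bs l by (simp add: mult_le_0_iff)
    also have "0 \<le> Cg * C powr \<delta> * l powr (\<delta> / 2)" using Cg by simp
    finally show ?thesis unfolding b_def .
  next
    case False
    then have sp: "s > 0" using s0 by simp
    have "L2_norm_on \<Omega> r \<le> C * s"
    proof -
      have "C1 * a \<le> C * s" using C0 C as a0 by (intro mult_mono) auto
      moreover have "N * b \<le> s" using mult_right_mono[OF N(2) b0] bs by linarith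
      then have "Ce * (N * b) \<le> C * s" using C0 C N b0 by (intro mult_mono) auto
      ultimately show ?thesis using cmp unfolding a_def[symmetric] b_def[symmetric] by (simp add: mult.assoc)
    qed
    moreover have "b \<le> s / sqrt l" using bs l by (simp add: field_simps)
    ultimately have "L2_norm_on \<Omega> r powr \<delta> * b powr (1 - \<delta>) \<le> (C * s) powr \<delta> * (s / sqrt l) powr (1 - \<delta>)"
      using \<delta> b0 L2_norm_on_nonneg[of \<Omega> r] by (intro mult_mono powr_mono2) auto
    then have "Cg * (L2_norm_on \<Omega> r powr \<delta> * b powr (1 - \<delta>)) \<le> Cg * ((C * s) powr \<delta> * (s / sqrt l) powr (1 - \<delta>))"
      using Cg by (intro mult_left_mono) auto
    then have ub: "ip g r \<le> Cg * ((C * s) powr \<delta> * (s / sqrt l) powr (1 - \<delta>))"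
      using i unfolding b_def[symmetric] by (simp add: mult.assoc)
    have "(C * s) powr \<delta> * (s / sqrt l) powr (1 - \<delta>) = C powr \<delta> * (s powr \<delta> * s powr (1 - \<delta>)) * sqrt l powr (\<delta> - 1)"
    proof -
      have "(C * s) powr \<delta> = C powr \<delta> * s powr \<delta>" using C0 sp by (simp add: powr_mult)
      moreover have "(s / sqrt l) powr (1 - \<delta>) = s powr (1 - \<delta>) * sqrt l powr (\<delta> - 1)"
        using sp l by (simp add: powr_divide powr_diff field_simps)
      ultimately show ?thesis by simp
    qed
    also have "s powr \<delta> * s powr (1 - \<delta>) = s" using sp by (simp add: powr_add[symmetric])
    finally have ub2: "ip g r \<le> Cg * (C powr \<delta> * s * sqrt l powr (\<delta> - 1))" using ub by simp
    have "(\<Sum>i<n. r (x i) * r (x i)) / real n = a\<^sup>2"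
      unfolding a_def empirical_norm_square by (simp add: power2_eq_square)
    then have "s\<^sup>2 = l * ip g r"
      using eq s2 hnorm_square[OF fh r] unfolding b_def by simp
    also have "\<dots> \<le> l * (Cg * (C powr \<delta> * s * sqrt l powr (\<delta> - 1)))"
      using l ub2 by (intro mult_left_mono) auto
    finally have "s * s \<le> (l * (Cg * C powr \<delta> * sqrt l powr (\<delta> - 1))) * s"
      by (simp add: power2_eq_square mult_ac)
    then have sb: "s \<le> l * (Cg * C powr \<delta> * sqrt l powr (\<delta> - 1))" using sp by simp
    have sl: "sqrt l = l powr (1/2)" using l by (simp add: powr_half_sqrt)
    have "b \<le> s / sqrt l" by fact
    also have "\<dots> \<le> l * (Cg * C powr \<delta> * sqrt l powr (\<delta> - 1)) / sqrt l"
      using sb l by (intro divide_right_mono) auto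
    also have "\<dots> = Cg * C powr \<delta> * (sqrt l powr (\<delta> - 1) * (l / sqrt l))" by simp
    also have "l / sqrt l = sqrt l powr 1" using l by (simp add: real_div_sqrt)
    also have "sqrt l powr (\<delta> - 1) * sqrt l powr 1 = sqrt l powr \<delta>" by (subst powr_add[symmetric]) simp
    also have "sqrt l powr \<delta> = l powr (\<delta> / 2)" unfolding sl by (simp add: powr_powr)
    finally show ?thesis unfolding b_def .
  qed
qed

text \<open>
  In the variational equation tested against \<open>v\<close>, the right-hand side exceeds \<open>l * C0 * R powr (1 - \<tau>)\<close> times \<open>|v|_L2\<close>, and
  the bound on \<open>|r|_H\<close> lets the term with the inner product absorb at most half of it. The empirical inner
  product must account for the other half, and by the comparison of norms it is at most \<open>|r|_n\<close> times \<open>C * |v|_L2\<close>.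
\<close>

lemma residual_empirical_lower_bound:
  assumes fh: "function_hilbert_space \<Omega> H ip" and r: "r \<in> H" and v: "v \<in> H" and l: "l > 0"
    and eq: "(\<Sum>i<n. r (x i) * v (x i)) / real n + l * ip r v = l * ip g v"
    and cmp: "empirical_norm n x v \<le> max (C1 * L2_norm_on \<Omega> v) (Ce * N * hnorm ip v)"
    and N: "0 \<le> N" and C: "C1 > 0" "Ce > 0" "C = max C1 Ce"
    and R: "R > 0" "R * N \<le> 1"
    and vR: "hnorm ip v \<le> R * L2_norm_on \<Omega> v" and big: "ip g v / L2_norm_on \<Omega> v > C0 * R powr (1 - \<tau>)"
    and C0: "C0 > 0" and b: "hnorm ip r * R powr \<tau> \<le> C0 / 2"
  shows "empirical_norm n x r > 0" and "l * R * hnorm ip r \<le> C * empirical_norm n x r"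
proof -
  define a where "a = empirical_norm n x r"
  define \<beta> where "\<beta> = hnorm ip r"
  define L where "L = L2_norm_on \<Omega> v"
  have a0: "a \<ge> 0" and \<beta>0: "\<beta> \<ge> 0" unfolding a_def \<beta>_def by (auto intro: empirical_norm_nonneg hnorm_ge_0[OF fh r])
  have Cp: "C > 0" "C1 \<le> C" "Ce \<le> C" using C by auto
  have rhs0: "C0 * R powr (1 - \<tau>) > 0" using C0 R by simp
  have L: "L > 0"
  proof -
    have "L \<noteq> 0" using big rhs0 unfolding L_def by auto
    then show ?thesis using L2_norm_on_nonneg[of \<Omega> v] unfolding L_def by simp
  qed
  have v0: "hnorm ip v \<ge> 0" by (rule hnorm_ge_0[OF fh v])
  have ev: "empirical_norm n x v \<le> C * L"
  proof -
    have "C1 * L \<le> C * L" using Cp L by (intro mult_right_mono) auto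
    moreover have "N * hnorm ip v \<le> L"
    proof -
      have "N * hnorm ip v \<le> N * (R * L)" using vR N unfolding L_def by (intro mult_left_mono) auto
      also have "\<dots> = (R * N) * L" by simp
      also have "\<dots> \<le> 1 * L" using R L by (intro mult_right_mono) auto
      finally show ?thesis by simp
    qed
    then have "Ce * (N * hnorm ip v) \<le> C * L" using Cp C N v0 by (intro mult_mono) auto
    ultimately show ?thesis using cmp unfolding L_def[symmetric] by (simp add: mult.assoc)
  qed
  have "l * (C0 * R powr (1 - \<tau>) * L) < l * ip g v"
    using big L l unfolding L_def[symmetric] by (simp add: pos_less_divide_eq)
  also have "l * ip g v = (\<Sum>i<n. r (x i) * v (x i)) / real n + l * ip r v" using eq by simp
  also have "\<dots> \<le> a * (C * L) + l * (\<beta> * (R * L))"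
  proof (intro add_mono mult_left_mono)
    have "(\<Sum>i<n. r (x i) * v (x i)) / real n \<le> a * empirical_norm n x v"
      using empirical_cauchy_schwarz[where u = r and v = v and x = x and n = n] unfolding a_def by linarith
    also have "\<dots> \<le> a * (C * L)" using ev a0 by (intro mult_left_mono)
    finally show "(\<Sum>i<n. r (x i) * v (x i)) / real n \<le> a * (C * L)" .
    have "ip r v \<le> \<beta> * hnorm ip v"
      using ip_cauchy_schwarz[OF fh r v] unfolding \<beta>_def by linarith
    also have "\<dots> \<le> \<beta> * (R * L)" using vR \<beta>0 unfolding L_def by (intro mult_left_mono)
    finally show "ip r v \<le> \<beta> * (R * L)" .
  qed (use l in auto)
  also have "a * (C * L) + l * (\<beta> * (R * L)) = (a * C + l * (\<beta> * R)) * L" by (simp add: algebra_simps)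
  finally have "(l * (C0 * R powr (1 - \<tau>))) * L < (a * C + l * (\<beta> * R)) * L" by (simp add: mult_ac)
  then have main: "l * (C0 * R powr (1 - \<tau>)) < a * C + l * (\<beta> * R)" using L by (simp only: mult_less_cancel_right_pos)
  have "\<beta> * R = (\<beta> * R powr \<tau>) * R powr (1 - \<tau>)"
  proof -
    have "R powr \<tau> * R powr (1 - \<tau>) = R" using R by (simp add: powr_add[symmetric])
    then show ?thesis by (simp only: mult.assoc)
  qed
  also have "\<dots> \<le> C0 / 2 * R powr (1 - \<tau>)" using b unfolding \<beta>_def by (intro mult_right_mono) auto
  finally have half: "\<beta> * R \<le> C0 / 2 * R powr (1 - \<tau>)" .
  have "l * (\<beta> * R) \<le> l * (C0 / 2 * R powr (1 - \<tau>))" using half l by (intro mult_left_mono) auto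
  with main have aC: "l * (C0 / 2 * R powr (1 - \<tau>)) < a * C" by (simp add: algebra_simps)
  moreover have "0 < l * (C0 / 2 * R powr (1 - \<tau>))" using l C0 R by simp
  ultimately have "0 < a * C" by linarith
  then show "empirical_norm n x r > 0" using Cp unfolding a_def by (simp add: zero_less_mult_iff)
  show "l * R * hnorm ip r \<le> C * empirical_norm n x r"
  proof -
    have "l * (\<beta> * R) \<le> a * C" using \<open>l * (\<beta> * R) \<le> l * (C0 / 2 * R powr (1 - \<tau>))\<close> aC by linarith
    then show ?thesis unfolding a_def \<beta>_def by (simp only: mult_ac)
  qed
qed

text \<open>
  The pointwise bound at the scale \<open>h = T n\<^bsup>-1/d\<^esup>\<close>, the typical spacing of \<open>n\<close> points up to the factor \<open>T\<close>. The
  number \<open>q\<close> bounds \<open>n\<^bsup>-m/d\<^esup> |r|_H / |r|_n\<close>.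
\<close>

lemma residual_spread:
  assumes fh: "function_hilbert_space \<Omega> H ip" and r: "r \<in> H" and n: "n \<ge> 1" and l: "l > 0"
    and cmp: "L2_norm_on \<Omega> r \<le> max (C1 * empirical_norm n x r) (Ce * real n powr (- m / d) * hnorm ip r)"
    and C: "C1 > 0" "Ce > 0" "C = max C1 Ce"
    and d: "d > 0" and R: "R > 0"
    and a: "empirical_norm n x r > 0" and low: "l * R * hnorm ip r \<le> C * empirical_norm n x r"
    and T: "T > 0" "T * real n powr (- 1 / d) \<le> 1"
    and S: "S > 0" "\<And>h. 0 < h \<and> h \<le> 1 \<Longrightarrow> \<bar>r y\<bar> \<le> S * (h powr (- d / 2) * L2_norm_on \<Omega> r + h powr (m - d / 2) * hnorm ip r)"
    and q: "q = C * (real n powr (- m / d) / (l * R))"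
  shows "\<bar>r y\<bar> \<le> S * (T powr (- d / 2) * (C * (1 + q)) + T powr (m - d / 2) * q) * (sqrt (real n) * empirical_norm n x r)"
proof -
  define A where "A = empirical_norm n x r"
  define b where "b = hnorm ip r"
  define N where "N = real n powr (- m / d)"
  define h where "h = T * real n powr (- 1 / d)"
  have A: "A > 0" and b0: "b \<ge> 0" using a unfolding A_def b_def by (auto intro: hnorm_ge_0[OF fh r])
  have np: "real n > 0" using n by simp
  have N0: "N > 0" unfolding N_def using np by simp
  have Cp: "C > 0" "C1 \<le> C" "Ce \<le> C" using C by auto
  have h: "0 < h" "h \<le> 1" unfolding h_def using T np by auto
  have q0: "q \<ge> 0" unfolding q using Cp l R by simp
  have Nb: "N * b \<le> q * A"
  proof -
    have "b \<le> C * A / (l * R)" using low l R unfolding A_def b_def by (simp add: field_simps)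
    then have "N * b \<le> N * (C * A / (l * R))" using N0 by (intro mult_left_mono) auto
    then show ?thesis unfolding q N_def by (simp add: mult_ac)
  qed
  have L: "L2_norm_on \<Omega> r \<le> C * (1 + q) * A"
  proof -
    have "C1 * A \<le> C * ((1 + q) * A)" using Cp C A q0 by (intro mult_mono) (auto simp: distrib_right)
    moreover have "N * b \<le> (1 + q) * A" using Nb A by (simp only: distrib_right mult_1)
    then have "Ce * (N * b) \<le> C * ((1 + q) * A)"
      by (rule mult_mono[OF Cp(3)]) (use Cp N0 b0 in auto)
    ultimately show ?thesis using cmp unfolding A_def[symmetric] b_def[symmetric] N_def[symmetric]
      by (simp add: mult.assoc)
  qed
  have h1: "h powr (- d / 2) = T powr (- d / 2) * sqrt (real n)"
  proof -
    have "h powr (- d / 2) = T powr (- d / 2) * (real n powr (- 1 / d)) powr (- d / 2)"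
      unfolding h_def using T by (simp add: powr_mult)
    also have "(real n powr (- 1 / d)) powr (- d / 2) = real n powr (1 / 2)"
      using d by (simp add: powr_powr)
    finally show ?thesis using np by (simp add: powr_half_sqrt)
  qed
  have h2: "h powr (m - d / 2) = T powr (m - d / 2) * (N * sqrt (real n))"
  proof -
    have "h powr (m - d / 2) = T powr (m - d / 2) * (real n powr (- 1 / d)) powr (m - d / 2)"
      unfolding h_def using T by (simp add: powr_mult)
    also have "(real n powr (- 1 / d)) powr (m - d / 2) = real n powr (- m / d + 1 / 2)"
    proof -
      have "(- 1 / d) * (m - d / 2) = - m / d + 1 / 2" using d by (simp add: field_simps)
      then show ?thesis by (simp only: powr_powr)
    qed
    also have "\<dots> = N * sqrt (real n)" unfolding N_def powr_add using np by (simp add: powr_half_sqrt)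
    finally show ?thesis .
  qed
  have "\<bar>r y\<bar> \<le> S * (h powr (- d / 2) * L2_norm_on \<Omega> r + h powr (m - d / 2) * b)"
    using S(2) h unfolding b_def by blast
  also have "\<dots> \<le> S * (T powr (- d / 2) * sqrt (real n) * (C * (1 + q) * A) + T powr (m - d / 2) * sqrt (real n) * (q * A))"
  proof (rule mult_left_mono[OF add_mono])
    show "h powr (- d / 2) * L2_norm_on \<Omega> r \<le> T powr (- d / 2) * sqrt (real n) * (C * (1 + q) * A)"
      unfolding h1 by (intro mult_left_mono L) auto
    have "h powr (m - d / 2) * b = T powr (m - d / 2) * sqrt (real n) * (N * b)"
      unfolding h2 by (simp only: mult_ac)
    also have "\<dots> \<le> T powr (m - d / 2) * sqrt (real n) * (q * A)" by (intro mult_left_mono Nb) auto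
    finally show "h powr (m - d / 2) * b \<le> T powr (m - d / 2) * sqrt (real n) * (q * A)" .
  qed (use S in auto)
  also have "\<dots> = S * (T powr (- d / 2) * (C * (1 + q)) + T powr (m - d / 2) * q) * (sqrt (real n) * A)"
    by (simp add: algebra_simps)
  finally show ?thesis unfolding A_def .
qed

text \<open>
  A real supremum carries information only if the set is bounded, which here is a consequence of
  condition (i). A function with vanishing \<open>L\<^sub>2\<close> norm contributes the quotient \<open>0\<close>.
\<close>

lemma sup_condition_witness:
  fixes \<Omega> :: "'a::euclidean_space set"
  assumes fh: "function_hilbert_space \<Omega> H ip"
    and i: "\<And>v. v \<in> H \<Longrightarrow> \<bar>ip g v\<bar> \<le> Cg * L2_norm_on \<Omega> v powr \<delta> * hnorm ip v powr (1 - \<delta>)"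
    and Cg: "Cg > 0" and \<delta>: "\<delta> \<le> 1" and R: "R > 0"
    and sup: "(SUP v\<in>{v \<in> H. hnorm ip v \<le> R * L2_norm_on \<Omega> v}. ip g v / L2_norm_on \<Omega> v) > c"
  shows "\<exists>v\<in>H. hnorm ip v \<le> R * L2_norm_on \<Omega> v \<and> ip g v / L2_norm_on \<Omega> v > c"
    and "c < Cg * R powr (1 - \<delta>)"
proof -
  let ?L = "L2_norm_on \<Omega>"
  let ?V = "{v \<in> H. hnorm ip v \<le> R * ?L v}"
  have ub: "ip g v / ?L v \<le> Cg * R powr (1 - \<delta>)" if v: "v \<in> ?V" for v
  proof (cases "?L v = 0")
    case True
    then show ?thesis using Cg by simp
  next
    case False
    then have L: "?L v > 0" using L2_norm_on_nonneg[of \<Omega> v] by simp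
    have "ip g v \<le> Cg * ?L v powr \<delta> * hnorm ip v powr (1 - \<delta>)" using i v by force
    also have "\<dots> \<le> Cg * ?L v powr \<delta> * (R * ?L v) powr (1 - \<delta>)"
      using v \<delta> Cg by (intro mult_left_mono powr_mono2) (auto intro: hnorm_ge_0[OF fh])
    also have "(R * ?L v) powr (1 - \<delta>) = R powr (1 - \<delta>) * ?L v powr (1 - \<delta>)"
      using R L by (simp add: powr_mult)
    also have "Cg * ?L v powr \<delta> * (R powr (1 - \<delta>) * ?L v powr (1 - \<delta>))
      = Cg * R powr (1 - \<delta>) * (?L v powr \<delta> * ?L v powr (1 - \<delta>))" by simp
    also have "?L v powr \<delta> * ?L v powr (1 - \<delta>) = ?L v"
      using L by (simp add: powr_add[symmetric])
    finally show ?thesis using L by (simp add: divide_le_eq)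
  qed
  have z: "(\<lambda>x. 0) \<in> ?V"
  proof -
    have "hnorm ip (\<lambda>x. 0) = 0" unfolding hnorm_def ip_zero[OF fh H_zero[OF fh]] by simp
    then show ?thesis using H_zero[OF fh] R L2_norm_on_nonneg[of \<Omega> "\<lambda>x. 0"] by simp
  qed
  have bdd: "bdd_above ((\<lambda>v. ip g v / ?L v) ` ?V)" using ub by (intro bdd_aboveI2)
  have "\<exists>v\<in>?V. c < ip g v / ?L v"
    using sup by (subst (asm) less_cSUP_iff[OF _ bdd]) (use z in blast)
  then obtain v where v: "v \<in> ?V" "c < ip g v / ?L v" by blast
  then show "\<exists>v\<in>H. hnorm ip v \<le> R * ?L v \<and> ip g v / ?L v > c" by blast
  show "c < Cg * R powr (1 - \<delta>)" using ub[OF v(1)] v(2) by linarith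
qed

lemma filterlim_powr_at_top:
  fixes a :: real
  assumes "a > 0"
  shows "filterlim (\<lambda>x::real. x powr a) at_top at_top"
  using assms by real_asymp

text \<open>
  As \<open>R\<close> grows, the lower bound from condition (ii) cannot outgrow the upper bound that condition (i) puts on
  the same supremum, see \<open>sup_condition_witness\<close>.
\<close>

lemma smoothness_exponents_le:
  fixes \<delta> \<tau> :: real
  assumes "C0 > 0" "Cg > 0" and le: "\<And>R. R \<ge> R0 \<Longrightarrow> R > 0 \<Longrightarrow> C0 * R powr (1 - \<tau>) < Cg * R powr (1 - \<delta>)"
  shows "\<delta> \<le> \<tau>"
proof (rule ccontr)
  assume "\<not> \<delta> \<le> \<tau>"
  then have dt: "\<delta> - \<tau> > 0" by simp
  have "filterlim (\<lambda>R. R powr (\<delta> - \<tau>)) at_top (at_top :: real filter)"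
    by (rule filterlim_powr_at_top[OF dt])
  then have "\<forall>\<^sub>F R::real in at_top. R powr (\<delta> - \<tau>) \<ge> Cg / C0" by (simp add: filterlim_at_top)
  moreover have "\<forall>\<^sub>F R::real in at_top. R \<ge> max R0 1" by (rule eventually_ge_at_top)
  ultimately have "\<forall>\<^sub>F R::real in at_top. R powr (\<delta> - \<tau>) \<ge> Cg / C0 \<and> R \<ge> max R0 1" by (rule eventually_conj)
  then obtain R :: real where R: "R powr (\<delta> - \<tau>) \<ge> Cg / C0" "R \<ge> max R0 1"
    using eventually_happens'[OF trivial_limit_at_top_linorder] by blast
  then have Rp: "R > 0" by simp
  have "C0 * R powr (1 - \<tau>) = C0 * R powr (\<delta> - \<tau>) * R powr (1 - \<delta>)"
    by (simp add: powr_add[symmetric])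
  also have "\<dots> \<ge> Cg * R powr (1 - \<delta>)"
    using R(1) assms(1) by (intro mult_right_mono) (auto simp: field_simps)
  finally show False using le[of R] R Rp by simp
qed

text \<open>
  Write \<open>Y = lam n * n powr p\<close> for the exponent \<open>p\<close> of the growth condition, so that \<open>Y\<close> tends to infinity. From \<open>q \<le> 1\<close> and
  \<open>d < 2 m\<close> follow \<open>p \<le> 2 m / d\<close> and \<open>p (1 - q/2) \<le> m / d\<close>. These inequalities bound \<open>lam n * R n * n powr (m/d)\<close> from below
  by \<open>Y\<close> or by \<open>c * Y powr (1 - q/2)\<close>, according to which of the two terms attains the minimum in \<open>R\<close>.
\<close>

lemma ridge_rates:
  fixes lam :: "nat \<Rightarrow> real" and m d q c :: real
  assumes pos: "\<And>n. n \<ge> 1 \<Longrightarrow> lam n > 0" and lim: "lam \<longlonglongrightarrow> 0"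
    and d: "d > 0" and m: "m > d / 2" and q: "0 < q" "q \<le> 1" and c: "c > 0"
    and o: "(\<lambda>n. 1 / lam n) \<in> o(\<lambda>n. real n powr (2 * m / (d + 2 * m * (1 - q))))"
  defines "R \<equiv> \<lambda>n. min (real n powr (m / d)) (c * lam n powr (- q / 2))"
  shows "\<forall>\<^sub>F n in sequentially. real n powr (- m / d) \<le> sqrt (lam n)"
    and "filterlim R at_top sequentially"
    and "(\<lambda>n. real n powr (- m / d) / (lam n * R n)) \<longlonglongrightarrow> 0"
proof -
  define p where "p = 2 * m / (d + 2 * m * (1 - q))"
  define Y where "Y n = lam n * real n powr p" for n
  have m0: "m > 0" using m d by simp
  have den: "d + 2 * m * (1 - q) > 0" using d m0 q by (simp add: add_pos_nonneg)
  have p0: "p > 0" unfolding p_def using m0 den by simp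
  have p1: "p \<le> 2 * m / d"
    unfolding p_def using m0 d q den by (intro divide_left_mono) auto
  have p2: "p * (1 - q / 2) \<le> m / d"
  proof -
    have "d * (1 - q) \<le> 2 * m * (1 - q)" using m q by (intro mult_right_mono) auto
    then have "m * (d * (2 - q)) \<le> m * (d + 2 * m * (1 - q))" using m0 by (intro mult_left_mono) (auto simp: algebra_simps)
    then have "m * (2 - q) * d \<le> m * (d + 2 * m * (1 - q))" by (simp add: mult_ac)
    then have "m * (2 - q) / (d + 2 * m * (1 - q)) \<le> m / d"
      using den d by (simp add: pos_divide_le_eq pos_le_divide_eq field_simps)
    moreover have "p * (1 - q / 2) = m * (2 - q) / (d + 2 * m * (1 - q))"     proof -
      have "2 * m * (1 - q / 2) = m * (2 - q)" by (simp add: algebra_simps)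
      then show ?thesis unfolding p_def times_divide_eq_left by simp
    qed
    ultimately show ?thesis by simp
  qed
  have ev1: "\<forall>\<^sub>F n in sequentially. n \<ge> (1::nat)" by (rule eventually_ge_at_top)
  have Y: "filterlim Y at_top sequentially"
  proof -
    have "(\<lambda>n. (1 / lam n) / real n powr p) \<longlonglongrightarrow> 0" using smalloD_tendsto[OF o] unfolding p_def .
    moreover have "\<forall>\<^sub>F n in sequentially. (1 / lam n) / real n powr p > 0"
      using ev1 by eventually_elim (use pos in auto)
    ultimately have "filterlim (\<lambda>n. inverse ((1 / lam n) / real n powr p)) at_top sequentially"
      by (rule filterlim_inverse_at_top)
    then show ?thesis unfolding Y_def by (simp add: field_simps)
  qed
  show "\<forall>\<^sub>F n in sequentially. real n powr (- m / d) \<le> sqrt (lam n)"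
    using ev1 filterlim_at_top[THEN iffD1, OF Y, rule_format, of 1]
  proof eventually_elim
    case (elim n)
    have np: "real n \<ge> 1" using elim by simp
    have "1 \<le> lam n * real n powr p" using elim unfolding Y_def by simp
    also have "\<dots> \<le> lam n * real n powr (2 * m / d)"
      using pos[OF elim(1)] np p1 by (intro mult_left_mono powr_mono) auto
    finally have "1 \<le> lam n * real n powr (2 * m / d)" .
    then have "real n powr (- (2 * m / d)) * 1 \<le> real n powr (- (2 * m / d)) * (lam n * real n powr (2 * m / d))"
      by (intro mult_left_mono) auto
    also have "\<dots> = lam n" using np by (simp add: powr_minus field_simps)
    finally have "real n powr (- (2 * m / d)) \<le> lam n" by simp
    moreover have "real n powr (- (2 * m / d)) = (real n powr (- m / d))\<^sup>2"
      by (simp add: power2_eq_square powr_add[symmetric])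
    ultimately show ?case by (intro real_le_rsqrt) simp
  qed
  have lim': "filterlim (\<lambda>n. lam n powr (- q / 2)) at_top sequentially"
  proof -
    have "\<forall>\<^sub>F n in sequentially. lam n > 0" using ev1 by eventually_elim (rule pos)
    with lim have "filterlim lam (at_right 0) sequentially" by (rule tendsto_imp_filterlim_at_right)
    moreover have "filterlim (\<lambda>t::real. t powr (- q / 2)) at_top (at_right 0)"
      using q by real_asymp
    ultimately show ?thesis by (rule filterlim_compose[rotated])
  qed
  have nlim: "filterlim (\<lambda>n. real n powr (m / d)) at_top sequentially"
    using m0 d by (intro filterlim_compose[OF filterlim_powr_at_top filterlim_real_sequentially]) auto
  show Rlim: "filterlim R at_top sequentially"
    unfolding filterlim_at_top
  proof
    fix Z :: real
    show "\<forall>\<^sub>F n in sequentially. Z \<le> R n"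
      using filterlim_at_top[THEN iffD1, OF nlim, rule_format, of Z]
        filterlim_at_top[THEN iffD1, OF lim', rule_format, of "Z / c"]
    proof eventually_elim
      case (elim n)
      then show ?case using c unfolding R_def by (simp add: field_simps)
    qed
  qed
  have Ylim: "filterlim (\<lambda>n. Y n powr (1 - q / 2)) at_top sequentially"
    using q by (intro filterlim_compose[OF filterlim_powr_at_top Y]) auto
  have "filterlim (\<lambda>n. lam n * R n * real n powr (m / d)) at_top sequentially"
    unfolding filterlim_at_top
  proof
    fix Z :: real
    show "\<forall>\<^sub>F n in sequentially. Z \<le> lam n * R n * real n powr (m / d)"
      using filterlim_at_top[THEN iffD1, OF Y, rule_format, of Z]
        filterlim_at_top[THEN iffD1, OF Ylim, rule_format, of "Z / c"] ev1
    proof eventually_elim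
      case (elim n)
      have np: "real n \<ge> 1" and lp: "lam n > 0" using elim pos by auto
      show ?case
      proof (cases "real n powr (m / d) \<le> c * lam n powr (- q / 2)")
        case True
        then have "R n = real n powr (m / d)" by (simp add: R_def)
        then have "lam n * R n * real n powr (m / d) = lam n * real n powr (2 * m / d)"
          by (simp add: powr_add[symmetric])
        also have "\<dots> \<ge> lam n * real n powr p" using lp np p1 by (intro mult_left_mono powr_mono) auto
        finally show ?thesis using elim(1) unfolding Y_def by linarith
      next
        case False
        then have R: "R n = c * lam n powr (- q / 2)" by (simp add: R_def)
        have "Z \<le> c * Y n powr (1 - q / 2)" using elim(2) c by (simp add: field_simps)
        also have "Y n powr (1 - q / 2) = lam n powr (1 - q / 2) * real n powr (p * (1 - q / 2))"
          unfolding Y_def using lp by (simp add: powr_mult powr_powr)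
        also have "\<dots> \<le> lam n powr (1 - q / 2) * real n powr (m / d)"
          using np p2 by (intro mult_left_mono powr_mono) auto
        also have "lam n powr (1 - q / 2) = lam n * lam n powr (- q / 2)"
          using lp powr_add[of "lam n" 1 "- q / 2"] by simp
        finally show ?thesis using c unfolding R by (simp add: mult_ac)
      qed
    qed
  qed
  from tendsto_inverse_0_at_top[OF this]
  show "(\<lambda>n. real n powr (- m / d) / (lam n * R n)) \<longlonglongrightarrow> 0"
    by (simp add: powr_minus field_simps)
qed

section \<open>A central limit theorem for random weights\<close>

text \<open>
  The upper bound for \<open>exp (- y)\<close> follows from the quadratic lower bound for \<open>exp y\<close> and
  \<open>(1 - y + y\<^sup>2/2) (1 + y + y\<^sup>2/2) = 1 + y\<^sup>4/4\<close>.
\<close>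

lemma exp_minus_quadratic_approx:
  fixes y :: real
  assumes "y \<ge> 0"
  shows "\<bar>1 - y - exp (- y)\<bar> \<le> y\<^sup>2 / 2"
proof -
  have l: "1 - y \<le> exp (- y)" using exp_ge_add_one_self[of "-y"] by simp
  have q: "1 + y + y\<^sup>2 / 2 \<le> exp y" using exp_lower_Taylor_quadratic[OF assms] by simp
  have pos: "1 + y + y\<^sup>2 / 2 > 0" using assms by (simp add: add_pos_nonneg)
  have nn: "1 - y + y\<^sup>2 / 2 \<ge> 0"
  proof -
    have "1 - y + y\<^sup>2 / 2 = (1 - y)\<^sup>2 / 2 + 1 / 2" by (simp add: power2_eq_square field_simps)
    then show ?thesis by simp
  qed
  have "1 \<le> 1 + y ^ 4 / 4" by simp
  also have "\<dots> = (1 - y + y\<^sup>2 / 2) * (1 + y + y\<^sup>2 / 2)"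
    by (simp add: power2_eq_square power4_eq_xxxx algebra_simps)
  also have "\<dots> \<le> (1 - y + y\<^sup>2 / 2) * exp y" using q nn by (rule mult_left_mono)
  finally have "exp (- y) \<le> 1 - y + y\<^sup>2 / 2"
    by (simp add: exp_minus field_simps)
  with l show ?thesis by simp
qed

text \<open>
  Lindeberg's argument. Factor by factor, the characteristic function of the error and the Gaussian one differ by
  \<open>(t u)\<^sup>2\<close> times a quantity that is small uniformly for \<open>|u| \<le> \<eta>\<close>; the sum of these errors is controlled
  by the normalisation of the weights. The bound is uniform in the weights, so it survives averaging over them.
\<close>

lemma (in real_distribution) char_product_close_to_gaussian:
  assumes i1: "integrable M (\<lambda>x. x)" and m0: "expectation (\<lambda>x. x) = 0"
    and i2: "integrable M (\<lambda>x. x\<^sup>2)" and v: "variance (\<lambda>x. x) = \<sigma>\<^sup>2" and \<sigma>: "\<sigma> > 0"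
    and \<epsilon>: "\<epsilon> > 0"
  shows "\<exists>\<eta>>0. \<forall>(n::nat) u. \<sigma>\<^sup>2 * (\<Sum>i<n. (u i)\<^sup>2) = 1 \<and> (\<forall>i<n. \<bar>u i\<bar> \<le> \<eta>) \<longrightarrow>
    cmod ((\<Prod>i<n. char M (t * u i)) - complex_of_real (exp (- t\<^sup>2 / 2))) \<le> \<epsilon>"
proof -
  define m where "m a = expectation (\<lambda>x. min (6 * x\<^sup>2) (a * \<bar>x\<bar> ^ 3))" for a :: real
  define b where "b \<eta> = t\<^sup>2 / (6 * \<sigma>\<^sup>2) * m (\<bar>t\<bar> * \<eta>) + (\<sigma> * t * \<eta>)\<^sup>2 / 2 * t\<^sup>2 / 4" for \<eta>
  have mi: "integrable M (\<lambda>x. min (6 * x\<^sup>2) (a * \<bar>x\<bar> ^ 3))" if "a \<ge> 0" for a :: real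
  proof (rule Bochner_Integration.integrable_bound)
    show "integrable M (\<lambda>x. 6 * x\<^sup>2)" using i2 by (rule integrable_mult_right)
    show "AE x in M. norm (min (6 * x\<^sup>2) (a * \<bar>x\<bar> ^ 3)) \<le> norm (6 * x\<^sup>2)"
      using that by (intro AE_I2) (auto simp: min_def)
  qed simp
  have m_mono: "m a \<le> m a'" if "0 \<le> a" "a \<le> a'" for a a'
    unfolding m_def using that by (intro integral_mono mi min.mono mult_right_mono) auto
  have "(\<lambda>k. m (\<bar>t\<bar> * (1 / Suc k))) \<longlonglongrightarrow> expectation (\<lambda>x. 0)"
    unfolding m_def
  proof (rule integral_dominated_convergence[where w = "\<lambda>x. 6 * x\<^sup>2"])
    show "AE x in M. (\<lambda>k. min (6 * x\<^sup>2) (\<bar>t\<bar> * (1 / Suc k) * \<bar>x\<bar> ^ 3)) \<longlonglongrightarrow> 0"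
    proof (intro AE_I2)
      fix x :: real
      have "(\<lambda>k. min (6 * x\<^sup>2) (\<bar>t\<bar> * (1 / Suc k) * \<bar>x\<bar> ^ 3)) \<longlonglongrightarrow> min (6 * x\<^sup>2) (\<bar>t\<bar> * 0 * \<bar>x\<bar> ^ 3)"
        by (intro tendsto_min tendsto_mult tendsto_const LIMSEQ_Suc[OF lim_1_over_n])
      then show "(\<lambda>k. min (6 * x\<^sup>2) (\<bar>t\<bar> * (1 / Suc k) * \<bar>x\<bar> ^ 3)) \<longlonglongrightarrow> 0" by simp
    qed
    show "AE x in M. norm (min (6 * x\<^sup>2) (\<bar>t\<bar> * (1 / Suc k) * \<bar>x\<bar> ^ 3)) \<le> 6 * x\<^sup>2" for k
      by (intro AE_I2) (auto simp: min_def)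
    show "integrable M (\<lambda>x. 6 * x\<^sup>2)" using i2 by (rule integrable_mult_right)
  qed simp_all
  then have m0': "(\<lambda>k. m (\<bar>t\<bar> * (1 / Suc k))) \<longlonglongrightarrow> 0" by simp
  have "(\<lambda>k. b (1 / Suc k)) \<longlonglongrightarrow> t\<^sup>2 / (6 * \<sigma>\<^sup>2) * 0 + (\<sigma> * t * 0)\<^sup>2 / 2 * t\<^sup>2 / 4"
    unfolding b_def using \<sigma>
    by (intro tendsto_add tendsto_mult tendsto_divide tendsto_power tendsto_const m0' LIMSEQ_Suc[OF lim_1_over_n]) auto
  then have "(\<lambda>k. b (1 / Suc k)) \<longlonglongrightarrow> 0" by simp
  then have "\<forall>\<^sub>F k in sequentially. b (1 / Suc k) < \<epsilon>" using \<epsilon> by (rule order_tendstoD)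
  then obtain k where k: "b (1 / Suc k) < \<epsilon>" by (auto simp: eventually_sequentially)
  define \<eta> where "\<eta> = 1 / real (Suc k)"
  have \<eta>: "\<eta> > 0" "b \<eta> < \<epsilon>" using k by (auto simp: \<eta>_def)
  have cl: "cmod ((\<Prod>i<n. char M (t * u i)) - complex_of_real (exp (- t\<^sup>2 / 2))) \<le> \<epsilon>"
    if s: "\<sigma>\<^sup>2 * (\<Sum>i<n. (u i)\<^sup>2) = 1" and u: "\<And>i. i < n \<Longrightarrow> \<bar>u i\<bar> \<le> \<eta>" for n :: nat and u
  proof -
    define y where "y i = (t * u i)\<^sup>2 * \<sigma>\<^sup>2 / 2" for i
    have ys: "(\<Sum>i<n. y i) = t\<^sup>2 / 2"
    proof -
      have "(\<Sum>i<n. y i) = t\<^sup>2 / 2 * (\<sigma>\<^sup>2 * (\<Sum>i<n. (u i)\<^sup>2))"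
        unfolding y_def sum_distrib_left by (intro sum.cong refl) (simp add: power_mult_distrib)
      then show ?thesis unfolding s by simp
    qed
    have ex: "complex_of_real (exp (- t\<^sup>2 / 2)) = (\<Prod>i<n. of_real (exp (- y i)))"
    proof -
      have "exp (- t\<^sup>2 / 2) = exp (\<Sum>i<n. - y i)" using ys by (simp add: sum_negf)
      also have "\<dots> = (\<Prod>i<n. exp (- y i))" by (rule exp_sum) simp
      finally show ?thesis by simp
    qed
    have "cmod ((\<Prod>i<n. char M (t * u i)) - (\<Prod>i<n. of_real (exp (- y i)))) \<le> (\<Sum>i<n. cmod (char M (t * u i) - of_real (exp (- y i))))"
      by (rule norm_prod_diff) (auto simp: cmod_char_le_1 y_def)
    also have "\<dots> \<le> (\<Sum>i<n. (t * u i)\<^sup>2 / 6 * m (\<bar>t\<bar> * \<eta>) + (\<sigma> * t * \<eta>)\<^sup>2 / 2 * y i / 2)"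
    proof (intro sum_mono)
      fix i assume "i \<in> {..<n}"
      then have ui: "\<bar>u i\<bar> \<le> \<eta>" using u by simp
      have "cmod (char M (t * u i) - of_real (1 - y i)) \<le> (t * u i)\<^sup>2 / 6 * m \<bar>t * u i\<bar>"
        using char_approx3[OF i1 m0 i2 v, of "t * u i"] unfolding m_def y_def by simp
      also have "\<dots> \<le> (t * u i)\<^sup>2 / 6 * m (\<bar>t\<bar> * \<eta>)"
        using ui by (intro mult_left_mono m_mono) (auto simp: abs_mult intro: mult_left_mono)
      finally have 1: "cmod (char M (t * u i) - of_real (1 - y i)) \<le> (t * u i)\<^sup>2 / 6 * m (\<bar>t\<bar> * \<eta>)" .
      have y0: "y i \<ge> 0" by (simp add: y_def)
      have "(u i)\<^sup>2 \<le> \<eta>\<^sup>2" using power_mono[OF ui, of 2] by simp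
      then have "(\<sigma> * t)\<^sup>2 * (u i)\<^sup>2 \<le> (\<sigma> * t)\<^sup>2 * \<eta>\<^sup>2" by (rule mult_left_mono) simp
      moreover have "y i = (\<sigma> * t)\<^sup>2 * (u i)\<^sup>2 / 2"
        unfolding y_def power_mult_distrib by (simp only: mult_ac)
      moreover have "(\<sigma> * t * \<eta>)\<^sup>2 = (\<sigma> * t)\<^sup>2 * \<eta>\<^sup>2" by (rule power_mult_distrib)
      ultimately have yb: "y i \<le> (\<sigma> * t * \<eta>)\<^sup>2 / 2" by linarith
      have "cmod (of_real (1 - y i) - of_real (exp (- y i))) = \<bar>1 - y i - exp (- y i)\<bar>"
        by (simp only: of_real_diff[symmetric] norm_of_real)
      also have "\<dots> \<le> (y i)\<^sup>2 / 2" by (rule exp_minus_quadratic_approx[OF y0])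
      also have "\<dots> \<le> (\<sigma> * t * \<eta>)\<^sup>2 / 2 * y i / 2"
        using mult_right_mono[OF yb y0] by (simp add: power2_eq_square)
      finally have 2: "cmod (of_real (1 - y i) - of_real (exp (- y i))) \<le> (\<sigma> * t * \<eta>)\<^sup>2 / 2 * y i / 2" .
      show "cmod (char M (t * u i) - of_real (exp (- y i))) \<le> (t * u i)\<^sup>2 / 6 * m (\<bar>t\<bar> * \<eta>) + (\<sigma> * t * \<eta>)\<^sup>2 / 2 * y i / 2"
        using norm_triangle_ineq[of "char M (t * u i) - of_real (1 - y i)" "of_real (1 - y i) - of_real (exp (- y i))"] 1 2
        by simp
    qed
    also have "\<dots> = b \<eta>"
    proof -
      have "(\<Sum>i<n. (t * u i)\<^sup>2 / 6 * m (\<bar>t\<bar> * \<eta>)) = t\<^sup>2 / (6 * \<sigma>\<^sup>2) * m (\<bar>t\<bar> * \<eta>) * (\<sigma>\<^sup>2 * (\<Sum>i<n. (u i)\<^sup>2))"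
        unfolding sum_distrib_left using \<sigma> by (intro sum.cong refl) (simp add: power_mult_distrib)
      then have "(\<Sum>i<n. (t * u i)\<^sup>2 / 6 * m (\<bar>t\<bar> * \<eta>)) = t\<^sup>2 / (6 * \<sigma>\<^sup>2) * m (\<bar>t\<bar> * \<eta>)" unfolding s by simp
      moreover have "(\<Sum>i<n. (\<sigma> * t * \<eta>)\<^sup>2 / 2 * y i / 2) = (\<sigma> * t * \<eta>)\<^sup>2 / 2 * (\<Sum>i<n. y i) / 2"
        by (simp only: sum_distrib_left sum_divide_distrib)
      ultimately show ?thesis unfolding sum.distrib b_def ys by simp
    qed
    finally show ?thesis unfolding ex using \<eta>(2) by linarith
  qed
  show ?thesis
  proof (intro exI[of _ \<eta>] conjI allI impI)
    fix n :: nat and u :: "nat \<Rightarrow> real"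
    assume a: "\<sigma>\<^sup>2 * (\<Sum>i<n. (u i)\<^sup>2) = 1 \<and> (\<forall>i<n. \<bar>u i\<bar> \<le> \<eta>)"
    show "cmod ((\<Prod>i<n. char M (t * u i)) - complex_of_real (exp (- t\<^sup>2 / 2))) \<le> \<epsilon>"
      by (rule cl) (use a in auto)
  qed (rule \<eta>(1))
qed

text \<open>
  Conditioning on the weights, by Fubini on the product of the two laws.
\<close>

lemma (in prob_space) char_random_weights:
  fixes e U :: "nat \<Rightarrow> 'a \<Rightarrow> real"
  assumes e: "indep_vars (\<lambda>_. borel) e UNIV" and d: "\<And>i. distr M borel (e i) = \<mu>"
    and ind: "indep_var (\<Pi>\<^sub>M i\<in>{..<n}. borel) (\<lambda>\<omega>. \<lambda>i\<in>{..<n}. U i \<omega>) (\<Pi>\<^sub>M i\<in>{..<n}. borel) (\<lambda>\<omega>. \<lambda>i\<in>{..<n}. e i \<omega>)"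
  shows "(\<lambda>\<omega>. \<Sum>i<n. U i \<omega> * e i \<omega>) \<in> borel_measurable M"
    and "(\<lambda>\<omega>. \<Prod>i<n. char \<mu> (t * U i \<omega>)) \<in> borel_measurable M"
    and "char (distr M borel (\<lambda>\<omega>. \<Sum>i<n. U i \<omega> * e i \<omega>)) t = (\<integral>\<omega>. (\<Prod>i<n. char \<mu> (t * U i \<omega>)) \<partial>M)"
proof -
  let ?P = "\<Pi>\<^sub>M i\<in>{..<n}. (borel :: real measure)"
  let ?U = "\<lambda>\<omega>. \<lambda>i\<in>{..<n}. U i \<omega>" and ?E = "\<lambda>\<omega>. \<lambda>i\<in>{..<n}. e i \<omega>"
  have em [measurable]: "e i \<in> borel_measurable M" for i
    using e unfolding indep_vars_def by auto
  have Um: "?U \<in> M \<rightarrow>\<^sub>M ?P" and Em: "?E \<in> M \<rightarrow>\<^sub>M ?P"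
    and J: "distr M ?P ?U \<Otimes>\<^sub>M distr M ?P ?E = distr M (?P \<Otimes>\<^sub>M ?P) (\<lambda>\<omega>. (?U \<omega>, ?E \<omega>))"
    using ind unfolding indep_var_distribution_eq by auto
  have Ui [measurable]: "U i \<in> borel_measurable M" if "i < n" for i
  proof -
    have "(\<lambda>\<omega>. ?U \<omega> i) \<in> borel_measurable M"
      by (rule measurable_compose[OF Um]) (use that in simp)
    then show ?thesis using that by (simp cong: measurable_cong)
  qed
  interpret \<mu>: real_distribution \<mu> using d[of 0] real_distribution_distr[OF em] by metis
  show Sm: "(\<lambda>\<omega>. \<Sum>i<n. U i \<omega> * e i \<omega>) \<in> borel_measurable M" by (intro borel_measurable_sum) auto
  show "(\<lambda>\<omega>. \<Prod>i<n. char \<mu> (t * U i \<omega>)) \<in> borel_measurable M"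
    by (intro borel_measurable_prod) (auto intro!: measurable_compose[OF _ \<mu>.char_measurable])
  interpret DU: prob_space "distr M ?P ?U" by (rule prob_space_distr[OF Um])
  interpret DE: prob_space "distr M ?P ?E" by (rule prob_space_distr[OF Em])
  interpret D: pair_prob_space "distr M ?P ?U" "distr M ?P ?E" ..
  let ?F = "\<lambda>u v :: nat \<Rightarrow> real. iexp (t * (\<Sum>i<n. u i * v i))"
  have Fm: "(\<lambda>p. ?F (fst p) (snd p)) \<in> borel_measurable (?P \<Otimes>\<^sub>M ?P)"
    by measurable
  have FmD: "case_prod ?F \<in> borel_measurable (distr M ?P ?U \<Otimes>\<^sub>M distr M ?P ?E)"
    using Fm by (simp add: case_prod_beta' cong: measurable_cong_sets)
  have Fi: "integrable (distr M ?P ?U \<Otimes>\<^sub>M distr M ?P ?E) (case_prod ?F)"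
    by (rule D.integrable_const_bound[where B = 1]) (use FmD in \<open>auto simp del: of_real_mult\<close>)
  have "char (distr M borel (\<lambda>\<omega>. \<Sum>i<n. U i \<omega> * e i \<omega>)) t = (\<integral>\<omega>. ?F (\<lambda>i. U i \<omega>) (\<lambda>i. e i \<omega>) \<partial>M)"
    unfolding char_def by (subst integral_distr[OF Sm]) auto
  also have "\<dots> = (\<integral>\<omega>. case_prod ?F (?U \<omega>, ?E \<omega>) \<partial>M)"
    by (intro Bochner_Integration.integral_cong refl) simp
  also have "\<dots> = (\<integral>p. case_prod ?F p \<partial>(distr M (?P \<Otimes>\<^sub>M ?P) (\<lambda>\<omega>. (?U \<omega>, ?E \<omega>))))"
    using Um Em Fm by (intro integral_distr[symmetric]) (auto simp: case_prod_beta')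
  also have "\<dots> = (\<integral>p. case_prod ?F p \<partial>(distr M ?P ?U \<Otimes>\<^sub>M distr M ?P ?E))" unfolding J ..
  also have "\<dots> = (\<integral>u. (\<integral>v. ?F u v \<partial>distr M ?P ?E) \<partial>distr M ?P ?U)"
    by (rule D.integral_fst[OF Fi, symmetric])
  also have "\<dots> = (\<integral>u. (\<Prod>i<n. char \<mu> (t * u i)) \<partial>distr M ?P ?U)"
  proof (intro Bochner_Integration.integral_cong refl)
    fix u :: "nat \<Rightarrow> real"
    have "(\<integral>v. ?F u v \<partial>distr M ?P ?E) = (\<integral>\<omega>. ?F u (?E \<omega>) \<partial>M)"
      by (rule integral_distr[OF Em]) measurable
    also have "\<dots> = (\<integral>\<omega>. ?F u (\<lambda>i. e i \<omega>) \<partial>M)"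
      by (intro Bochner_Integration.integral_cong refl) simp
    also have "\<dots> = char (distr M borel (\<lambda>\<omega>. \<Sum>i<n. u i * e i \<omega>)) t"
      unfolding char_def by (subst integral_distr) auto
    also have "\<dots> = (\<Prod>i<n. char (distr M borel (\<lambda>\<omega>. u i * e i \<omega>)) t)"
      by (intro char_distr_sum indep_vars_compose2[OF indep_vars_subset[OF e]]) auto
    also have "\<dots> = (\<Prod>i<n. char \<mu> (t * u i))"
    proof (intro prod.cong refl)
      fix i
      have "char (distr M borel (\<lambda>\<omega>. u i * e i \<omega>)) t = (\<integral>\<omega>. iexp (t * u i * e i \<omega>) \<partial>M)"
        unfolding char_def by (subst integral_distr) (auto simp: mult.assoc)
      also have "\<dots> = char (distr M borel (e i)) (t * u i)"
        unfolding char_def by (subst integral_distr) auto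
      finally show "char (distr M borel (\<lambda>\<omega>. u i * e i \<omega>)) t = char \<mu> (t * u i)" unfolding d .
    qed
    finally show "(\<integral>v. ?F u v \<partial>distr M ?P ?E) = (\<Prod>i<n. char \<mu> (t * u i))" .
  qed
  also have "\<dots> = (\<integral>\<omega>. (\<Prod>i<n. char \<mu> (t * ?U \<omega> i)) \<partial>M)"
    by (rule integral_distr[OF Um]) (intro borel_measurable_prod measurable_compose[OF _ \<mu>.char_measurable], simp)
  also have "\<dots> = (\<integral>\<omega>. (\<Prod>i<n. char \<mu> (t * U i \<omega>)) \<partial>M)"
    by (intro Bochner_Integration.integral_cong prod.cong refl) simp
  finally show "char (distr M borel (\<lambda>\<omega>. \<Sum>i<n. U i \<omega> * e i \<omega>)) t = (\<integral>\<omega>. (\<Prod>i<n. char \<mu> (t * U i \<omega>)) \<partial>M)" .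
qed

text \<open>
  The conditional characteristic function is uniformly close to the Gaussian one on the event where the weights
  are normalised and small, and off this event both are bounded by \<open>1\<close>.
\<close>

lemma (in prob_space) random_weights_clt:
  fixes e :: "nat \<Rightarrow> 'a \<Rightarrow> real" and U :: "nat \<Rightarrow> nat \<Rightarrow> 'a \<Rightarrow> real"
  assumes iid: "iid_errors M e \<sigma>" and \<sigma>: "\<sigma> > 0"
    and ind: "\<And>n. indep_var (\<Pi>\<^sub>M i\<in>{..<n}. borel) (\<lambda>\<omega>. \<lambda>i\<in>{..<n}. U n i \<omega>) (\<Pi>\<^sub>M i\<in>{..<n}. borel) (\<lambda>\<omega>. \<lambda>i\<in>{..<n}. e i \<omega>)"
    and small: "\<And>\<epsilon> \<eta>. \<epsilon> > 0 \<Longrightarrow> \<eta> > 0 \<Longrightarrow> \<forall>\<^sub>F n in sequentially. \<exists>A\<in>sets M. prob A \<ge> 1 - \<epsilon> \<and>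
        (\<forall>\<omega>\<in>A. \<sigma>\<^sup>2 * (\<Sum>i<n. (U n i \<omega>)\<^sup>2) = 1 \<and> (\<forall>i<n. \<bar>U n i \<omega>\<bar> \<le> \<eta>))"
  shows "weak_conv_m (\<lambda>n. distr M borel (\<lambda>\<omega>. \<Sum>i<n. U n i \<omega> * e i \<omega>)) std_normal_distribution"
proof (rule levy_continuity)
  let ?S = "\<lambda>n \<omega>. \<Sum>i<n. U n i \<omega> * e i \<omega>"
  define \<mu> where "\<mu> = distr M borel (e 0)"
  have e: "indep_vars (\<lambda>_. borel) e UNIV" and d: "\<And>i. distr M borel (e i) = \<mu>"
    and e1: "integrable M (e 0)" "expectation (e 0) = 0" and e2: "integrable M (\<lambda>\<omega>. (e 0 \<omega>)\<^sup>2)" "variance (e 0) = \<sigma>\<^sup>2"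
    using iid unfolding iid_errors_def \<mu>_def by auto
  have em: "e i \<in> borel_measurable M" for i using e unfolding indep_vars_def by auto
  interpret \<mu>: real_distribution \<mu> unfolding \<mu>_def by (rule real_distribution_distr[OF em])
  have mu: "integrable \<mu> (\<lambda>x. x)" "\<mu>.expectation (\<lambda>x. x) = 0" "integrable \<mu> (\<lambda>x. x\<^sup>2)" "\<mu>.variance (\<lambda>x. x) = \<sigma>\<^sup>2"
    using e1 e2 em[of 0] unfolding \<mu>_def by (simp_all add: integrable_distr_eq integral_distr)
  note cw = char_random_weights[OF e d ind]
  show "real_distribution (distr M borel (?S n))" for n
    by (rule real_distribution_distr[OF cw(1)])
  show "real_distribution std_normal_distribution" by (rule real_dist_normal_dist)
  fix t :: real
  show "(\<lambda>n. char (distr M borel (?S n)) t) \<longlonglongrightarrow> char std_normal_distribution t"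
  proof (rule tendstoI)
    fix \<delta> :: real assume "\<delta> > 0"
    define \<epsilon> where "\<epsilon> = \<delta> / 4"
    have \<epsilon>: "\<epsilon> > 0" using \<open>\<delta> > 0\<close> by (simp add: \<epsilon>_def)
    obtain \<eta> where \<eta>: "\<eta> > 0" and close: "\<And>(n::nat) u. \<sigma>\<^sup>2 * (\<Sum>i<n. (u i)\<^sup>2) = 1 \<Longrightarrow> (\<forall>i<n. \<bar>u i\<bar> \<le> \<eta>) \<Longrightarrow>
        cmod ((\<Prod>i<n. char \<mu> (t * u i)) - complex_of_real (exp (- t\<^sup>2 / 2))) \<le> \<epsilon>"
      using \<mu>.char_product_close_to_gaussian[OF mu \<sigma> \<epsilon>, of t] by blast
    show "\<forall>\<^sub>F n in sequentially. dist (char (distr M borel (?S n)) t) (char std_normal_distribution t) < \<delta>"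
      using small[OF \<epsilon> \<eta>]
    proof eventually_elim
      case (elim n)
      then obtain A where A': "A \<in> sets M" and "prob A \<ge> 1 - \<epsilon> \<and>
          (\<forall>\<omega>\<in>A. \<sigma>\<^sup>2 * (\<Sum>i<n. (U n i \<omega>)\<^sup>2) = 1 \<and> (\<forall>i<n. \<bar>U n i \<omega>\<bar> \<le> \<eta>))"
        by (rule bexE)
      then have A: "A \<in> sets M" "prob A \<ge> 1 - \<epsilon>"
        and AU: "\<forall>\<omega>\<in>A. \<sigma>\<^sup>2 * (\<Sum>i<n. (U n i \<omega>)\<^sup>2) = 1 \<and> (\<forall>i<n. \<bar>U n i \<omega>\<bar> \<le> \<eta>)"
        by simp_all
      let ?p = "\<lambda>\<omega>. \<Prod>i<n. char \<mu> (t * U n i \<omega>)" and ?g = "complex_of_real (exp (- t\<^sup>2 / 2))"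
      have p1: "cmod (?p \<omega>) \<le> 1" for \<omega>
        unfolding prod_norm[symmetric] by (intro prod_le_1) (auto simp: \<mu>.cmod_char_le_1)
      have pi: "integrable M ?p"
        by (rule integrable_const_bound[where B = 1]) (use p1 cw(2) in auto)
      have g1: "cmod ?g \<le> 1" by simp
      have Ac: "space M - A \<in> sets M" using A(1) by auto
      have "char (distr M borel (?S n)) t - ?g = (\<integral>\<omega>. ?p \<omega> - ?g \<partial>M)"
        unfolding cw(3) using pi by (simp add: prob_space)
      also have "cmod \<dots> \<le> (\<integral>\<omega>. cmod (?p \<omega> - ?g) \<partial>M)" by (rule integral_norm_bound)
      also have "\<dots> \<le> (\<integral>\<omega>. \<epsilon> + 2 * indicator (space M - A) \<omega> \<partial>M)"
      proof (rule integral_mono_AE)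
        show "integrable M (\<lambda>\<omega>. cmod (?p \<omega> - ?g))" using pi by (intro integrable_norm Bochner_Integration.integrable_diff) auto
        show "integrable M (\<lambda>\<omega>. \<epsilon> + 2 * indicator (space M - A) \<omega>)"
          using Ac by (intro Bochner_Integration.integrable_add integrable_mult_right integrable_real_indicator)
            (auto simp: less_top[symmetric])
        show "AE \<omega> in M. cmod (?p \<omega> - ?g) \<le> \<epsilon> + 2 * indicator (space M - A) \<omega>"
        proof (intro AE_I2)
          fix \<omega> assume \<omega>: "\<omega> \<in> space M"
          show "cmod (?p \<omega> - ?g) \<le> \<epsilon> + 2 * indicator (space M - A) \<omega>"
          proof (cases "\<omega> \<in> A")
            case True
            with AU have "cmod (?p \<omega> - ?g) \<le> \<epsilon>" by (intro close) auto
            then show ?thesis using True by simp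
          next
            case False
            have "cmod (?p \<omega> - ?g) \<le> 2"
              using norm_triangle_ineq4[of "?p \<omega>" ?g] p1[of \<omega>] g1 by linarith
            then show ?thesis using False \<omega> \<epsilon> by simp
          qed
        qed
      qed
      also have "\<dots> = \<epsilon> + 2 * prob (space M - A)"
        using Ac by (simp add: prob_space less_top[symmetric])
      also have "prob (space M - A) \<le> \<epsilon>" using A by (simp add: prob_compl)
      finally have "cmod (char (distr M borel (?S n)) t - ?g) \<le> 3 * \<epsilon>" by simp
      then show ?case using \<epsilon> unfolding char_std_normal_distribution dist_norm \<epsilon>_def by simp
    qed
  qed
qed

section \<open>Measurability of the weights\<close>

lemma sobolev_space_on_continuous:
  assumes "v \<in> sobolev_space_on m \<Omega>"
  shows "continuous_on \<Omega> v"
proof -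
  obtain f where f: "f \<in> sobolev_space m" "\<forall>x\<in>\<Omega>. f x = v x"
    using assms unfolding sobolev_space_on_def sobolev_extensions_def by blast
  have "continuous_on UNIV f" using f(1) unfolding sobolev_space_def by simp
  then have "continuous_on \<Omega> f" by (rule continuous_on_subset) simp
  then show ?thesis by (rule continuous_on_eq) (use f(2) in auto)
qed

text \<open>
  The second argument is replaced by its first neighbour, within \<open>1/(k+1)\<close>, in a countable dense subset. The
  resulting functions are measurable because the neighbour takes countably many values, and they converge by
  continuity in the second argument.
\<close>

lemma separately_continuous_measurable:
  fixes K :: "'a::euclidean_space \<Rightarrow> 'a \<Rightarrow> real"
  assumes \<Omega> [measurable]: "\<Omega> \<in> sets borel"
    and c1: "\<And>y. y \<in> \<Omega> \<Longrightarrow> continuous_on \<Omega> (\<lambda>x. K x y)"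
    and c2: "\<And>x. x \<in> \<Omega> \<Longrightarrow> continuous_on \<Omega> (\<lambda>y. K x y)"
  shows "(\<lambda>p. if fst p \<in> \<Omega> \<and> snd p \<in> \<Omega> then K (fst p) (snd p) else 0) \<in> borel_measurable (borel \<Otimes>\<^sub>M borel)"
proof (cases "\<Omega> = {}")
  case True
  then show ?thesis by simp
next
  case False
  obtain D where D: "countable D" "D \<subseteq> \<Omega>" "\<Omega> \<subseteq> closure D" using separable by metis
  have "D \<noteq> {}" using D(3) False by auto
  define d where "d = from_nat_into D"
  have dO: "d i \<in> \<Omega>" for i using from_nat_into[OF \<open>D \<noteq> {}\<close>] D(2) unfolding d_def by blast
  define \<iota> where "\<iota> k y = (LEAST i. dist (d i) y < 1 / real (Suc k))" for k :: nat and y :: 'a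
  have \<iota>: "dist (d (\<iota> k y)) y < 1 / real (Suc k)" if "y \<in> \<Omega>" for k y
  proof -
    have "y \<in> closure D" using D(3) that by blast
    then have "\<forall>e>0. \<exists>z\<in>D. dist z y < e" unfolding closure_approachable .
    then have "\<exists>z\<in>D. dist z y < 1 / real (Suc k)" by (rule allE[of _ "1 / real (Suc k)"]) simp
    then obtain i where "dist (d i) y < 1 / real (Suc k)"
      unfolding d_def using from_nat_into_surj[OF D(1)] by metis
    then show ?thesis unfolding \<iota>_def by (rule LeastI)
  qed
  have \<iota>m [measurable]: "\<iota> k \<in> borel \<rightarrow>\<^sub>M count_space UNIV" for k
    unfolding \<iota>_def by measurable
  have Fm: "(\<lambda>p. if fst p \<in> \<Omega> \<and> snd p \<in> \<Omega> then K (fst p) (d i) else 0) \<in> borel_measurable (borel \<Otimes>\<^sub>M borel)" for i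
  proof -
    define ff where "ff x = indicator \<Omega> x *\<^sub>R K x (d i)" for x
    have [measurable]: "ff \<in> borel_measurable borel"
      using borel_measurable_continuous_on_indicator[OF \<Omega> c1[OF dO]] unfolding ff_def .
    have "(\<lambda>p. indicator \<Omega> (snd p) * ff (fst p)) \<in> borel_measurable ((borel::'a measure) \<Otimes>\<^sub>M (borel::'a measure))"
      by measurable
    moreover have "(\<lambda>p. indicator \<Omega> (snd p) * ff (fst p))
       = (\<lambda>p. if fst p \<in> \<Omega> \<and> snd p \<in> \<Omega> then K (fst p) (d i) else 0)"
      by (auto simp: ff_def indicator_def)
    ultimately show ?thesis by simp
  qed
  show ?thesis
  proof (rule borel_measurable_LIMSEQ_real)
    show "(\<lambda>p. if fst p \<in> \<Omega> \<and> snd p \<in> \<Omega> then K (fst p) (d (\<iota> k (snd p))) else 0) \<in> borel_measurable (borel \<Otimes>\<^sub>M borel)" for k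
      by (rule measurable_compose_countable[where f = "\<lambda>i p. if fst p \<in> \<Omega> \<and> snd p \<in> \<Omega> then K (fst p) (d i) else 0" and g = "\<lambda>p. \<iota> k (snd p)"])
        (rule Fm, measurable)
    fix p :: "'a \<times> 'a"
    show "(\<lambda>k. if fst p \<in> \<Omega> \<and> snd p \<in> \<Omega> then K (fst p) (d (\<iota> k (snd p))) else 0) \<longlonglongrightarrow> (if fst p \<in> \<Omega> \<and> snd p \<in> \<Omega> then K (fst p) (snd p) else 0)"
    proof (cases "fst p \<in> \<Omega> \<and> snd p \<in> \<Omega>")
      case True
      have "(\<lambda>k. dist (d (\<iota> k (snd p))) (snd p)) \<longlonglongrightarrow> 0"
        by (rule Lim_null_comparison[OF _ LIMSEQ_Suc[OF lim_1_over_n]])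
          (use True \<iota> in \<open>auto intro!: always_eventually less_imp_le\<close>)
      then have "(\<lambda>k. d (\<iota> k (snd p))) \<longlonglongrightarrow> snd p" by (rule tendsto_dist_iff[THEN iffD2])
      then have "(\<lambda>k. K (fst p) (d (\<iota> k (snd p)))) \<longlonglongrightarrow> K (fst p) (snd p)"
        using True dO by (intro continuous_on_tendsto_compose[OF c2]) auto
      then show ?thesis using True by simp
    next
      case False
      then show ?thesis by (simp only: if_False tendsto_const)
    qed
  qed
qed

lemma measurable_det:
  assumes A: "\<And>z. A z \<in> carrier_mat k k"
    and m: "\<And>i j. i < k \<Longrightarrow> j < k \<Longrightarrow> (\<lambda>z. A z $$ (i, j)) \<in> borel_measurable N"
  shows "(\<lambda>z. det (A z) :: real) \<in> borel_measurable N"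
proof -
  have "(\<lambda>z. det (A z)) = (\<lambda>z. \<Sum>p\<in>{p. p permutes {0..<k}}. signof p * (\<Prod>i=0..<k. A z $$ (i, p i)))"
    using A by (intro ext det_def')
  moreover have "(\<lambda>z. \<Sum>p\<in>{p. p permutes {0..<k}}. signof p * (\<Prod>i=0..<k. A z $$ (i, p i))) \<in> borel_measurable N"
  proof (intro borel_measurable_sum borel_measurable_times borel_measurable_const borel_measurable_prod m)
    fix p i assume p: "p \<in> {p. p permutes {0..<k}}" and i: "i \<in> {0..<k}"
    show "i < k" using i by simp
    show "p i < k" using permutes_in_image[of p "{0..<k}" i] p i by simp
  qed
  ultimately show ?thesis by simp
qed

lemma measurable_cofactor:
  assumes A: "\<And>z. A z \<in> carrier_mat n n" and i: "i < n" and j: "j < n"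
    and m: "\<And>i j. i < n \<Longrightarrow> j < n \<Longrightarrow> (\<lambda>z. A z $$ (i, j)) \<in> borel_measurable N"
  shows "(\<lambda>z. cofactor (A z) i j :: real) \<in> borel_measurable N"
  unfolding cofactor_def
proof (intro borel_measurable_times borel_measurable_const measurable_det[where k = "n - 1"])
  show "mat_delete (A z) i j \<in> carrier_mat (n - 1) (n - 1)" for z by (rule mat_delete_carrier[OF A])
  fix i' j' assume i': "i' < n - 1" "j' < n - 1"
  have dim: "dim_row (A z) = n" "dim_col (A z) = n" for z using A[of z] by auto
  have eq: "(\<lambda>z. mat_delete (A z) i j $$ (i', j')) = (\<lambda>z. A z $$ (if i' < i then i' else Suc i', if j' < j then j' else Suc j'))"
    using i' unfolding mat_delete_def dim by (intro ext) simp
  show "(\<lambda>z. mat_delete (A z) i j $$ (i', j')) \<in> borel_measurable N"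
    unfolding eq using i' by (intro m) auto
qed

lemma measurable_ridge_weight:
  assumes K: "\<And>i j. i < n \<Longrightarrow> j < n \<Longrightarrow> (\<lambda>z. K (X z i) (X z j)) \<in> borel_measurable N"
    and g: "\<And>i. i < n \<Longrightarrow> (\<lambda>z. g (X z i)) \<in> borel_measurable N" and i: "i < n"
  shows "(\<lambda>z. ridge_weight K g l n (X z) i) \<in> borel_measurable N"
proof -
  have m: "(\<lambda>z. ridge_mat K l n (X z) $$ (i, j)) \<in> borel_measurable N" if "i < n" "j < n" for i j
    using K[OF that] that by (simp add: ridge_mat_index)
  show ?thesis
    unfolding ridge_weight_def
    by (intro borel_measurable_divide borel_measurable_sum borel_measurable_times
        measurable_cofactor[OF ridge_mat_carrier] measurable_det[OF ridge_mat_carrier] m g i) auto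
qed

lemma ridge_weight_cong:
  assumes "\<And>i j. i < n \<Longrightarrow> j < n \<Longrightarrow> K (x i) (x j) = K' (x' i) (x' j)" and "\<And>i. i < n \<Longrightarrow> g (x i) = g' (x' i)"
  shows "ridge_weight K g l n x i = ridge_weight K' g' l n x' i"
proof -
  have "ridge_mat K l n x = ridge_mat K' l n x'"
    using assms(1) ridge_mat_carrier[of K l n x] ridge_mat_carrier[of K' l n x']
    by (intro eq_matI) (auto simp: ridge_mat_index)
  moreover have "(\<Sum>j<n. cofactor A j i * g (x j)) = (\<Sum>j<n. cofactor A j i * g' (x' j))" for A
    by (intro sum.cong refl) (simp add: assms(2))
  ultimately show ?thesis unfolding ridge_weight_def by simp
qed

text \<open>
  Independence of generated sigma-algebras is inherited by functions. Passing from the design to the weights in this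
  way also makes both random variables take values in the same type.
\<close>

lemma (in prob_space) indep_var_of_indep_vimage:
  assumes ind: "indep_set (sets (vimage_algebra (space M) X S)) (sets (vimage_algebra (space M) Y T))"
    and X: "X \<in> M \<rightarrow>\<^sub>M S" and Y: "Y \<in> M \<rightarrow>\<^sub>M T" and f: "f \<in> S \<rightarrow>\<^sub>M T'"
  shows "indep_var T' (\<lambda>\<omega>. f (X \<omega>)) T Y"
proof -
  have Xs: "X \<in> space M \<rightarrow> space S" and Ys: "Y \<in> space M \<rightarrow> space T"
    using measurable_space[OF X] measurable_space[OF Y] by auto
  have "sigma_sets (space M) {(\<lambda>\<omega>. f (X \<omega>)) -` A \<inter> space M |A. A \<in> sets T'} \<subseteq> sets (vimage_algebra (space M) X S)"
  proof -
    have "{(\<lambda>\<omega>. f (X \<omega>)) -` A \<inter> space M |A. A \<in> sets T'} \<subseteq> sets (vimage_algebra (space M) X S)"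
    proof clarify
      fix A assume "A \<in> sets T'"
      then have "f -` A \<inter> space S \<in> sets S" by (rule measurable_sets[OF f])
      then have "X -` (f -` A \<inter> space S) \<inter> space M \<in> sets (vimage_algebra (space M) X S)"
        by (rule in_vimage_algebra)
      moreover have "X -` (f -` A \<inter> space S) \<inter> space M = (\<lambda>\<omega>. f (X \<omega>)) -` A \<inter> space M"
        using Xs by auto
      ultimately show "(\<lambda>\<omega>. f (X \<omega>)) -` A \<inter> space M \<in> sets (vimage_algebra (space M) X S)" by simp
    qed
    from sets.sigma_sets_subset[OF this] show ?thesis by simp
  qed
  moreover have "sigma_sets (space M) {Y -` A \<inter> space M |A. A \<in> sets T} \<subseteq> sets (vimage_algebra (space M) Y T)"
  proof -
    have "{Y -` A \<inter> space M |A. A \<in> sets T} \<subseteq> sets (vimage_algebra (space M) Y T)"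
      by (auto intro: in_vimage_algebra)
    from sets.sigma_sets_subset[OF this] show ?thesis by simp
  qed
  ultimately have "indep_set (sigma_sets (space M) {(\<lambda>\<omega>. f (X \<omega>)) -` A \<inter> space M |A. A \<in> sets T'})
      (sigma_sets (space M) {Y -` A \<inter> space M |A. A \<in> sets T})"
    using ind unfolding indep_set_def by (elim indep_sets_mono_sets) (auto split: bool.split)
  then show ?thesis
    unfolding indep_var_eq using measurable_compose[OF X f] Y by simp
qed

section \<open>Asymptotic normality\<close>

text \<open>
  The bound for the Sobolev quotient norm, transferred to an equivalent norm.
\<close>

lemma rkhs_sobolev_pointwise_bound:
  fixes \<Omega> :: "'a::euclidean_space set"
  assumes "convex \<Omega>" "compact \<Omega>" "interior \<Omega> \<noteq> {}" "m > real DIM('a) / 2" "equals_sobolev m \<Omega> H ip"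
    and fh: "function_hilbert_space \<Omega> H ip"
  obtains S where "S > 0" "\<And>v y h. v \<in> H \<Longrightarrow> y \<in> \<Omega> \<Longrightarrow> 0 < h \<and> h \<le> 1 \<Longrightarrow>
    \<bar>v y\<bar> \<le> S * (h powr (- real DIM('a) / 2) * L2_norm_on \<Omega> v + h powr (m - real DIM('a) / 2) * hnorm ip v)"
proof -
  let ?d = "real DIM('a)"
  obtain c where H: "H = sobolev_space_on m \<Omega>" and c: "c > 0" "\<And>v. v \<in> H \<Longrightarrow> c * sobolev_norm_on m \<Omega> v \<le> hnorm ip v"
    using assms(5) unfolding equals_sobolev_def by blast
  obtain S0 where S0: "S0 > 0" "\<And>v y h. v \<in> H \<Longrightarrow> y \<in> \<Omega> \<Longrightarrow> 0 < h \<and> h \<le> 1 \<Longrightarrow>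
    \<bar>v y\<bar> \<le> S0 * (h powr (- ?d / 2) * L2_norm_on \<Omega> v + h powr (m - ?d / 2) * sobolev_norm_on m \<Omega> v)"
    using sobolev_pointwise_bound[OF assms(1-4)] unfolding H by blast
  define k where "k = max 1 (1 / c)"
  have k: "k \<ge> 1" "1 / c \<le> k" by (auto simp: k_def)
  show thesis
  proof (rule that)
    show "S0 * k > 0" using S0 k by simp
    fix v y h assume v: "v \<in> H" and y: "y \<in> \<Omega>" and h: "0 < h \<and> h \<le> (1::real)"
    have "sobolev_norm_on m \<Omega> v \<le> 1 / c * hnorm ip v" using c(2)[OF v] c(1) by (simp add: field_simps)
    also have "\<dots> \<le> k * hnorm ip v" using k hnorm_ge_0[OF fh v] by (intro mult_right_mono) auto
    finally have "h powr (m - ?d / 2) * sobolev_norm_on m \<Omega> v \<le> h powr (m - ?d / 2) * (k * hnorm ip v)"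
      by (rule mult_left_mono) simp
    moreover have "1 * (h powr (- ?d / 2) * L2_norm_on \<Omega> v) \<le> k * (h powr (- ?d / 2) * L2_norm_on \<Omega> v)"
      using k L2_norm_on_nonneg[of \<Omega> v] by (intro mult_right_mono) auto
    ultimately have "h powr (- ?d / 2) * L2_norm_on \<Omega> v + h powr (m - ?d / 2) * sobolev_norm_on m \<Omega> v
       \<le> k * (h powr (- ?d / 2) * L2_norm_on \<Omega> v + h powr (m - ?d / 2) * hnorm ip v)"
      by (simp add: distrib_left mult.left_commute)
    then have "S0 * (h powr (- ?d / 2) * L2_norm_on \<Omega> v + h powr (m - ?d / 2) * sobolev_norm_on m \<Omega> v)
       \<le> S0 * (k * (h powr (- ?d / 2) * L2_norm_on \<Omega> v + h powr (m - ?d / 2) * hnorm ip v))"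
      using S0(1) by (intro mult_left_mono) auto
    with S0(2)[OF v y h] show "\<bar>v y\<bar> \<le> S0 * k * (h powr (- ?d / 2) * L2_norm_on \<Omega> v + h powr (m - ?d / 2) * hnorm ip v)"
      by (simp only: mult.assoc)
  qed
qed

text \<open>
  All deterministic estimates together, for one design on which the norm comparison holds.
\<close>

lemma ridge_weights_small:
  fixes \<Omega> :: "'a::euclidean_space set" and z :: "nat \<Rightarrow> 'a" and n :: nat and S T :: real
  assumes K: "rkhs \<Omega> K H ip" and g: "g \<in> H" and z: "\<And>i. i < n \<Longrightarrow> z i \<in> \<Omega>" and n: "n \<ge> 1" and l: "l > 0"
    and S: "S > 0" "\<And>v y h. v \<in> H \<Longrightarrow> y \<in> \<Omega> \<Longrightarrow> 0 < h \<and> h \<le> 1 \<Longrightarrow>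
      \<bar>v y\<bar> \<le> S * (h powr (- real DIM('a) / 2) * L2_norm_on \<Omega> v + h powr (m - real DIM('a) / 2) * hnorm ip v)"
    and cmp: "\<And>v. v \<in> H \<Longrightarrow> L2_norm_on \<Omega> v \<le> max (C1 * empirical_norm n z v) (Ce * real n powr (- m / real DIM('a)) * hnorm ip v)"
      "\<And>v. v \<in> H \<Longrightarrow> empirical_norm n z v \<le> max (C1 * L2_norm_on \<Omega> v) (Ce * real n powr (- m / real DIM('a)) * hnorm ip v)"
    and C: "C1 > 0" "Ce > 0" "C = max C1 Ce"
    and i: "\<And>v. v \<in> H \<Longrightarrow> \<bar>ip g v\<bar> \<le> Cg * L2_norm_on \<Omega> v powr \<delta> * hnorm ip v powr (1 - \<delta>)"
    and Cg: "Cg > 0" and \<delta>: "0 < \<delta>" "\<delta> \<le> 1"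
    and Nl: "real n powr (- m / real DIM('a)) \<le> sqrt l"
    and v: "v \<in> H" "hnorm ip v \<le> R * L2_norm_on \<Omega> v" "ip g v / L2_norm_on \<Omega> v > C0 * R powr (1 - \<tau>)" and C0: "C0 > 0"
    and R: "R > 0" "R * real n powr (- m / real DIM('a)) \<le> 1" "Cg * C powr \<delta> * l powr (\<delta> / 2) * R powr \<tau> \<le> C0 / 2"
    and T: "T > 0" "T * real n powr (- 1 / real DIM('a)) \<le> 1"
    and q: "q = C * (real n powr (- m / real DIM('a)) / (l * R))"
    and \<theta>: "S * (T powr (- real DIM('a) / 2) * (C * (1 + q)) + T powr (m - real DIM('a) / 2) * q) \<le> \<theta>"
  shows "(\<Sum>i<n. (ridge_weight K g l n z i)\<^sup>2) > 0"
    and "i < n \<Longrightarrow> \<bar>ridge_weight K g l n z i\<bar> \<le> \<theta> * sqrt (\<Sum>i<n. (ridge_weight K g l n z i)\<^sup>2)"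
proof -
  note fh = rkhs_hilbert[OF K]
  let ?w = "ridge_weight K g l n z"
  obtain r where r: "r \<in> H" and rz: "\<And>i. i < n \<Longrightarrow> r (z i) = l * real n * ?w i"
    and eq: "\<And>v. v \<in> H \<Longrightarrow> (\<Sum>i<n. r (z i) * v (z i)) / real n + l * ip r v = l * ip g v"
    using ridge_residual[OF K, of n z l g] z l n g by blast
  have b: "hnorm ip r \<le> Cg * C powr \<delta> * l powr (\<delta> / 2)"
    by (rule residual_hnorm_bound[OF fh r l eq[OF r] cmp(1)[OF r] _ Nl C i[OF r] Cg \<delta>]) simp
  have "hnorm ip r * R powr \<tau> \<le> Cg * C powr \<delta> * l powr (\<delta> / 2) * R powr \<tau>"
    by (rule mult_right_mono[OF b]) simp
  then have bR: "hnorm ip r * R powr \<tau> \<le> C0 / 2" using R(3) by linarith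
  have N0: "0 \<le> real n powr (- m / real DIM('a))" by simp
  note low = residual_empirical_lower_bound[OF fh r v(1) l eq[OF v(1)] cmp(2)[OF v(1)] N0 C R(1,2) v(2,3) C0 bR]
  define A where "A = empirical_norm n z r"
  have A: "A > 0" using low(1) unfolding A_def .
  have np: "real n > 0" using n by simp
  have ln: "l * real n > 0" using l np by simp
  have sum: "(\<Sum>i<n. (?w i)\<^sup>2) = (sqrt (real n) * A / (l * real n))\<^sup>2"
  proof -
    have "(\<Sum>i<n. (r (z i))\<^sup>2) = real n * A\<^sup>2"
      unfolding A_def empirical_norm_square using np by simp
    moreover have "(\<Sum>i<n. (r (z i))\<^sup>2) = (l * real n)\<^sup>2 * (\<Sum>i<n. (?w i)\<^sup>2)"
      unfolding sum_distrib_left by (intro sum.cong refl) (simp add: rz power_mult_distrib)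
    ultimately have "(l * real n)\<^sup>2 * (\<Sum>i<n. (?w i)\<^sup>2) = real n * A\<^sup>2" by simp
    then have "(\<Sum>i<n. (?w i)\<^sup>2) = real n * A\<^sup>2 / (l * real n)\<^sup>2"
      using ln by (metis nonzero_mult_div_cancel_left power_not_zero less_irrefl)
    also have "\<dots> = (sqrt (real n) * A / (l * real n))\<^sup>2"
      unfolding power_divide power_mult_distrib[of "sqrt (real n)"] by simp
    finally show ?thesis .
  qed
  have s0: "sqrt (real n) * A / (l * real n) > 0" using A np ln by simp
  show "(\<Sum>i<n. (?w i)\<^sup>2) > 0" unfolding sum using s0 by (intro zero_less_power)
  have sq: "sqrt (\<Sum>i<n. (?w i)\<^sup>2) = sqrt (real n) * A / (l * real n)"
    unfolding sum using s0 by (simp only: real_sqrt_abs)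
  show "\<bar>?w i\<bar> \<le> \<theta> * sqrt (\<Sum>i<n. (?w i)\<^sup>2)" if i: "i < n"
  proof -
    have "\<bar>r (z i)\<bar> \<le> S * (T powr (- real DIM('a) / 2) * (C * (1 + q)) + T powr (m - real DIM('a) / 2) * q) * (sqrt (real n) * A)"
      unfolding A_def
      by (rule residual_spread[OF fh r n l cmp(1)[OF r] C _ R(1) low T S(1) S(2)[OF r z[OF i]] q]) simp_all
    also have "\<dots> \<le> \<theta> * (sqrt (real n) * A)" using A by (intro mult_right_mono \<theta>) auto
    finally have "\<bar>r (z i)\<bar> \<le> \<theta> * (sqrt (real n) * A)" .
    moreover have "\<bar>?w i\<bar> = \<bar>r (z i)\<bar> / (l * real n)"
      using rz[OF i] ln l np by (simp add: abs_mult)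
    ultimately have "\<bar>?w i\<bar> \<le> \<theta> * (sqrt (real n) * A) / (l * real n)"
      using ln by (simp only: divide_right_mono[OF _ less_imp_le])
    then show ?thesis unfolding sq by simp
  qed
qed

text \<open>
  What is left is the choice of the constants. The event of the norm comparison fixes \<open>C\<close>; then \<open>c\<close> in the
  definition of \<open>R\<close> and the scale factor \<open>T\<close> are chosen such that the bound on the weights falls below any
  given \<open>\<eta>\<close> as \<open>n\<close> grows.
\<close>

lemma ridge_functional_weak_convergence:
  fixes \<Omega> :: "'a::euclidean_space set"
    and K :: "'a \<Rightarrow> 'a \<Rightarrow> real"
    and H :: "('a \<Rightarrow> real) set"
    and ip :: "('a \<Rightarrow> real) \<Rightarrow> ('a \<Rightarrow> real) \<Rightarrow> real"
    and g :: "'a \<Rightarrow> real"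
    and M :: "'w measure"
    and x :: "nat \<Rightarrow> nat \<Rightarrow> 'w \<Rightarrow> 'a"
    and e :: "nat \<Rightarrow> 'w \<Rightarrow> real"
    and lam :: "nat \<Rightarrow> real"
    and m \<sigma> \<delta> \<tau> :: real
  assumes geo: "convex \<Omega>" "compact \<Omega>" "interior \<Omega> \<noteq> {}"
    and m: "m > real DIM('a) / 2"
    and K: "rkhs \<Omega> K H ip" and sob: "equals_sobolev m \<Omega> H ip"
    and M: "prob_space M"
    and \<sigma>: "\<sigma> > 0" and iid: "iid_errors M e \<sigma>"
    and des: "random_design M \<Omega> x" and ind: "design_indep_errors M x e"
    and cmp: "norm_comparison M \<Omega> H ip m x"
    and g: "g \<in> H"
    and \<delta>: "0 < \<delta>" "\<delta> \<le> 1"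
    and i: "\<exists>Cg>0. \<forall>v\<in>H.
           \<bar>ip g v\<bar> \<le> Cg * L2_norm_on \<Omega> v powr \<delta> * hnorm ip v powr (1 - \<delta>)"
    and \<tau>: "0 < \<tau>"
    and ii: "\<exists>C0>0. \<exists>R0>0. \<forall>R\<ge>R0.
           (SUP v\<in>{v \<in> H. hnorm ip v \<le> R * L2_norm_on \<Omega> v}. ip g v / L2_norm_on \<Omega> v)
             > C0 * R powr (1 - \<tau>)"
    and lam: "\<And>n. n \<ge> 1 \<Longrightarrow> lam n > 0" "lam \<longlonglongrightarrow> 0"
    and o: "(\<lambda>n. 1 / lam n) \<in>
            o(\<lambda>n. real n powr (2 * m / (real DIM('a) + 2 * m * (1 - \<delta> / \<tau>))))"
  shows "weak_conv_m
            (\<lambda>n. distr M borel (\<lambda>\<omega>.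
               1 / sqrt (VAR K g \<sigma> (lam n) n (\<lambda>i. x n i \<omega>)) *
               noise_functional K g (lam n) n (\<lambda>i. x n i \<omega>) (\<lambda>i. e i \<omega>)))
            std_normal_distribution"
proof -
  interpret prob_space M by (rule M)
  let ?d = "real DIM('a)"
  note fh = rkhs_hilbert[OF K]
  have Om [measurable]: "\<Omega> \<in> sets borel" using geo(2) by (simp add: borel_closed compact_imp_closed)
  have xm: "x n i \<in> borel_measurable M" if "i < n" for n i
    using des that unfolding random_design_def by blast
  have xO: "x n i \<omega> \<in> \<Omega>" if "i < n" "\<omega> \<in> space M" for n i \<omega>
    using des that unfolding random_design_def by blast
  have em: "e i \<in> borel_measurable M" for i using iid unfolding iid_errors_def indep_vars_def by auto
  have cont: "continuous_on \<Omega> v" if "v \<in> H" for v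
    using that sobolev_space_on_continuous sob unfolding equals_sobolev_def by blast

  have Kcont: "continuous_on \<Omega> (\<lambda>x. K x y)" if "y \<in> \<Omega>" for y
    by (rule continuous_on_eq[OF cont[OF rkhs_section[OF K that]]]) (simp add: kernel_section_def)
  have Kcont': "continuous_on \<Omega> (\<lambda>y. K x y)" if "x \<in> \<Omega>" for x
    by (rule continuous_on_eq[OF Kcont[OF that]]) (rule rkhs_kernel_sym[OF K _ that])
  \<comment> \<open>The kernel is arbitrary off \<open>\<Omega>\<close>; cutting it off there makes it measurable on the whole space.\<close>
  define K' where "K' a b = (if a \<in> \<Omega> \<and> b \<in> \<Omega> then K a b else 0)" for a b
  have K'm: "(\<lambda>p. K' (fst p) (snd p)) \<in> borel_measurable (borel \<Otimes>\<^sub>M borel)"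
    unfolding K'_def by (rule separately_continuous_measurable[OF Om Kcont Kcont'])
  have gm: "g \<in> borel_measurable borel"
  proof -
    have "(\<lambda>x. indicator \<Omega> x *\<^sub>R g x) \<in> borel_measurable borel"
      by (rule borel_measurable_continuous_on_indicator[OF Om cont[OF g]])
    moreover have "g y = 0" if "y \<notin> \<Omega>" for y
      using fh g that unfolding function_hilbert_space_def by blast
    then have "indicator \<Omega> y *\<^sub>R g y = g y" for y by (cases "y \<in> \<Omega>") auto
    then have "(\<lambda>x. indicator \<Omega> x *\<^sub>R g x) = g" by (rule ext)
    ultimately show ?thesis by simp
  qed

  define w where "w n z = ridge_weight K' g (lam n) n z" for n and z :: "nat \<Rightarrow> 'a"
  define F where "F n z = (\<lambda>i\<in>{..<n}. w n z i / (\<sigma> * sqrt (\<Sum>j<n. (w n z j)\<^sup>2)))" for n z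
  define X where "X n \<omega> = (\<lambda>i\<in>{..<n}. x n i \<omega>)" for n \<omega>
  define U where "U n i \<omega> = F n (X n \<omega>) i" for n i \<omega>
  have wX: "w n (X n \<omega>) i = ridge_weight K g (lam n) n (\<lambda>i. x n i \<omega>) i" if "\<omega> \<in> space M" for n \<omega> i
    unfolding w_def X_def using that xO by (intro ridge_weight_cong) (auto simp: K'_def)
  have Xm: "X n \<in> M \<rightarrow>\<^sub>M (\<Pi>\<^sub>M i\<in>{..<n}. borel)" for n
    unfolding X_def using xm by (intro measurable_restrict) auto
  have Em: "(\<lambda>\<omega>. \<lambda>i\<in>{..<n}. e i \<omega>) \<in> M \<rightarrow>\<^sub>M (\<Pi>\<^sub>M i\<in>{..<n}. borel)" for n
    using em by (intro measurable_restrict) auto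
  have wm: "(\<lambda>z. w n z i) \<in> borel_measurable (\<Pi>\<^sub>M i\<in>{..<n}. borel)" if "i < n" for n i
    unfolding w_def
  proof (rule measurable_ridge_weight)
    fix i j assume ij: "i < n" "j < n"
    have "(\<lambda>z. (z i, z j)) \<in> (\<Pi>\<^sub>M i\<in>{..<n}. borel) \<rightarrow>\<^sub>M (borel :: 'a measure) \<Otimes>\<^sub>M (borel :: 'a measure)"
      using ij by (intro measurable_Pair measurable_component_singleton) auto
    from measurable_compose[OF this K'm]
    show "(\<lambda>z. K' (z i) (z j)) \<in> borel_measurable (\<Pi>\<^sub>M i\<in>{..<n}. borel)" by simp
  next
    fix i assume "i < n"
    then show "(\<lambda>z. g (z i)) \<in> borel_measurable (\<Pi>\<^sub>M i\<in>{..<n}. borel)"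
      by (intro measurable_compose[OF _ gm] measurable_component_singleton) auto
  qed (rule that)
  have Fm: "F n \<in> (\<Pi>\<^sub>M i\<in>{..<n}. borel) \<rightarrow>\<^sub>M (\<Pi>\<^sub>M i\<in>{..<n}. borel)" for n
  proof -
    have [measurable]: "(\<lambda>z. \<Sum>j<n. (w n z j)\<^sup>2) \<in> borel_measurable (\<Pi>\<^sub>M i\<in>{..<n}. borel)"
      by (intro borel_measurable_sum borel_measurable_power wm) auto
    have "(\<lambda>z. \<sigma> * sqrt (\<Sum>j<n. (w n z j)\<^sup>2)) \<in> borel_measurable (\<Pi>\<^sub>M i\<in>{..<n}. borel)" by measurable
    then show ?thesis unfolding F_def by (intro measurable_restrict borel_measurable_divide wm) auto
  qed
  have indU: "indep_var (\<Pi>\<^sub>M i\<in>{..<n}. borel) (\<lambda>\<omega>. \<lambda>i\<in>{..<n}. U n i \<omega>) (\<Pi>\<^sub>M i\<in>{..<n}. borel) (\<lambda>\<omega>. \<lambda>i\<in>{..<n}. e i \<omega>)" for n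
  proof -
    have "indep_var (\<Pi>\<^sub>M i\<in>{..<n}. borel) (\<lambda>\<omega>. F n (X n \<omega>)) (\<Pi>\<^sub>M i\<in>{..<n}. borel) (\<lambda>\<omega>. \<lambda>i\<in>{..<n}. e i \<omega>)"
      using ind unfolding design_indep_errors_def X_def[symmetric]
      by (intro indep_var_of_indep_vimage[OF _ Xm Em Fm]) blast
    moreover have "(\<lambda>\<omega>. F n (X n \<omega>)) = (\<lambda>\<omega>. \<lambda>i\<in>{..<n}. U n i \<omega>)"
      unfolding U_def F_def by (intro ext) simp
    ultimately show ?thesis by simp
  qed

  obtain Cg where Cg: "Cg > 0" and iv: "\<And>v. v \<in> H \<Longrightarrow> \<bar>ip g v\<bar> \<le> Cg * L2_norm_on \<Omega> v powr \<delta> * hnorm ip v powr (1 - \<delta>)"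
    using i by blast
  obtain C0 R0 where C0: "C0 > 0" and R0: "R0 > 0" and sup: "\<And>R. R \<ge> R0 \<Longrightarrow>
     (SUP v\<in>{v \<in> H. hnorm ip v \<le> R * L2_norm_on \<Omega> v}. ip g v / L2_norm_on \<Omega> v) > C0 * R powr (1 - \<tau>)"
    using ii by blast
  have Rpos: "R > 0" if "R \<ge> R0" for R using that R0 by linarith
  note wit = sup_condition_witness[OF fh iv Cg \<delta>(2) Rpos sup]
  have "\<delta> \<le> \<tau>"
    by (rule smoothness_exponents_le[OF C0 Cg, of R0]) (rule wit(2))
  define q where "q = \<delta> / \<tau>"
  have q: "0 < q" "q \<le> 1" unfolding q_def using \<delta> \<tau> \<open>\<delta> \<le> \<tau>\<close> by auto
  obtain S where S: "S > 0" "\<And>v y h. v \<in> H \<Longrightarrow> y \<in> \<Omega> \<Longrightarrow> 0 < h \<and> h \<le> 1 \<Longrightarrow>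
      \<bar>v y\<bar> \<le> S * (h powr (- ?d / 2) * L2_norm_on \<Omega> v + h powr (m - ?d / 2) * hnorm ip v)"
    by (rule rkhs_sobolev_pointwise_bound[OF geo m sob fh]) (rule that; assumption)
  define ev where "ev C1 Ce n = {\<omega> \<in> space M. \<forall>v\<in>H.
      L2_norm_on \<Omega> v \<le> max (C1 * empirical_norm n (\<lambda>i. x n i \<omega>) v)
                           (Ce * real n powr (- m / ?d) * hnorm ip v) \<and>
      empirical_norm n (\<lambda>i. x n i \<omega>) v \<le> max (C1 * L2_norm_on \<Omega> v)
                           (Ce * real n powr (- m / ?d) * hnorm ip v)}" for C1 Ce n
  obtain C1 where "C1 > 0 \<and> (\<forall>\<epsilon>>0. \<exists>Ce>0. \<forall>n\<ge>1. prob (ev C1 Ce n) \<ge> 1 - \<epsilon>)"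
    using cmp unfolding norm_comparison_def ev_def by (rule exE)
  then have C1: "C1 > 0"
    and cmpe: "\<And>\<epsilon>. \<epsilon> > 0 \<Longrightarrow> \<exists>Ce>0. \<forall>n\<ge>1. prob (ev C1 Ce n) \<ge> 1 - \<epsilon>"
    by simp_all

  have small: "\<forall>\<^sub>F n in sequentially. \<exists>A\<in>sets M. prob A \<ge> 1 - \<epsilon> \<and>
        (\<forall>\<omega>\<in>A. \<sigma>\<^sup>2 * (\<Sum>i<n. (U n i \<omega>)\<^sup>2) = 1 \<and> (\<forall>i<n. \<bar>U n i \<omega>\<bar> \<le> \<eta>))"
    if \<epsilon>: "\<epsilon> > 0" and \<eta>: "\<eta> > 0" for \<epsilon> \<eta>
  proof -
    \<comment> \<open>A set that is not measurable has measure \<open>0\<close>; a bound \<open>1 - \<epsilon>' > 0\<close> makes the event measurable.\<close>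
    define \<epsilon>' where "\<epsilon>' = min \<epsilon> (1/2)"
    have \<epsilon>': "\<epsilon>' > 0" "\<epsilon>' \<le> \<epsilon>" "\<epsilon>' < 1" using \<epsilon> by (auto simp: \<epsilon>'_def)
    obtain Ce where Ce: "Ce > 0" and ev: "\<And>n. n \<ge> 1 \<Longrightarrow> prob (ev C1 Ce n) \<ge> 1 - \<epsilon>'"
      using cmpe[OF \<epsilon>'(1)] by blast
    define C where "C = max C1 Ce"
    have C: "C > 0" using C1 by (simp add: C_def)
    define B where "B = Cg * C powr \<delta>"
    have B: "B > 0" using Cg C by (simp add: B_def)
    \<comment> \<open>chosen such that \<open>B * lam n powr (\<delta> / 2) * R n powr \<tau> \<le> C0 / 2\<close>; the first two factors bound \<open>|r|_H\<close>\<close>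
    define c where "c = (C0 / (2 * B)) powr (1 / \<tau>)"
    have c: "c > 0" using C0 B by (simp add: c_def)
    define R where "R n = min (real n powr (m / ?d)) (c * lam n powr (- q / 2))" for n
    have d0: "?d > 0" by simp
    note o' = o[folded q_def]
    have rates: "\<forall>\<^sub>F n in sequentially. real n powr (- m / ?d) \<le> sqrt (lam n)"
      "filterlim R at_top sequentially"
      "(\<lambda>n. real n powr (- m / ?d) / (lam n * R n)) \<longlonglongrightarrow> 0"
      unfolding R_def by (rule ridge_rates[OF _ lam(2) d0 m q c o']; rule lam(1); assumption)+
    define Q where "Q n = C * (real n powr (- m / ?d) / (lam n * R n))" for n
    have Q0: "Q \<longlonglongrightarrow> 0"
      using tendsto_mult_right_zero[OF rates(3), of C] unfolding Q_def .
    define \<beta> where "\<beta> = \<sigma> * \<eta> / (4 * S * C)"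
    have \<beta>: "\<beta> > 0" unfolding \<beta>_def using \<sigma> \<eta> S(1) C by simp
    \<comment> \<open>chosen such that the leading term \<open>S * T powr (- ?d / 2) * C\<close> equals \<open>\<sigma> * \<eta> / 4\<close>\<close>
    define T where "T = \<beta> powr (- 2 / ?d)"
    have T: "T > 0" unfolding T_def using \<beta> by simp
    have Td: "T powr (- ?d / 2) = \<beta>"
      unfolding T_def powr_powr using \<beta> by simp
    have "S * (\<beta> * (C * (1 + 0)) + T powr (m - ?d / 2) * 0) = \<sigma> * \<eta> / 4"
      unfolding \<beta>_def using S(1) C by simp
    moreover have "(\<lambda>n. S * (T powr (- ?d / 2) * (C * (1 + Q n)) + T powr (m - ?d / 2) * Q n))
       \<longlonglongrightarrow> S * (\<beta> * (C * (1 + 0)) + T powr (m - ?d / 2) * 0)"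
      unfolding Td by (intro tendsto_mult tendsto_add tendsto_const Q0)
    ultimately have "(\<lambda>n. S * (T powr (- ?d / 2) * (C * (1 + Q n)) + T powr (m - ?d / 2) * Q n)) \<longlonglongrightarrow> \<sigma> * \<eta> / 4"
      by (simp only:)
    then have E1: "\<forall>\<^sub>F n in sequentially. S * (T powr (- ?d / 2) * (C * (1 + Q n)) + T powr (m - ?d / 2) * Q n) < \<sigma> * \<eta>"
      by (rule order_tendstoD(2)) (use \<sigma> \<eta> in simp)
    have "(\<lambda>n. T * real n powr (- 1 / ?d)) \<longlonglongrightarrow> T * 0"
      by (intro tendsto_mult tendsto_const tendsto_neg_powr filterlim_real_sequentially) simp
    then have E2: "\<forall>\<^sub>F n in sequentially. T * real n powr (- 1 / ?d) < 1"
      by (rule order_tendstoD(2)) simp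
    have E3: "\<forall>\<^sub>F n in sequentially. R0 \<le> R n" using rates(2) by (simp add: filterlim_at_top)
    have E4: "\<forall>\<^sub>F n in sequentially. n \<ge> (1::nat)" by (rule eventually_ge_at_top)
    show ?thesis using E1 E2 E3 E4 rates(1)
    proof eventually_elim
      case (elim n)
      define A where "A = ev C1 Ce n"
      have PA: "prob A \<ge> 1 - \<epsilon>'" unfolding A_def by (rule ev[OF elim(4)])
      have AM: "A \<in> sets M"
      proof (rule ccontr)
        assume "A \<notin> sets M"
        then have "prob A = 0" by (rule measure_notin_sets)
        then show False using PA \<epsilon>'(3) by simp
      qed
      have l: "lam n > 0" by (rule lam(1)[OF elim(4)])
      have np: "real n > 0" using elim(4) by simp
      have Rn: "R n > 0" by (rule Rpos[OF elim(3)])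
      have RN: "R n * real n powr (- m / ?d) \<le> 1"
      proof -
        have "R n * real n powr (- m / ?d) \<le> real n powr (m / ?d) * real n powr (- m / ?d)"
          unfolding R_def by (intro mult_right_mono) auto
        also have "\<dots> = 1" using np by (simp add: powr_add[symmetric])
        finally show ?thesis .
      qed
      have RB: "Cg * C powr \<delta> * lam n powr (\<delta> / 2) * R n powr \<tau> \<le> C0 / 2"
      proof -
        have "R n powr \<tau> \<le> (c * lam n powr (- q / 2)) powr \<tau>"
          using Rn \<tau> unfolding R_def by (intro powr_mono2) auto
        also have "\<dots> = c powr \<tau> * lam n powr (- \<delta> / 2)"
          using c l \<tau> by (simp add: powr_mult powr_powr q_def)
        also have "c powr \<tau> = C0 / (2 * B)" unfolding c_def powr_powr using \<tau> C0 B by simp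
        finally have "B * lam n powr (\<delta> / 2) * R n powr \<tau> \<le> B * lam n powr (\<delta> / 2) * (C0 / (2 * B) * lam n powr (- \<delta> / 2))"
          using B by (intro mult_left_mono) auto
        also have "\<dots> = C0 / 2 * (lam n powr (\<delta> / 2) * lam n powr (- \<delta> / 2))" using B by simp
        also have "lam n powr (\<delta> / 2) * lam n powr (- \<delta> / 2) = 1" using l by (simp add: powr_add[symmetric])
        finally show ?thesis unfolding B_def by simp
      qed
      obtain v where v: "v \<in> H" "hnorm ip v \<le> R n * L2_norm_on \<Omega> v" "ip g v / L2_norm_on \<Omega> v > C0 * R n powr (1 - \<tau>)"
        using wit(1)[OF _ elim(3) elim(3)] by blast
      have "\<sigma>\<^sup>2 * (\<Sum>i<n. (U n i \<omega>)\<^sup>2) = 1 \<and> (\<forall>i<n. \<bar>U n i \<omega>\<bar> \<le> \<eta>)" if \<omega>: "\<omega> \<in> A" for \<omega>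
      proof -
        have \<omega>M: "\<omega> \<in> space M" using \<omega> by (simp add: A_def ev_def)
        let ?z = "\<lambda>i. x n i \<omega>"
        let ?w = "ridge_weight K g (lam n) n ?z"
        have c1: "L2_norm_on \<Omega> v \<le> max (C1 * empirical_norm n ?z v) (Ce * real n powr (- m / ?d) * hnorm ip v)"
          and c2: "empirical_norm n ?z v \<le> max (C1 * L2_norm_on \<Omega> v) (Ce * real n powr (- m / ?d) * hnorm ip v)"
          if "v \<in> H" for v using \<omega> that by (auto simp: A_def ev_def)
        note sm = ridge_weights_small[OF K g xO[OF _ \<omega>M] elim(4) l S c1 c2 C1 Ce C_def iv Cg \<delta> elim(5) v C0 Rn RN RB
            T less_imp_le[OF elim(2)] Q_def less_imp_le[OF elim(1)]]
        define s where "s = (\<Sum>j<n. (?w j)\<^sup>2)"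
        have s: "s > 0" unfolding s_def by (rule sm(1)) simp_all
        have Ui: "U n i \<omega> = ?w i / (\<sigma> * sqrt s)" if "i < n" for i
          using that unfolding U_def F_def s_def by (simp add: wX[OF \<omega>M])
        have "(\<Sum>i<n. (U n i \<omega>)\<^sup>2) = (\<Sum>i<n. (?w i)\<^sup>2 / (\<sigma>\<^sup>2 * s))"
          using s by (intro sum.cong refl) (simp add: Ui power_divide power_mult_distrib)
        also have "\<dots> = s / (\<sigma>\<^sup>2 * s)" unfolding s_def by (rule sum_divide_distrib[symmetric])
        finally have "\<sigma>\<^sup>2 * (\<Sum>i<n. (U n i \<omega>)\<^sup>2) = 1" using s \<sigma> by simp
        moreover have "\<bar>U n i \<omega>\<bar> \<le> \<eta>" if "i < n" for i
        proof -
          have "\<bar>?w i\<bar> \<le> \<sigma> * \<eta> * sqrt s" unfolding s_def by (rule sm(2)) (use that in simp_all)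
          then show ?thesis unfolding Ui[OF that] using s \<sigma> by (simp add: abs_mult divide_le_eq mult_ac)
        qed
        ultimately show ?thesis by blast
      qed
      then show ?case using AM PA \<epsilon>'(2) by (intro bexI[of _ A]) auto
    qed
  qed

  have conv: "weak_conv_m (\<lambda>n. distr M borel (\<lambda>\<omega>. \<Sum>i<n. U n i \<omega> * e i \<omega>)) std_normal_distribution"
    by (rule random_weights_clt[OF iid \<sigma> indU small])
  have eq: "distr M borel (\<lambda>\<omega>. \<Sum>i<n. U n i \<omega> * e i \<omega>) =
      distr M borel (\<lambda>\<omega>. 1 / sqrt (VAR K g \<sigma> (lam n) n (\<lambda>i. x n i \<omega>)) *
               noise_functional K g (lam n) n (\<lambda>i. x n i \<omega>) (\<lambda>i. e i \<omega>))" if n: "n \<ge> 1" for n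
  proof (intro distr_cong refl)
    fix \<omega> assume \<omega>: "\<omega> \<in> space M"
    let ?w = "ridge_weight K g (lam n) n (\<lambda>i. x n i \<omega>)"
    have xz: "\<And>i. i < n \<Longrightarrow> x n i \<omega> \<in> \<Omega>" using xO \<omega> by blast
    have V: "sqrt (VAR K g \<sigma> (lam n) n (\<lambda>i. x n i \<omega>)) = \<sigma> * sqrt (\<Sum>i<n. (?w i)\<^sup>2)"
      by (subst VAR_eq[OF K xz lam(1)[OF n] n]) (use \<sigma> in \<open>simp_all add: real_sqrt_mult\<close>)
    have Nf: "noise_functional K g (lam n) n (\<lambda>i. x n i \<omega>) (\<lambda>i. e i \<omega>) = (\<Sum>i<n. ?w i * e i \<omega>)"
      by (rule noise_functional_eq[OF K xz lam(1)[OF n] n])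
    show "(\<Sum>i<n. U n i \<omega> * e i \<omega>) = 1 / sqrt (VAR K g \<sigma> (lam n) n (\<lambda>i. x n i \<omega>)) *
               noise_functional K g (lam n) n (\<lambda>i. x n i \<omega>) (\<lambda>i. e i \<omega>)"
      unfolding V Nf sum_distrib_left
      by (intro sum.cong refl) (simp add: U_def F_def wX[OF \<omega>])
  qed
  show ?thesis
    unfolding weak_conv_m_def weak_conv_def
  proof (intro allI impI)
    fix t assume "isCont (cdf std_normal_distribution) t"
    with conv have "(\<lambda>n. cdf (distr M borel (\<lambda>\<omega>. \<Sum>i<n. U n i \<omega> * e i \<omega>)) t) \<longlonglongrightarrow> cdf std_normal_distribution t"
      unfolding weak_conv_m_def weak_conv_def by blast
    then show "(\<lambda>n. cdf (distr M borel (\<lambda>\<omega>. 1 / sqrt (VAR K g \<sigma> (lam n) n (\<lambda>i. x n i \<omega>)) *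
               noise_functional K g (lam n) n (\<lambda>i. x n i \<omega>) (\<lambda>i. e i \<omega>))) t) \<longlonglongrightarrow> cdf std_normal_distribution t"
      by (rule Lim_transform_eventually)
        (use eq in \<open>auto simp: eventually_sequentially intro!: exI[of _ 1]\<close>)
  qed
qed

theorem theorem6:
  fixes \<Omega> :: "'a::euclidean_space set"
    and K :: "'a \<Rightarrow> 'a \<Rightarrow> real"
    and H :: "('a \<Rightarrow> real) set"
    and ip :: "('a \<Rightarrow> real) \<Rightarrow> ('a \<Rightarrow> real) \<Rightarrow> real"
    and g :: "'a \<Rightarrow> real"
    and M :: "'w measure"
    and x :: "nat \<Rightarrow> nat \<Rightarrow> 'w \<Rightarrow> 'a"
    and e :: "nat \<Rightarrow> 'w \<Rightarrow> real"
    and lam :: "nat \<Rightarrow> real"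
    and m \<sigma> \<delta> \<tau> :: real
  assumes "convex \<Omega>" and "compact \<Omega>" and "interior \<Omega> \<noteq> {}"
    and "m > real DIM('a) / 2"
    and "rkhs \<Omega> K H ip" and "equals_sobolev m \<Omega> H ip"
    and "prob_space M"
    and "\<sigma> > 0" and "iid_errors M e \<sigma>"
    and "random_design M \<Omega> x" and "design_indep_errors M x e"
    and "norm_comparison M \<Omega> H ip m x"
    and "g \<in> H" and "g \<noteq> (\<lambda>y. 0)"
    and "0 < \<delta>" and "\<delta> \<le> 1"
    and "\<exists>Cg>0. \<forall>v\<in>H.
           \<bar>ip g v\<bar> \<le> Cg * L2_norm_on \<Omega> v powr \<delta> * hnorm ip v powr (1 - \<delta>)"
    and "0 < \<tau>" and "\<tau> \<le> 1"
    and "\<exists>C0>0. \<exists>R0>0. \<forall>R\<ge>R0.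
           (SUP v\<in>{v \<in> H. hnorm ip v \<le> R * L2_norm_on \<Omega> v}. ip g v / L2_norm_on \<Omega> v)
             > C0 * R powr (1 - \<tau>)"
    and "\<And>n. n \<ge> 1 \<Longrightarrow> lam n > 0"
    and "lam \<longlonglongrightarrow> 0"
  shows "((\<lambda>n. 1 / lam n) \<in>
            o(\<lambda>n. real n powr (2 * m / (real DIM('a) + 2 * m * (1 - \<delta> / \<tau>)))) \<longrightarrow>
          weak_conv_m
            (\<lambda>n. distr M borel (\<lambda>\<omega>.
               1 / sqrt (VAR K g \<sigma> (lam n) n (\<lambda>i. x n i \<omega>)) *
               noise_functional K g (lam n) n (\<lambda>i. x n i \<omega>) (\<lambda>i. e i \<omega>)))
            std_normal_distribution) \<and>
         (\<delta> = \<tau> \<and> (\<lambda>n. 1 / lam n) \<in> o(\<lambda>n. real n powr (2 * m / real DIM('a))) \<longrightarrow>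
          weak_conv_m
            (\<lambda>n. distr M borel (\<lambda>\<omega>.
               1 / sqrt (VAR K g \<sigma> (lam n) n (\<lambda>i. x n i \<omega>)) *
               noise_functional K g (lam n) n (\<lambda>i. x n i \<omega>) (\<lambda>i. e i \<omega>)))
            std_normal_distribution)"
proof (intro conjI impI)
  note main = ridge_functional_weak_convergence[OF assms(1-13,15-18,20) _ assms(22)]
  let ?T = "\<lambda>n \<omega>. 1 / sqrt (VAR K g \<sigma> (lam n) n (\<lambda>i. x n i \<omega>)) *
      noise_functional K g (lam n) n (\<lambda>i. x n i \<omega>) (\<lambda>i. e i \<omega>)"
  {
    assume "(\<lambda>n. 1 / lam n) \<in>
        o(\<lambda>n. real n powr (2 * m / (real DIM('a) + 2 * m * (1 - \<delta> / \<tau>))))"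
    then show "weak_conv_m (\<lambda>n. distr M borel (?T n)) std_normal_distribution"
      by (intro main) (auto intro: assms(21))
  next
    assume a: "\<delta> = \<tau> \<and> (\<lambda>n. 1 / lam n) \<in> o(\<lambda>n. real n powr (2 * m / real DIM('a)))"
    then have "2 * m / (real DIM('a) + 2 * m * (1 - \<delta> / \<tau>)) = 2 * m / real DIM('a)"
      using assms(18) by simp
    with a show "weak_conv_m (\<lambda>n. distr M borel (?T n)) std_normal_distribution"
      by (intro main) (auto intro: assms(21))
  }
qed

end
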